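(* If Boolean-OMv can be solved in time $O(n^{3-\varepsilon})$ for some $\varepsilon>0$, then $\exists$Equality-OMv can be solved in time $O(n^{3-\varepsilon/2})$.
   Context: Both problems are online: an $n\times n$ matrix $M$ is given for preprocessing, then $n$ query column vectors $v_1,\dots,v_n$ arrive one at a time and the answer to query $j$ must be output before $v_{j+1}$ is received; running time counts preprocessing and all queries. Boolean-OMv: $M\in\{0,1\}^{n\times n}$, $v_j\in\{0,1\}^n$, output $u\in\{0,1\}^n$ with $u[i]=1$ iff $\exists k\in[n]$: $M[i,k]=v_j[k]=1$. $\exists$Equality-OMv: $M\in\mathbb{Z}^{n\times n}$, $v_j\in\mathbb{Z}^n$, output $u\in\{0,1\}^n$ with $u[i]=1$ iff $\exists k\in[n]$: $M[i,k]=v_j[k]$. *)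

theory Defs
  imports Complex_Main "HOL-Library.Landau_Symbols" "Jordan_Normal_Form.Matrix"
begin

section \<open>A word RAM with structured control flow\<close>

text \<open>
  A program uses finitely many registers and a zero-initialised memory whose cells are addressed by
  register contents. Every elementary operation and every branch test costs one step. The parameter
  \<open>b\<close> of the semantics is the word length (up to the sign bit): an operation whose result is not a
  word has no execution, so an execution for \<open>b\<close> is an overflow-free one, and it is also an execution
  for every larger word length.
\<close>

definition words :: "nat \<Rightarrow> int set" where
  "words b = {- (2 ^ b)..<2 ^ b}"

datatype bop = Add | Sub | Mul | Div | Mod | BitAnd | BitOr | BitXor | Shl | Shr | Less | Eq

fun bop_val :: "bop \<Rightarrow> int \<Rightarrow> int \<Rightarrow> int" where
  "bop_val Add x y = x + y"
| "bop_val Sub x y = x - y"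
| "bop_val Mul x y = x * y"
| "bop_val Div x y = x div y"
| "bop_val Mod x y = x mod y"
| "bop_val BitAnd x y = Bit_Operations.and x y"
| "bop_val BitOr x y = Bit_Operations.or x y"
| "bop_val BitXor x y = Bit_Operations.xor x y"
| "bop_val Shl x y = push_bit (nat y) x"
| "bop_val Shr x y = drop_bit (nat y) x"
| "bop_val Less x y = of_bool (x < y)"
| "bop_val Eq x y = of_bool (x = y)"

type_synonym reg = nat

datatype com =
    Skip
  | Const reg int
  | Op bop reg reg reg
  | Load reg reg
  | Store reg reg
  | Seq com com
  | If reg com com
  | While reg com

type_synonym state = "(reg \<Rightarrow> int) \<times> (nat \<Rightarrow> int)"

text \<open>\<open>exec b p s t s'\<close>: from state \<open>s\<close>, program \<open>p\<close> halts in state \<open>s'\<close> after exactly \<open>t\<close> steps.\<close>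

inductive exec :: "nat \<Rightarrow> com \<Rightarrow> state \<Rightarrow> nat \<Rightarrow> state \<Rightarrow> bool" for b where
  Skip: "exec b Skip s 1 s"
| Const: "k \<in> words b \<Longrightarrow> exec b (Const r k) (R, m) 1 (R(r := k), m)"
| Op: "bop_val f (R r1) (R r2) \<in> words b \<Longrightarrow>
    exec b (Op f r r1 r2) (R, m) 1 (R(r := bop_val f (R r1) (R r2)), m)"
| Load: "0 \<le> R a \<Longrightarrow> exec b (Load r a) (R, m) 1 (R(r := m (nat (R a))), m)"
| Store: "0 \<le> R a \<Longrightarrow> exec b (Store a r) (R, m) 1 (R, m(nat (R a) := R r))"
| Seq: "exec b p s t s' \<Longrightarrow> exec b q s' t' s'' \<Longrightarrow> exec b (Seq p q) s (t + t') s''"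
| IfTrue: "fst s r \<noteq> 0 \<Longrightarrow> exec b p s t s' \<Longrightarrow> exec b (If r p q) s (1 + t) s'"
| IfFalse: "fst s r = 0 \<Longrightarrow> exec b q s t s' \<Longrightarrow> exec b (If r p q) s (1 + t) s'"
| WhileFalse: "fst s r = 0 \<Longrightarrow> exec b (While r p) s 1 s"
| WhileTrue: "fst s r \<noteq> 0 \<Longrightarrow> exec b p s t s' \<Longrightarrow> exec b (While r p) s' t' s'' \<Longrightarrow>
    exec b (While r p) s (1 + t + t') s''"


section \<open>Online matrix-vector problems\<close>

text \<open>
  Memory layout: the matrix occupies cells \<open>0..<n\<^sup>2\<close> in row-major order, the current query vector
  cells \<open>n\<^sup>2..<n\<^sup>2 + n\<close>, and the answer is read off cells \<open>n\<^sup>2 + n..<n\<^sup>2 + 2 * n\<close>. The dimension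
  is initially in register 0.
\<close>

definition init_state :: "nat \<Rightarrow> int mat \<Rightarrow> state" where
  "init_state n M =
    ((\<lambda>_. 0)(0 := int n), \<lambda>a. if a < n * n then M $$ (a div n, a mod n) else 0)"

definition put_query :: "nat \<Rightarrow> int vec \<Rightarrow> state \<Rightarrow> state" where
  "put_query n v s =
    (fst s, \<lambda>a. if a \<in> {n * n..<n * n + n} then v $ (a - n * n) else snd s a)"

definition read_answer :: "nat \<Rightarrow> state \<Rightarrow> int vec" where
  "read_answer n s = vec n (\<lambda>i. snd s (n * n + n + i))"

text \<open>
  \<open>serves b query n ans s vs t\<close>: started in state \<open>s\<close>, the query program answers the queries \<open>vs\<close>
  correctly in \<open>t\<close> steps overall. A query vector is written into memory only after the preceding
  query has been answered; all other memory and the registers persist between queries.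
\<close>

inductive serves ::
  "nat \<Rightarrow> com \<Rightarrow> nat \<Rightarrow> (int vec \<Rightarrow> int vec) \<Rightarrow> state \<Rightarrow> int vec list \<Rightarrow> nat \<Rightarrow> bool"
  for b query n ans where
  Nil: "serves b query n ans s [] 0"
| Cons: "exec b query (put_query n v s) t s' \<Longrightarrow> read_answer n s' = ans v \<Longrightarrow>
    serves b query n ans s' vs t' \<Longrightarrow> serves b query n ans s (v # vs) (t + t')"

text \<open>
  An online problem is given by the set \<open>D\<close> of admissible entries and the answer function \<open>ans\<close>.
  If \<open>n\<close> and all entries fit into \<open>w\<close> bits (up to sign), the algorithm may use words of \<open>c * w\<close> bits,
  for a constant \<open>c\<close> of the algorithm; for entries in \<open>{0, 1}\<close> these are words of \<open>O(log n)\<close> bits.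
  The step bound \<open>T n\<close> covers preprocessing and all \<open>n\<close> queries and must not depend on \<open>w\<close>.
\<close>

definition solves_online ::
  "int set \<Rightarrow> (int mat \<Rightarrow> int vec \<Rightarrow> int vec) \<Rightarrow> com \<Rightarrow> com \<Rightarrow> nat \<Rightarrow> (nat \<Rightarrow> nat) \<Rightarrow> bool" where
  "solves_online D ans pre query c T \<longleftrightarrow>
    (\<forall>n w M vs.
      n \<ge> 1 \<and> int n \<in> words w \<and>
      M \<in> carrier_mat n n \<and> elements_mat M \<subseteq> D \<inter> words w \<and>
      length vs = n \<and> (\<forall>v \<in> set vs. v \<in> carrier_vec n \<and> vec_set v \<subseteq> D \<inter> words w) \<longrightarrow>
      (\<exists>t0 s t. exec (c * w) pre (init_state n M) t0 s \<and>
        serves (c * w) query n (ans M) s vs t \<and> t0 + t \<le> T n))"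

definition solvable_in_time_O ::
  "int set \<Rightarrow> (int mat \<Rightarrow> int vec \<Rightarrow> int vec) \<Rightarrow> (nat \<Rightarrow> real) \<Rightarrow> bool" where
  "solvable_in_time_O D ans f \<longleftrightarrow>
    (\<exists>pre query c T. solves_online D ans pre query c T \<and> (\<lambda>n. real (T n)) \<in> O(f))"

definition boolean_answer :: "int mat \<Rightarrow> int vec \<Rightarrow> int vec" where
  "boolean_answer M v =
    vec (dim_row M) (\<lambda>i. if \<exists>k < dim_col M. M $$ (i, k) = 1 \<and> v $ k = 1 then 1 else 0)"

definition equality_answer :: "int mat \<Rightarrow> int vec \<Rightarrow> int vec" where
  "equality_answer M v =
    vec (dim_row M) (\<lambda>i. if \<exists>k < dim_col M. M $$ (i, k) = v $ k then 1 else 0)"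

definition Boolean_OMv_in_time_O :: "(nat \<Rightarrow> real) \<Rightarrow> bool" where
  "Boolean_OMv_in_time_O f \<longleftrightarrow> solvable_in_time_O {0, 1} boolean_answer f"

definition Ex_Equality_OMv_in_time_O :: "(nat \<Rightarrow> real) \<Rightarrow> bool" where
  "Ex_Equality_OMv_in_time_O f \<longleftrightarrow> solvable_in_time_O UNIV equality_answer f"

end

theory Submission
  imports Defs "HOL-Library.Log_Nat"
begin

text \<open>
  Sort every column and cut it into buckets of \<open>g\<close> consecutive ranks. Level \<open>j\<close> is the Boolean
  matrix marking the \<open>j\<close>-th bucket of each column. A query value selects the buckets that are
  constantly equal to it, which is a Boolean query on every level; at most two further buckets per
  column straddle the value, and these are scanned in \<open>O(g)\<close> steps. This costs \<open>n / g\<close> Boolean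
  instances and \<open>O(n\<^sup>2 g)\<close> steps of scanning, so \<open>g = n\<close> to the power \<open>1 - \<epsilon>/2\<close> is the right choice.

  No program can compute that \<open>g\<close>, since \<open>\<epsilon>\<close> may be an uncomputable real. Instead, the program
  counts the steps of the simulated Boolean instances and starts with \<open>g = 1\<close>. Once the count
  reaches \<open>g n\<^sup>2\<close>, it answers the current query by brute force, doubles \<open>g\<close> and builds new
  instances in untouched memory. Abandoning \<open>g\<close> means that \<open>n / g\<close> instances took \<open>g n\<^sup>2\<close> steps, so
  \<open>g\<close> never grows beyond the right order. That sorting is affordable follows from \<open>\<epsilon> \<le> 1\<close>: an
  algorithm for Boolean-OMv has to rewrite all answer cells when the queries alternate between
  all-ones and zero.
\<close>

inductive_cases exec_SkipE: "exec b Skip s t s'"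
inductive_cases exec_ConstE: "exec b (Const r k) s t s'"
inductive_cases exec_OpE: "exec b (Op f r r1 r2) s t s'"
inductive_cases exec_LoadE: "exec b (Load r a) s t s'"
inductive_cases exec_StoreE: "exec b (Store a r) s t s'"
inductive_cases exec_SeqE: "exec b (Seq p q) s t s'"
inductive_cases exec_IfE: "exec b (If r p q) s t s'"

lemma exec_deterministic:
  assumes "exec b p s t s'" "exec b p s u s''"
  shows "t = u \<and> s' = s''"
  using assms
proof (induction arbitrary: u s'' rule: exec.induct)
  case (WhileTrue s r p t s1 t' s2)
  from WhileTrue.prems obtain v v' s3
    where body: "exec b p s v s3" and "exec b (While r p) s3 v' s''" and "u = 1 + v + v'"
    by cases (use WhileTrue.hyps(1) in auto)
  moreover have "t = v \<and> s1 = s3" by (rule WhileTrue.IH(1)[OF body])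
  ultimately show ?case using WhileTrue.IH(2)[of v' s''] by simp
next
  case (WhileFalse s r p)
  from WhileFalse.prems show ?case by cases (use WhileFalse.hyps in auto)
next
  case (Seq p s t s1 q t' s2)
  from Seq.prems obtain v v' s3
    where first: "exec b p s v s3" and "exec b q s3 v' s''" and "u = v + v'"
    by (elim exec_SeqE) auto
  moreover have "t = v \<and> s1 = s3" by (rule Seq.IH(1)[OF first])
  ultimately show ?case using Seq.IH(2)[of v' s''] by simp
next
  case (IfTrue s r p t s' q)
  then obtain v where "exec b p s v s''" "u = 1 + v" by (elim exec_IfE) auto
  with IfTrue.IH show ?case by simp
next
  case (IfFalse s r q t s' p)
  then obtain v where "exec b q s v s''" "u = 1 + v" by (elim exec_IfE) auto
  with IfFalse.IH show ?case by simp
qed (auto elim: exec_SkipE exec_ConstE exec_OpE exec_LoadE exec_StoreE)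

lemma words_mono:
  assumes "b \<le> b'"
  shows "words b \<subseteq> words b'"
proof -
  have "(2::int) ^ b \<le> 2 ^ b'" using assms by (simp add: power_increasing)
  then show ?thesis unfolding words_def by auto
qed

lemma nonneg_in_words: "0 \<le> x \<Longrightarrow> x < 2 ^ b \<Longrightarrow> x \<in> words b"
  by (simp add: words_def order.trans[of _ 0])

lemma exec_mono_word_length: "exec b p s t s' \<Longrightarrow> b \<le> b' \<Longrightarrow> exec b' p s t s'"
  by (induction rule: exec.induct) (use words_mono in \<open>blast intro: exec.intros\<close>)+

lemma serves_mono_word_length:
  "serves b query n ans s vs t \<Longrightarrow> b \<le> b' \<Longrightarrow> serves b' query n ans s vs t"
  by (induction rule: serves.induct) (blast intro: serves.intros exec_mono_word_length)+

definition changed_cells :: "state \<Rightarrow> state \<Rightarrow> nat set" where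
  "changed_cells s s' = {a. snd s' a \<noteq> snd s a}"

lemma card_changed_cells_trans:
  assumes "finite (changed_cells s s') \<and> card (changed_cells s s') \<le> t"
    and "finite (changed_cells s' s'') \<and> card (changed_cells s' s'') \<le> t'"
  shows "finite (changed_cells s s'') \<and> card (changed_cells s s'') \<le> t + t'"
proof -
  have "changed_cells s s'' \<subseteq> changed_cells s s' \<union> changed_cells s' s''"
    by (auto simp: changed_cells_def)
  with assms show ?thesis
    by (meson add_mono card_Un_le card_mono finite_UnI finite_subset order_trans)
qed

lemma exec_changes_few_cells:
  "exec b p s t s' \<Longrightarrow> finite (changed_cells s s') \<and> card (changed_cells s s') \<le> t"
proof (induction rule: exec.induct)
  case (Store R a r m)
  have "changed_cells (R, m) (R, m(nat (R a) := R r)) \<subseteq> {nat (R a)}"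
    by (auto simp: changed_cells_def)
  then show ?case using card_mono[of "{nat (R a)}"] finite_subset by fastforce
next
  case (Seq p s t s' q t' s'')
  then show ?case by (intro card_changed_cells_trans)
next
  case (WhileTrue s r p t s' t' s'')
  then show ?case using card_changed_cells_trans[of s s' t s'' t'] by simp
qed (simp_all add: changed_cells_def)


section \<open>Expressions and weakest preconditions\<close>

datatype exp = Lit int | Var reg | BinOp bop exp exp | Deref exp

abbreviation Plus (infixl "+\<^sub>e" 65) where "e +\<^sub>e f \<equiv> BinOp Add e f"
abbreviation Minus (infixl "-\<^sub>e" 65) where "e -\<^sub>e f \<equiv> BinOp Sub e f"
abbreviation Times (infixl "*\<^sub>e" 70) where "e *\<^sub>e f \<equiv> BinOp Mul e f"
abbreviation Less_Than (infix "<\<^sub>e" 50) where "e <\<^sub>e f \<equiv> BinOp Less e f"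
abbreviation Equals (infix "=\<^sub>e" 50) where "e =\<^sub>e f \<equiv> BinOp Eq e f"

text \<open>Registers below \<open>nvars\<close> are program variables, the others hold intermediate results.\<close>

abbreviation nvars :: nat where "nvars \<equiv> 20"

type_synonym env = "reg \<Rightarrow> int"
type_synonym imem = "int \<Rightarrow> int"

fun val :: "exp \<Rightarrow> env \<Rightarrow> imem \<Rightarrow> int" where
  "val (Lit k) V m = k"
| "val (Var x) V m = V x"
| "val (BinOp f e1 e2) V m = bop_val f (val e1 V m) (val e2 V m)"
| "val (Deref e) V m = m (val e V m)"

fun safe :: "nat \<Rightarrow> exp \<Rightarrow> env \<Rightarrow> imem \<Rightarrow> bool" where
  "safe b (Lit k) V m \<longleftrightarrow> k \<in> words b"
| "safe b (Var x) V m \<longleftrightarrow> x < nvars"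
| "safe b (BinOp f e1 e2) V m \<longleftrightarrow>
    safe b e1 V m \<and> safe b e2 V m \<and> bop_val f (val e1 V m) (val e2 V m) \<in> words b"
| "safe b (Deref e) V m \<longleftrightarrow> safe b e V m \<and> 0 \<le> val e V m"

fun cost :: "exp \<Rightarrow> nat" where
  "cost (Lit k) = 1"
| "cost (Var x) = 1"
| "cost (BinOp f e1 e2) = cost e1 + cost e2 + 1"
| "cost (Deref e) = cost e + 1"

text \<open>
  \<open>code e d u\<close> leaves the value of \<open>e\<close> in register \<open>operand e d\<close> and uses the registers from \<open>u\<close>
  on as scratch space. A variable is its own operand because the machine cannot copy a register.
\<close>

fun operand :: "exp \<Rightarrow> reg \<Rightarrow> reg" where
  "operand (Var x) d = x"
| "operand e d = d"

notation Seq (infixr ";;" 60)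

fun code :: "exp \<Rightarrow> reg \<Rightarrow> reg \<Rightarrow> com" where
  "code (Lit k) d u = Const d k"
| "code (Var x) d u = Skip"
| "code (BinOp f e1 e2) d u =
    (code e1 u (Suc u) ;; code e2 (Suc u) (Suc (Suc u))) ;;
      Op f d (operand e1 u) (operand e2 (Suc u))"
| "code (Deref e) d u = code e u (Suc u) ;; Load d (operand e u)"

text \<open>Memory is indexed by integers here, so that no address needs a conversion.\<close>

definition represents :: "state \<Rightarrow> env \<Rightarrow> imem \<Rightarrow> bool" where
  "represents s V m \<longleftrightarrow> (\<forall>x < nvars. fst s x = V x) \<and> (\<forall>a. snd s a = m (int a))"

definition evaluates :: "nat \<Rightarrow> exp \<Rightarrow> env \<Rightarrow> imem \<Rightarrow> bool" where
  "evaluates b e V m \<longleftrightarrow> (\<forall>d u s. represents s V m \<and> nvars \<le> u \<longrightarrow>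
    (\<exists>s'. exec b (code e d u) s (cost e) s' \<and> fst s' (operand e d) = val e V m \<and>
      snd s' = snd s \<and> (\<forall>x < u. x \<noteq> d \<longrightarrow> fst s' x = fst s x)))"

lemma evaluatesE:
  assumes "evaluates b e V m" "represents s V m" "nvars \<le> u"
  obtains s' where "exec b (code e d u) s (cost e) s'" "fst s' (operand e d) = val e V m"
    "snd s' = snd s" "\<And>x. x < u \<Longrightarrow> x \<noteq> d \<Longrightarrow> fst s' x = fst s x"
  using assms unfolding evaluates_def by meson

lemma represents_frame:
  assumes "represents s V m" "snd s' = snd s" "\<And>x. x < nvars \<Longrightarrow> fst s' x = fst s x"
  shows "represents s' V m"
  using assms by (simp add: represents_def)

lemma operand_less: "safe b e V m \<Longrightarrow> nvars \<le> d \<Longrightarrow> operand e d \<le> d"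
  by (cases e) auto

lemma evaluates_operands:
  assumes "evaluates b e1 V m" "evaluates b e2 V m" "safe b e1 V m" "represents s V m" "nvars \<le> u"
  obtains s' where
    "exec b (code e1 u (Suc u) ;; code e2 (Suc u) (Suc (Suc u))) s (cost e1 + cost e2) s'"
    "fst s' (operand e1 u) = val e1 V m" "fst s' (operand e2 (Suc u)) = val e2 V m"
    "snd s' = snd s" "\<And>x. x < u \<Longrightarrow> fst s' x = fst s x"
proof -
  obtain s1 where left: "exec b (code e1 u (Suc u)) s (cost e1) s1"
    "fst s1 (operand e1 u) = val e1 V m" "snd s1 = snd s"
    "\<And>x. x < Suc u \<Longrightarrow> x \<noteq> u \<Longrightarrow> fst s1 x = fst s x"
    by (rule evaluatesE[OF assms(1,4), of "Suc u" u]) (use assms(5) in auto)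
  have rep: "represents s1 V m" by (rule represents_frame[OF assms(4)]) (use left assms(5) in auto)
  obtain s2 where right: "exec b (code e2 (Suc u) (Suc (Suc u))) s1 (cost e2) s2"
    "fst s2 (operand e2 (Suc u)) = val e2 V m" "snd s2 = snd s1"
    "\<And>x. x < Suc (Suc u) \<Longrightarrow> x \<noteq> Suc u \<Longrightarrow> fst s2 x = fst s1 x"
    by (rule evaluatesE[OF assms(2) rep, of "Suc (Suc u)" "Suc u"]) (use assms(5) in auto)
  show ?thesis
  proof (rule that[OF exec.Seq[OF left(1) right(1)]])
    show "fst s2 (operand e1 u) = val e1 V m"
      using left(2) right(4) operand_less[OF assms(3,5)] by simp
  qed (use left right in auto)
qed

lemma evaluates_Lit:
  assumes "k \<in> words b"
  shows "evaluates b (Lit k) V m"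
  unfolding evaluates_def
proof (intro allI impI)
  fix d u :: nat and s :: state
  show "\<exists>s'. exec b (code (Lit k) d u) s (cost (Lit k)) s' \<and>
      fst s' (operand (Lit k) d) = val (Lit k) V m \<and> snd s' = snd s \<and>
      (\<forall>x < u. x \<noteq> d \<longrightarrow> fst s' x = fst s x)"
    using exec.Const[OF assms, of d "fst s" "snd s"]
    by (intro exI[of _ "((fst s)(d := k), snd s)"]) simp
qed

lemma evaluates_Var: "x < nvars \<Longrightarrow> evaluates b (Var x) V m"
  unfolding evaluates_def represents_def using exec.Skip[of b] by fastforce

lemma evaluates_BinOp:
  assumes evaluates: "evaluates b e1 V m" "evaluates b e2 V m"
    and safe: "safe b (BinOp f e1 e2) V m"
  shows "evaluates b (BinOp f e1 e2) V m"
  unfolding evaluates_def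
proof (intro allI impI, elim conjE)
  fix d u s assume rep: "represents s V m" and u: "nvars \<le> u"
  obtain R h where "exec b (code e1 u (Suc u) ;; code e2 (Suc u) (Suc (Suc u))) s
      (cost e1 + cost e2) (R, h)"
    and ops: "R (operand e1 u) = val e1 V m" "R (operand e2 (Suc u)) = val e2 V m"
    and frame: "h = snd s" "\<And>x. x < u \<Longrightarrow> R x = fst s x"
    by (rule evaluates_operands[OF evaluates _ rep u]) (use safe in auto)
  moreover have "exec b (Op f d (operand e1 u) (operand e2 (Suc u))) (R, h) 1
      (R(d := bop_val f (val e1 V m) (val e2 V m)), h)"
    using exec.Op[of f R "operand e1 u" "operand e2 (Suc u)" b d h] ops safe by simp
  ultimately have "exec b (code (BinOp f e1 e2) d u) s (cost (BinOp f e1 e2))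
      (R(d := bop_val f (val e1 V m) (val e2 V m)), h)"
    using exec.Seq by fastforce
  with frame show "\<exists>s'. exec b (code (BinOp f e1 e2) d u) s (cost (BinOp f e1 e2)) s' \<and>
      fst s' (operand (BinOp f e1 e2) d) = val (BinOp f e1 e2) V m \<and> snd s' = snd s \<and>
      (\<forall>x < u. x \<noteq> d \<longrightarrow> fst s' x = fst s x)"
    by (intro exI[of _ "(R(d := bop_val f (val e1 V m) (val e2 V m)), h)"]) simp
qed

lemma evaluates_Deref:
  assumes "evaluates b e V m" "0 \<le> val e V m"
  shows "evaluates b (Deref e) V m"
  unfolding evaluates_def
proof (intro allI impI, elim conjE)
  fix d u s assume rep: "represents s V m" and "nvars \<le> u"
  then have u: "nvars \<le> Suc u" by simp
  obtain R h where "exec b (code e u (Suc u)) s (cost e) (R, h)"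
    and address: "R (operand e u) = val e V m"
    and frame: "h = snd s" "\<And>x. x < Suc u \<Longrightarrow> x \<noteq> u \<Longrightarrow> R x = fst s x"
    by (rule evaluatesE[OF assms(1) rep u, of u]) auto
  moreover have "snd s (nat (val e V m)) = m (val e V m)"
    using rep assms(2) by (simp add: represents_def)
  then have "exec b (Load d (operand e u)) (R, h) 1 (R(d := m (val e V m)), h)"
    using exec.Load[of R "operand e u" b d h] address frame(1) assms(2) by simp
  ultimately have "exec b (code (Deref e) d u) s (cost (Deref e)) (R(d := m (val e V m)), h)"
    using exec.Seq by fastforce
  with frame show "\<exists>s'. exec b (code (Deref e) d u) s (cost (Deref e)) s' \<and>
      fst s' (operand (Deref e) d) = val (Deref e) V m \<and> snd s' = snd s \<and>
      (\<forall>x < u. x \<noteq> d \<longrightarrow> fst s' x = fst s x)"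
    by (intro exI[of _ "(R(d := m (val e V m)), h)"]) simp
qed

lemma safe_evaluates: "safe b e V m \<Longrightarrow> evaluates b e V m"
  by (induction e) (auto intro: evaluates_Lit evaluates_Var evaluates_BinOp evaluates_Deref)

definition guard :: "exp \<Rightarrow> com" where
  "guard e = code e nvars (Suc nvars)"

lemma exec_guard:
  assumes "safe b e V m" "represents s V m"
  obtains s' where "exec b (guard e) s (cost e) s'" "fst s' (operand e nvars) = val e V m"
    "represents s' V m"
proof (rule evaluatesE[OF safe_evaluates[OF assms(1)] assms(2), of "Suc nvars" nvars])
  fix s' assume s': "exec b (code e nvars (Suc nvars)) s (cost e) s'"
    "fst s' (operand e nvars) = val e V m" "snd s' = snd s"
    "\<And>x. x < Suc nvars \<Longrightarrow> x \<noteq> nvars \<Longrightarrow> fst s' x = fst s x"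
  then have "represents s' V m" by (intro represents_frame[OF assms(2)]) auto
  with s'(1,2) show thesis by (intro that) (simp_all add: guard_def)
qed simp

definition assign :: "reg \<Rightarrow> exp \<Rightarrow> com" (infix "::=" 61) where
  "x ::= e = code e x nvars"

definition store :: "exp \<Rightarrow> exp \<Rightarrow> com" where
  "store e1 e2 = (code e1 nvars (Suc nvars) ;; code e2 (Suc nvars) (Suc (Suc nvars))) ;;
     Store (operand e1 nvars) (operand e2 (Suc nvars))"

definition cond :: "exp \<Rightarrow> com \<Rightarrow> com \<Rightarrow> com" ("(IF _/ THEN _/ ELSE _)" [0, 61, 61] 61) where
  "IF e THEN p ELSE q = guard e ;; com.If (operand e nvars) p q"

abbreviation cond1 :: "exp \<Rightarrow> com \<Rightarrow> com" ("(WHEN _/ DO _)" [0, 61] 61) where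
  "WHEN e DO p \<equiv> IF e THEN p ELSE Skip"

definition loop :: "exp \<Rightarrow> com \<Rightarrow> com" ("(WHILE _/ DO _)" [0, 61] 61) where
  "WHILE e DO p = guard e ;; While (operand e nvars) (p ;; guard e)"

definition for_loop :: "reg \<Rightarrow> exp \<Rightarrow> reg \<Rightarrow> com \<Rightarrow> com"
  ("(FOR _ FROM _ BELOW _/ DO _)" [0, 0, 0, 61] 61)
  where "FOR x FROM e BELOW y DO p =
     x ::= e ;; WHILE Var x <\<^sub>e Var y DO (p ;; x ::= Var x +\<^sub>e Lit 1)"

definition reaches :: "nat \<Rightarrow> com \<Rightarrow> (int \<Rightarrow> env \<Rightarrow> imem \<Rightarrow> bool) \<Rightarrow> int \<Rightarrow> state \<Rightarrow> bool" where
  "reaches b p Q t s \<longleftrightarrow>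
    (\<exists>u s' V m. exec b p s u s' \<and> represents s' V m \<and> Q (t + int u) V m)"

definition wp :: "nat \<Rightarrow> com \<Rightarrow> (int \<Rightarrow> env \<Rightarrow> imem \<Rightarrow> bool) \<Rightarrow> int \<Rightarrow> env \<Rightarrow> imem \<Rightarrow> bool" where
  "wp b p Q t V m \<longleftrightarrow> (\<forall>s. represents s V m \<longrightarrow> reaches b p Q t s)"

lemma wpI: "(\<And>s. represents s V m \<Longrightarrow> reaches b p Q t s) \<Longrightarrow> wp b p Q t V m"
  by (simp add: wp_def)

lemma wpD: "wp b p Q t V m \<Longrightarrow> represents s V m \<Longrightarrow> reaches b p Q t s"
  unfolding wp_def by blast

lemma reachesI: "exec b p s u s' \<Longrightarrow> represents s' V m \<Longrightarrow> Q (t + int u) V m \<Longrightarrow> reaches b p Q t s"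
  unfolding reaches_def by blast

lemma reaches_Seq:
  assumes "exec b p s u s'" "reaches b q Q (t + int u) s'"
  shows "reaches b (p ;; q) Q t s"
proof -
  obtain u' s'' V m where "exec b q s' u' s''" "represents s'' V m" "Q (t + int u + int u') V m"
    using assms(2) unfolding reaches_def by blast
  with exec.Seq[OF assms(1)] show ?thesis unfolding reaches_def by (metis add.assoc of_nat_add)
qed

lemma wp_mono:
  assumes "wp b p P t V m" "\<And>t' V' m'. P t' V' m' \<Longrightarrow> Q t' V' m'"
  shows "wp b p Q t V m"
  using assms unfolding wp_def reaches_def by meson

lemma wp_shift: "wp b p Q t V m \<longleftrightarrow> wp b p (\<lambda>t'. Q (t + t')) 0 V m"
  by (simp add: wp_def reaches_def)

lemma wp_Skip: "Q (t + 1) V m \<Longrightarrow> wp b Skip Q t V m"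
  by (intro wpI reachesI[OF exec.Skip]) auto

lemma wp_Seq:
  assumes "wp b p (\<lambda>t V m. wp b q Q t V m) t V m"
  shows "wp b (p ;; q) Q t V m"
proof (rule wpI)
  fix s assume "represents s V m"
  then obtain u s' V' m' where "exec b p s u s'" "represents s' V' m'" "wp b q Q (t + int u) V' m'"
    using wpD[OF assms] unfolding reaches_def by blast
  then show "reaches b (p ;; q) Q t s" by (blast intro: reaches_Seq wpD)
qed

lemma wp_Seq_assoc:
  assumes "wp b (p ;; q ;; r) Q t V m"
  shows "wp b ((p ;; q) ;; r) Q t V m"
proof -
  have "exec b ((p ;; q) ;; r) s u s'" if "exec b (p ;; q ;; r) s u s'" for s u s'
  proof -
    from that obtain u1 u2 u3 s1 s2 where
      "exec b p s u1 s1" "exec b q s1 u2 s2" "exec b r s2 u3 s'" "u = u1 + (u2 + u3)"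
      by (elim exec_SeqE) simp
    then show ?thesis using exec.Seq[OF exec.Seq] by (metis add.assoc)
  qed
  with assms show ?thesis unfolding wp_def reaches_def by meson
qed

lemma wp_assign:
  assumes "safe b e V m" "\<nexists>y. e = Var y" "Q (t + int (cost e)) (V(x := val e V m)) m"
  shows "wp b (x ::= e) Q t V m"
proof (rule wpI)
  fix s assume rep: "represents s V m"
  obtain s' where s': "exec b (code e x nvars) s (cost e) s'" "fst s' (operand e x) = val e V m"
    "snd s' = snd s" "\<And>y. y < nvars \<Longrightarrow> y \<noteq> x \<Longrightarrow> fst s' y = fst s y"
    by (rule evaluatesE[OF safe_evaluates[OF assms(1)] rep order_refl, of x]) auto
  have "operand e x = x" using assms(2) by (cases e) auto
  then have "represents s' (V(x := val e V m)) m"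
    using rep s' by (simp add: represents_def)
  with s'(1) assms(3) show "reaches b (x ::= e) Q t s" unfolding assign_def by (intro reachesI)
qed

lemma wp_store:
  assumes "safe b e1 V m" "safe b e2 V m" "0 \<le> val e1 V m"
    and "Q (t + int (cost e1 + cost e2 + 1)) V (m(val e1 V m := val e2 V m))"
  shows "wp b (store e1 e2) Q t V m"
proof (rule wpI)
  fix s assume rep: "represents s V m"
  let ?operands = "code e1 nvars (Suc nvars) ;; code e2 (Suc nvars) (Suc (Suc nvars))"
  obtain R h where ops: "exec b ?operands s (cost e1 + cost e2) (R, h)"
    "R (operand e1 nvars) = val e1 V m" "R (operand e2 (Suc nvars)) = val e2 V m"
    and frame: "h = snd s" "\<And>x. x < nvars \<Longrightarrow> R x = fst s x"
    by (rule evaluates_operands[OF safe_evaluates[OF assms(1)] safe_evaluates[OF assms(2)]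
          assms(1) rep order_refl]) auto
  let ?h = "h(nat (val e1 V m) := val e2 V m)"
  have "exec b (Store (operand e1 nvars) (operand e2 (Suc nvars))) (R, h) 1 (R, ?h)"
    using exec.Store[of R "operand e1 nvars" b "operand e2 (Suc nvars)" h] ops assms(3) by simp
  from exec.Seq[OF ops(1) this]
  have "exec b (store e1 e2) s (cost e1 + cost e2 + 1) (R, ?h)" by (simp add: store_def)
  moreover have "represents (R, ?h) V (m(val e1 V m := val e2 V m))"
    using rep frame assms(3) by (auto simp: represents_def)
  ultimately show "reaches b (store e1 e2) Q t s" using assms(4) by (intro reachesI)
qed

lemma wp_cond:
  assumes "safe b e V m"
    and "val e V m \<noteq> 0 \<Longrightarrow> wp b p Q (t + int (cost e) + 1) V m"
    and "val e V m = 0 \<Longrightarrow> wp b q Q (t + int (cost e) + 1) V m"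
  shows "wp b (IF e THEN p ELSE q) Q t V m"
proof (rule wpI)
  fix s assume "represents s V m"
  then obtain s1 where s1: "exec b (guard e) s (cost e) s1" "fst s1 (operand e nvars) = val e V m"
    "represents s1 V m" by (rule exec_guard[OF assms(1)])
  have "reaches b (com.If (operand e nvars) p q) Q (t + int (cost e)) s1"
  proof (cases "val e V m = 0")
    case True
    then obtain u s2 V' m' where "exec b q s1 u s2" "represents s2 V' m'"
      "Q (t + int (cost e) + 1 + int u) V' m'"
      using wpD[OF assms(3) s1(3)] unfolding reaches_def by blast
    with True s1(2) show ?thesis by (intro reachesI[OF exec.IfFalse]) (auto simp: algebra_simps)
  next
    case False
    then obtain u s2 V' m' where "exec b p s1 u s2" "represents s2 V' m'"
      "Q (t + int (cost e) + 1 + int u) V' m'"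
      using wpD[OF assms(2) s1(3)] unfolding reaches_def by blast
    with False s1(2) show ?thesis by (intro reachesI[OF exec.IfTrue]) (auto simp: algebra_simps)
  qed
  with s1(1) show "reaches b (IF e THEN p ELSE q) Q t s" unfolding cond_def by (rule reaches_Seq)
qed

lemma wp_loop_exit:
  assumes "safe b e V m" "val e V m = 0" "Q (t + int (cost e) + 1) V m"
  shows "wp b (WHILE e DO p) Q t V m"
proof (rule wpI)
  fix s assume "represents s V m"
  then obtain s1 where s1: "exec b (guard e) s (cost e) s1" "fst s1 (operand e nvars) = val e V m"
    "represents s1 V m" by (rule exec_guard[OF assms(1)])
  have "reaches b (While (operand e nvars) (p ;; guard e)) Q (t + int (cost e)) s1"
    using s1 assms(2,3) by (intro reachesI[OF exec.WhileFalse]) auto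
  with s1(1) show "reaches b (WHILE e DO p) Q t s" unfolding loop_def by (rule reaches_Seq)
qed

lemma wp_loop_unfold:
  assumes "safe b e V m" "val e V m \<noteq> 0"
    and "wp b (p ;; WHILE e DO p) Q (t + int (cost e) + 1) V m"
  shows "wp b (WHILE e DO p) Q t V m"
proof (rule wpI)
  fix s assume "represents s V m"
  then obtain s1 where s1: "exec b (guard e) s (cost e) s1" "fst s1 (operand e nvars) = val e V m"
    "represents s1 V m" by (rule exec_guard[OF assms(1)])
  let ?while = "While (operand e nvars) (p ;; guard e)"
  obtain u s' V' m' where "exec b (p ;; WHILE e DO p) s1 u s'"
    and post: "represents s' V' m'" "Q (t + int (cost e) + 1 + int u) V' m'"
    using wpD[OF assms(3) s1(3)] unfolding reaches_def by blast
  then obtain u1 u2 u3 s2 s3 where parts: "exec b p s1 u1 s2" "exec b (guard e) s2 u2 s3"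
    "exec b ?while s3 u3 s'" and u: "u = u1 + (u2 + u3)"
    unfolding loop_def by (elim exec_SeqE) simp
  have iterate: "exec b ?while s1 (1 + (u1 + u2) + u3) s'"
    using s1(2) assms(2) by (intro exec.WhileTrue[OF _ exec.Seq[OF parts(1,2)] parts(3)]) simp
  have "reaches b ?while Q (t + int (cost e)) s1"
    by (rule reachesI[OF iterate post(1)]) (use post(2) in \<open>simp add: u algebra_simps\<close>)
  with s1(1) show "reaches b (WHILE e DO p) Q t s" unfolding loop_def by (rule reaches_Seq)
qed

lemma wp_loop:
  fixes measure :: "env \<Rightarrow> imem \<Rightarrow> nat"
  assumes "I t V m"
    and "\<And>t V m. I t V m \<Longrightarrow> safe b e V m"
    and "\<And>t V m. I t V m \<Longrightarrow> val e V m \<noteq> 0 \<Longrightarrow>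
      wp b p (\<lambda>t' V' m'. I t' V' m' \<and> measure V' m' < measure V m) (t + int (cost e) + 1) V m"
    and "\<And>t V m. I t V m \<Longrightarrow> val e V m = 0 \<Longrightarrow> Q (t + int (cost e) + 1) V m"
  shows "wp b (WHILE e DO p) Q t V m"
  using assms(1)
proof (induction "measure V m" arbitrary: t V m rule: less_induct)
  case less
  show ?case
  proof (cases "val e V m = 0")
    case True
    with less.prems show ?thesis using assms(2,4) by (intro wp_loop_exit)
  next
    case False
    have "wp b p (\<lambda>t V m. wp b (WHILE e DO p) Q t V m) (t + int (cost e) + 1) V m"
      using wp_mono[OF assms(3)[OF less.prems False]] less.hyps by blast
    with False less.prems show ?thesis using assms(2) by (intro wp_loop_unfold wp_Seq)
  qed
qed


section \<open>Amortised time and frames\<close>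

definition agree_off :: "'a set \<Rightarrow> ('a \<Rightarrow> 'b) \<Rightarrow> ('a \<Rightarrow> 'b) \<Rightarrow> bool" where
  "agree_off X f g \<longleftrightarrow> (\<forall>x. x \<notin> X \<longrightarrow> g x = f x)"

lemma agree_offD: "agree_off X f g \<Longrightarrow> x \<notin> X \<Longrightarrow> g x = f x"
  by (simp add: agree_off_def)

lemma agree_off_refl [simp]: "agree_off X f f"
  by (simp add: agree_off_def)

lemma agree_off_upd [simp]: "x \<in> X \<Longrightarrow> agree_off X f (g(x := y)) \<longleftrightarrow> agree_off X f g"
  by (auto simp: agree_off_def)

lemma agree_off_upd_left [simp]: "x \<in> X \<Longrightarrow> agree_off X (f(x := y)) g \<longleftrightarrow> agree_off X f g"
  by (auto simp: agree_off_def)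

lemma agree_off_trans: "agree_off X f g \<Longrightarrow> agree_off Y g h \<Longrightarrow> X \<union> Y \<subseteq> Z \<Longrightarrow> agree_off Z f h"
  unfolding agree_off_def by (metis UnI1 UnI2 subsetD)

lemma agree_off_mono: "agree_off X f g \<Longrightarrow> X \<subseteq> Y \<Longrightarrow> agree_off Y f g"
  by (auto simp: agree_off_def)

text \<open>
  The registers are numbered such that a program part may change all registers from some number
  on, and none below it.
\<close>

abbreviation (input) rDim :: reg where "rDim \<equiv> 0"
abbreviation (input) rSquare :: reg where "rSquare \<equiv> 1"
abbreviation (input) rAnswer :: reg where "rAnswer \<equiv> 2"
abbreviation (input) rPerm :: reg where "rPerm \<equiv> 3"
abbreviation (input) rTree :: reg where "rTree \<equiv> 4"
abbreviation (input) rStride :: reg where "rStride \<equiv> 5"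
abbreviation (input) rSize :: reg where "rSize \<equiv> 6"
abbreviation (input) rLane :: reg where "rLane \<equiv> 7"
abbreviation (input) rStart :: reg where "rStart \<equiv> 8"
abbreviation (input) rSteps :: reg where "rSteps \<equiv> 9"
abbreviation (input) rEnd :: reg where "rEnd \<equiv> 10"
abbreviation (input) rCol :: reg where "rCol \<equiv> 11"
abbreviation (input) rFirst :: reg where "rFirst \<equiv> 12"
abbreviation (input) rLast :: reg where "rLast \<equiv> 13"
abbreviation (input) rQuery :: reg where "rQuery \<equiv> 14"
abbreviation (input) rRank :: reg where "rRank \<equiv> 15"
abbreviation (input) rRow :: reg where "rRow \<equiv> 16"
abbreviation (input) rNode :: reg where "rNode \<equiv> 17"
abbreviation (input) rLeft :: reg where "rLeft \<equiv> 18"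
abbreviation (input) rRight :: reg where "rRight \<equiv> 19"

text \<open>
  Register \<open>rSteps\<close> counts simulated steps, each of which pays for \<open>220\<close> steps of the simulating
  program. In \<open>runs b p r F T Q V m\<close> the bound \<open>T\<close> is on the time beyond that; \<open>p\<close> changes only
  registers from \<open>r\<close> on and memory cells in \<open>F\<close>.
\<close>

definition credit :: "env \<Rightarrow> int" where
  "credit V = 220 * V rSteps"

definition runs ::
  "nat \<Rightarrow> com \<Rightarrow> reg \<Rightarrow> int set \<Rightarrow> int \<Rightarrow> (env \<Rightarrow> imem \<Rightarrow> bool) \<Rightarrow> env \<Rightarrow> imem \<Rightarrow> bool" where
  "runs b p r F T Q V m \<longleftrightarrow> wp b p (\<lambda>t V' m'. t + credit V \<le> T + credit V' \<and>
    agree_off {r..} V V' \<and> agree_off F m m' \<and> Q V' m') 0 V m"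

lemma credit_upd [simp]: "x \<noteq> rSteps \<Longrightarrow> credit (V(x := y)) = credit V"
  by (simp add: credit_def)

lemma credit_agree: "agree_off {r..} V V' \<Longrightarrow> rSteps < r \<Longrightarrow> credit V' = credit V"
  by (simp add: credit_def agree_off_def)

lemma wp_runs:
  assumes "runs b p r F T Q V m"
    and "\<And>t' V' m'. t' + credit V \<le> t + T + credit V' \<Longrightarrow> agree_off {r..} V V' \<Longrightarrow>
      agree_off F m m' \<Longrightarrow> Q V' m' \<Longrightarrow> Q' t' V' m'"
  shows "wp b p Q' t V m"
  by (subst wp_shift) (use assms in \<open>auto simp: runs_def elim!: wp_mono\<close>)

lemma runs_mono:
  assumes "runs b p r F T Q V m" "r' \<le> r" "F \<subseteq> F'" "T \<le> T'"
    and "\<And>V' m'. agree_off {r..} V V' \<Longrightarrow> agree_off F m m' \<Longrightarrow> Q V' m' \<Longrightarrow> Q' V' m'"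
  shows "runs b p r' F' T' Q' V m"
  unfolding runs_def
proof (rule wp_runs[OF assms(1)])
  fix t V' m'
  assume "t + credit V \<le> 0 + T + credit V'" "agree_off {r..} V V'" "agree_off F m m'" "Q V' m'"
  moreover from this have "agree_off {r'..} V V'" "agree_off F' m m'"
    using assms(2,3) by (auto elim!: agree_off_mono)
  ultimately show "t + credit V \<le> T' + credit V' \<and> agree_off {r'..} V V' \<and> agree_off F' m m' \<and>
      Q' V' m'"
    using assms(4,5) by simp
qed

lemma runs_Seq:
  assumes "runs b p r1 F1 T1 P V m" "r \<le> r1" "F1 \<subseteq> F"
    and "\<And>V' m'. agree_off {r1..} V V' \<Longrightarrow> agree_off F1 m m' \<Longrightarrow> P V' m' \<Longrightarrow>
      runs b q r F (T - T1) Q V' m'"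
  shows "runs b (p ;; q) r F T Q V m"
  unfolding runs_def
proof (rule wp_Seq, rule wp_runs[OF assms(1)])
  fix t V1 m1
  assume first: "t + credit V \<le> 0 + T1 + credit V1" "agree_off {r1..} V V1" "agree_off F1 m m1"
    "P V1 m1"
  then have "agree_off {r..} V V1" "agree_off F m m1"
    using assms(2,3) by (auto elim!: agree_off_mono)
  then show "wp b q (\<lambda>t' V' m'. t' + credit V \<le> T + credit V' \<and> agree_off {r..} V V' \<and>
      agree_off F m m' \<and> Q V' m') t V1 m1"
    by (intro wp_runs[OF assms(4)[OF first(2-4)]])
      (use first(1) in \<open>auto elim: agree_off_trans\<close>)
qed

lemma runs_Skip: "1 \<le> T \<Longrightarrow> Q V m \<Longrightarrow> runs b Skip r F T Q V m"
  unfolding runs_def by (intro wp_Skip) simp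

lemma runs_assign_credit:
  assumes "safe b e V m" "\<nexists>y. e = Var y" "r \<le> x"
    and "int (cost e) + credit V \<le> T + credit (V(x := val e V m))" "Q (V(x := val e V m)) m"
  shows "runs b (x ::= e) r F T Q V m"
  unfolding runs_def using assms by (intro wp_assign) auto

lemma runs_assign:
  assumes "safe b e V m" "\<nexists>y. e = Var y" "r \<le> x" "x \<noteq> rSteps"
    and "int (cost e) \<le> T" "Q (V(x := val e V m)) m"
  shows "runs b (x ::= e) r F T Q V m"
  using assms by (intro runs_assign_credit) auto

lemma runs_store:
  assumes "safe b e1 V m" "safe b e2 V m" "0 \<le> val e1 V m" "val e1 V m \<in> F"
    and "int (cost e1 + cost e2 + 1) \<le> T" "Q V (m(val e1 V m := val e2 V m))"
  shows "runs b (store e1 e2) r F T Q V m"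
  unfolding runs_def using assms by (intro wp_store) auto

lemma runs_assign_Seq:
  assumes "safe b e V m" "\<nexists>y. e = Var y" "r \<le> x" "x \<noteq> rSteps"
    and "runs b q r F (T - int (cost e)) Q (V(x := val e V m)) m"
  shows "runs b (x ::= e ;; q) r F T Q V m"
proof (rule runs_Seq)
  show "runs b (x ::= e) r F (int (cost e)) (\<lambda>V' m'. V' = V(x := val e V m) \<and> m' = m) V m"
    using assms(1-4) by (intro runs_assign) auto
qed (use assms(5) in auto)

lemma runs_store_Seq:
  assumes "safe b e1 V m" "safe b e2 V m" "0 \<le> val e1 V m" "val e1 V m \<in> F"
    and "runs b q r F (T - int (cost e1 + cost e2 + 1)) Q V (m(val e1 V m := val e2 V m))"
  shows "runs b (store e1 e2 ;; q) r F T Q V m"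
proof (rule runs_Seq)
  show "runs b (store e1 e2) r F (int (cost e1 + cost e2 + 1))
      (\<lambda>V' m'. V' = V \<and> m' = m(val e1 V m := val e2 V m)) V m"
    using assms(1-4) by (intro runs_store) auto
qed (use assms(5) in auto)

lemma runs_cond:
  assumes "safe b e V m"
    and "val e V m \<noteq> 0 \<Longrightarrow> runs b p r F (T - int (cost e) - 1) Q V m"
    and "val e V m = 0 \<Longrightarrow> runs b q r F (T - int (cost e) - 1) Q V m"
  shows "runs b (IF e THEN p ELSE q) r F T Q V m"
  unfolding runs_def
proof (rule wp_cond[OF assms(1)])
  show "wp b p (\<lambda>t V' m'. t + credit V \<le> T + credit V' \<and> agree_off {r..} V V' \<and>
      agree_off F m m' \<and> Q V' m') (0 + int (cost e) + 1) V m" if "val e V m \<noteq> 0"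
    by (rule wp_runs[OF assms(2)[OF that]]) auto
  show "wp b q (\<lambda>t V' m'. t + credit V \<le> T + credit V' \<and> agree_off {r..} V V' \<and>
      agree_off F m m' \<and> Q V' m') (0 + int (cost e) + 1) V m" if "val e V m = 0"
    by (rule wp_runs[OF assms(3)[OF that]]) auto
qed

text \<open>The invariant is indexed by the time that is left.\<close>

lemma runs_loop:
  fixes measure :: "env \<Rightarrow> imem \<Rightarrow> nat"
  assumes "I T V m"
    and safe: "\<And>T' V' m'. agree_off {r..} V V' \<Longrightarrow> agree_off F m m' \<Longrightarrow> I T' V' m' \<Longrightarrow> safe b e V' m'"
    and body: "\<And>T' V' m'. agree_off {r..} V V' \<Longrightarrow> agree_off F m m' \<Longrightarrow> I T' V' m' \<Longrightarrow>
      val e V' m' \<noteq> 0 \<Longrightarrow>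
      \<exists>c. runs b p r F c (\<lambda>V'' m''. I (T' - int (cost e) - 1 - c) V'' m'' \<and>
        measure V'' m'' < measure V' m') V' m'"
    and exit: "\<And>T' V' m'. agree_off {r..} V V' \<Longrightarrow> agree_off F m m' \<Longrightarrow> I T' V' m' \<Longrightarrow>
      val e V' m' = 0 \<Longrightarrow> int (cost e) + 1 \<le> T' \<and> Q V' m'"
  shows "runs b (WHILE e DO p) r F T Q V m"
  unfolding runs_def
proof (rule wp_loop[where measure = measure and I = "\<lambda>t V' m'. \<exists>T'. I T' V' m' \<and>
    agree_off {r..} V V' \<and> agree_off F m m' \<and> t + credit V + T' \<le> T + credit V'"])
  fix t V1 m1
  assume "\<exists>T'. I T' V1 m1 \<and> agree_off {r..} V V1 \<and> agree_off F m m1 \<and>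
    t + credit V + T' \<le> T + credit V1" and "val e V1 m1 \<noteq> 0"
  then obtain T' c where frame: "agree_off {r..} V V1" "agree_off F m m1"
    and time: "t + credit V + T' \<le> T + credit V1"
    and step: "runs b p r F c (\<lambda>V'' m''. I (T' - int (cost e) - 1 - c) V'' m'' \<and>
        measure V'' m'' < measure V1 m1) V1 m1"
    using body by blast
  show "wp b p (\<lambda>t' V' m'. (\<exists>T'. I T' V' m' \<and> agree_off {r..} V V' \<and> agree_off F m m' \<and>
      t' + credit V + T' \<le> T + credit V') \<and> measure V' m' < measure V1 m1)
      (t + int (cost e) + 1) V1 m1"
  proof (rule wp_runs[OF step])
    fix t' V' m'
    assume "t' + credit V1 \<le> t + int (cost e) + 1 + c + credit V'"
      and "agree_off {r..} V1 V'" "agree_off F m1 m'"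
      and "I (T' - int (cost e) - 1 - c) V' m' \<and> measure V' m' < measure V1 m1"
    moreover from this have "agree_off {r..} V V'" "agree_off F m m'"
      using frame by (auto elim: agree_off_trans)
    ultimately show "(\<exists>T'. I T' V' m' \<and> agree_off {r..} V V' \<and> agree_off F m m' \<and>
      t' + credit V + T' \<le> T + credit V') \<and> measure V' m' < measure V1 m1"
      using time by (intro conjI exI[of _ "T' - int (cost e) - 1 - c"]) auto
  qed
next
  fix t V' m'
  assume "\<exists>T'. I T' V' m' \<and> agree_off {r..} V V' \<and> agree_off F m m' \<and>
    t + credit V + T' \<le> T + credit V'" and "val e V' m' = 0"
  then show "t + int (cost e) + 1 + credit V \<le> T + credit V' \<and> agree_off {r..} V V' \<and>
      agree_off F m m' \<and> Q V' m'"
    using exit by fastforce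
qed (use assms(1) safe in auto)

lemma sum_int_atLeastLessThan_pop:
  fixes f :: "int \<Rightarrow> int"
  assumes "i < n"
  shows "sum f {i..<n} = f i + sum f {i + 1..<n}"
proof -
  have "{i..<n} = insert i {i + 1..<n}" using assms by auto
  then show ?thesis by simp
qed

lemma runs_increment:
  assumes "runs b p (Suc x) F c (\<lambda>_. P) V m"
    and "x < nvars" "x \<noteq> rSteps" "1 \<in> words b" "V x + 1 \<in> words b"
  shows "runs b (p ;; x ::= Var x +\<^sub>e Lit 1) x F (c + 3) (\<lambda>V' m'. V' x = V x + 1 \<and> P m') V m"
proof (rule runs_Seq[OF assms(1)])
  fix V' m'
  assume "agree_off {Suc x..} V V'" "P m'"
  then show "runs b (x ::= Var x +\<^sub>e Lit 1) x F (c + 3 - c) (\<lambda>V' m'. V' x = V x + 1 \<and> P m') V' m'"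
    using assms(2-5) agree_offD[of "{Suc x..}" V V' x] by (intro runs_assign) auto
qed auto

text \<open>
  An iteration takes \<open>7\<close> steps in addition to the body: \<open>4\<close> for the test and \<open>3\<close> for the
  increment.
\<close>

lemma runs_count_up:
  assumes registers: "y < x" "x < nvars" "x \<noteq> rSteps"
    and range: "0 \<le> V x" "V x \<le> V y" "V y < 2 ^ b" "1 \<le> b"
    and init: "J (V x) m"
    and body: "\<And>i V' m'. V x \<le> i \<Longrightarrow> i < V y \<Longrightarrow> V' x = i \<Longrightarrow> agree_off {x..} V V' \<Longrightarrow>
      agree_off F m m' \<Longrightarrow> J i m' \<Longrightarrow> runs b p (Suc x) F (c i) (\<lambda>_. J (i + 1)) V' m'"
  shows "runs b (WHILE Var x <\<^sub>e Var y DO (p ;; x ::= Var x +\<^sub>e Lit 1)) x F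
    (4 + (\<Sum>i \<in> {V x..<V y}. c i + 7)) (\<lambda>_. J (V y)) V m"
proof -
  define I where "I = (\<lambda>T V' m'. V x \<le> V' x \<and> V' x \<le> V y \<and> J (V' x) m' \<and>
    4 + (\<Sum>i \<in> {V' x..<V y}. c i + 7) \<le> T)"
  have "(2::int) ^ 1 \<le> 2 ^ b" using range by (intro power_increasing) auto
  then have words: "0 \<in> words b" "1 \<in> words b" by (auto intro!: nonneg_in_words)
  show ?thesis
  proof (rule runs_loop[where measure = "\<lambda>V' _. nat (V y - V' x)" and I = I])
    fix T V' m'
    assume frame: "agree_off {x..} V V'" "agree_off F m m'" and inv: "I T V' m'"
    have y: "V' y = V y" using registers agree_offD[OF frame(1), of y] by simp
    show "safe b (Var x <\<^sub>e Var y) V' m'" using registers words by simp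
    show "int (cost (Var x <\<^sub>e Var y)) + 1 \<le> T \<and> J (V y) m'" if "val (Var x <\<^sub>e Var y) V' m' = 0"
    proof -
      have "V' x = V y" using that inv y by (simp add: I_def split: if_splits)
      then show ?thesis using inv by (simp add: I_def)
    qed
    assume "val (Var x <\<^sub>e Var y) V' m' \<noteq> 0"
    then have less: "V' x < V y" using y by (simp split: if_splits)
    have "runs b (p ;; x ::= Var x +\<^sub>e Lit 1) x F (c (V' x) + 3)
        (\<lambda>V'' m''. V'' x = V' x + 1 \<and> J (V' x + 1) m'') V' m'"
      using registers range words frame inv less
      by (intro runs_increment body) (auto simp: I_def intro!: nonneg_in_words)
    then have "runs b (p ;; x ::= Var x +\<^sub>e Lit 1) x F (c (V' x) + 3)
        (\<lambda>V'' m''. I (T - 4 - (c (V' x) + 3)) V'' m'' \<and> nat (V y - V'' x) < nat (V y - V' x)) V' m'"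
      by (rule runs_mono)
        (use inv less sum_int_atLeastLessThan_pop[OF less, of "\<lambda>i. c i + 7"] in \<open>auto simp: I_def\<close>)
    then show "\<exists>c. runs b (p ;; x ::= Var x +\<^sub>e Lit 1) x F c (\<lambda>V'' m''.
        I (T - int (cost (Var x <\<^sub>e Var y)) - 1 - c) V'' m'' \<and>
            nat (V y - V'' x) < nat (V y - V' x)) V' m'"
      by (intro exI[of _ "c (V' x) + 3"]) simp
  qed (use range init in \<open>simp add: I_def\<close>)
qed

lemma runs_for_loop:
  assumes registers: "y < x" "x < nvars" "x \<noteq> rSteps"
    and range: "safe b e V m" "\<nexists>z. e = Var z" "val e V m = lo" "V y = hi"
      "0 \<le> lo" "lo \<le> hi" "hi < 2 ^ b" "1 \<le> b"
    and init: "J lo m"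
    and body: "\<And>i V' m'. lo \<le> i \<Longrightarrow> i < hi \<Longrightarrow> V' x = i \<Longrightarrow> agree_off {x..} V V' \<Longrightarrow>
      agree_off F m m' \<Longrightarrow> J i m' \<Longrightarrow> runs b p (Suc x) F (c i) (\<lambda>_. J (i + 1)) V' m'"
    and "int (cost e) + 4 + (\<Sum>i \<in> {lo..<hi}. c i + 7) \<le> T"
  shows "runs b (FOR x FROM e BELOW y DO p) x F T (\<lambda>_. J hi) V m"
proof -
  let ?V = "V(x := val e V m)"
  have loop: "runs b (WHILE Var x <\<^sub>e Var y DO (p ;; x ::= Var x +\<^sub>e Lit 1)) x F
      (4 + (\<Sum>i \<in> {?V x..<?V y}. c i + 7)) (\<lambda>_. J (?V y)) ?V m"
  proof (rule runs_count_up)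
    fix i V' m'
    assume "?V x \<le> i" "i < ?V y" "V' x = i" "agree_off {x..} ?V V'" "agree_off F m m'" "J i m'"
    then show "runs b p (Suc x) F (c i) (\<lambda>_. J (i + 1)) V' m'"
      using registers range(3,4) by (intro body) simp_all
  qed (use registers range init in auto)
  show ?thesis unfolding for_loop_def
    by (intro runs_assign_Seq runs_mono[OF loop]) (use assms in auto)
qed

lemma runs_for_loop_const:
  assumes "y < x" "x < nvars" "x \<noteq> rSteps"
    and "safe b e V m" "\<nexists>z. e = Var z" "val e V m = lo" "V y = hi"
      "0 \<le> lo" "lo \<le> hi" "hi < 2 ^ b" "1 \<le> b"
    and "J lo m"
    and "\<And>i V' m'. lo \<le> i \<Longrightarrow> i < hi \<Longrightarrow> V' x = i \<Longrightarrow> agree_off {x..} V V' \<Longrightarrow>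
      agree_off F m m' \<Longrightarrow> J i m' \<Longrightarrow> runs b p (Suc x) F c (\<lambda>_. J (i + 1)) V' m'"
    and "int (cost e) + 4 + (hi - lo) * (c + 7) \<le> T"
  shows "runs b (FOR x FROM e BELOW y DO p) x F T (\<lambda>_. J hi) V m"
  by (rule runs_for_loop[where c = "\<lambda>_. c" and lo = lo]) (use assms in auto)


section \<open>Simulating many machines in one memory\<close>

fun reg_bound :: "com \<Rightarrow> nat" where
  "reg_bound Skip = 0"
| "reg_bound (Const r k) = Suc r"
| "reg_bound (Op f r r1 r2) = Suc (max r (max r1 r2))"
| "reg_bound (Load r a) = Suc (max r a)"
| "reg_bound (Store a r) = Suc (max a r)"
| "reg_bound (Seq p q) = max (reg_bound p) (reg_bound q)"
| "reg_bound (com.If r p q) = max (Suc r) (max (reg_bound p) (reg_bound q))"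
| "reg_bound (While r p) = max (Suc r) (reg_bound p)"

definition reg_cell :: "reg \<Rightarrow> exp" where
  "reg_cell r = Lit (int r + 1) *\<^sub>e Var rStride +\<^sub>e Var rLane"

definition mem_cell :: "nat \<Rightarrow> exp \<Rightarrow> exp" where
  "mem_cell K e = (e +\<^sub>e Lit (int K + 1)) *\<^sub>e Var rStride +\<^sub>e Var rLane"

definition tick :: com where
  "tick = rSteps ::= Var rSteps +\<^sub>e Lit 1"

text \<open>
  The simulated machine keeps its registers \<open>r < K\<close> and its memory cells \<open>a\<close> as virtual cells
  \<open>r\<close> and \<open>K + a\<close>; virtual cell \<open>v\<close> of the machine in lane \<open>l\<close> is the memory cell
  \<open>(v + 1) * S + l\<close>.
\<close>

fun sim :: "nat \<Rightarrow> com \<Rightarrow> com" where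
  "sim K Skip = tick"
| "sim K (Const r k) = tick ;; store (reg_cell r) (Lit k)"
| "sim K (Op f r r1 r2) =
    tick ;; store (reg_cell r) (BinOp f (Deref (reg_cell r1)) (Deref (reg_cell r2)))"
| "sim K (Load r a) = tick ;; store (reg_cell r) (Deref (mem_cell K (Deref (reg_cell a))))"
| "sim K (Store a r) = tick ;; store (mem_cell K (Deref (reg_cell a))) (Deref (reg_cell r))"
| "sim K (Seq p q) = sim K p ;; sim K q"
| "sim K (com.If r p q) = tick ;; IF Deref (reg_cell r) THEN sim K p ELSE sim K q"
| "sim K (While r p) = tick ;; WHILE Deref (reg_cell r) DO (sim K p ;; tick)"

definition cell :: "int \<Rightarrow> int \<Rightarrow> int \<Rightarrow> int" where
  "cell S l v = (v + 1) * S + l"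

definition lane_cells :: "int \<Rightarrow> int \<Rightarrow> int set" where
  "lane_cells S l = cell S l ` {0..}"

lemma cell_eq_iff:
  assumes "0 \<le> l" "l < S" "0 \<le> l'" "l' < S"
  shows "cell S l v = cell S l' v' \<longleftrightarrow> v = v' \<and> l = l'"
proof
  assume eq: "cell S l v = cell S l' v'"
  have "cell S l v mod S = l" "cell S l' v' mod S = l'" using assms by (simp_all add: cell_def)
  with eq have "l = l'" by simp
  with eq assms show "v = v' \<and> l = l'" by (simp add: cell_def)
qed simp

lemma cell_ge:
  assumes "0 \<le> v" "0 < S" "0 \<le> l"
  shows "S \<le> cell S l v"
proof -
  have "1 * S \<le> (v + 1) * S" using assms by (intro mult_right_mono) auto
  then show ?thesis using assms unfolding cell_def by linarith
qed

lemma lane_cells_ge: "0 < S \<Longrightarrow> 0 \<le> l \<Longrightarrow> lane_cells S l \<subseteq> {S..}"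
  using cell_ge by (auto simp: lane_cells_def)

lemma cell_in_lane_cells: "0 \<le> v \<Longrightarrow> cell S l v \<in> lane_cells S l"
  by (simp add: lane_cells_def)

lemma cell_notin_lane_cells:
  "0 \<le> l \<Longrightarrow> l < S \<Longrightarrow> 0 \<le> l' \<Longrightarrow> l' < S \<Longrightarrow> l \<noteq> l' \<Longrightarrow> cell S l v \<notin> lane_cells S l'"
  by (auto simp: lane_cells_def cell_eq_iff)

locale lanes =
  fixes K b0 b :: nat and S :: int
  assumes S_pos: "0 < S" and b0_le: "b0 \<le> b"
    and lanes_fit: "(2 ^ b0 + int K + 2) * S \<le> 2 ^ b"
begin

definition machine_at :: "int \<Rightarrow> imem \<Rightarrow> state \<Rightarrow> bool" where
  "machine_at l m s \<longleftrightarrow> (\<forall>r < K. m (cell S l (int r)) = fst s r \<and> fst s r \<in> words b0) \<and>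
    (\<forall>a. m (cell S l (int K + int a)) = snd s a \<and> snd s a \<in> words b0)"

definition can_simulate :: "int \<Rightarrow> nat \<Rightarrow> env \<Rightarrow> bool" where
  "can_simulate l u V \<longleftrightarrow> V rStride = S \<and> V rLane = l \<and> 0 \<le> l \<and> l < S \<and>
    0 \<le> V rSteps \<and> V rSteps + int u < 2 ^ b"

lemma can_simulate_le: "can_simulate l u V \<Longrightarrow> u' \<le> u \<Longrightarrow> can_simulate l u' V"
  by (simp add: can_simulate_def)

lemma can_simulate_steps:
  "can_simulate l (u + u') V \<Longrightarrow> can_simulate l u' (V(rSteps := V rSteps + int u))"
  by (simp add: can_simulate_def)

lemma machine_at_cong:
  assumes "machine_at l m s" "\<And>v. 0 \<le> v \<Longrightarrow> m' (cell S l v) = m (cell S l v)"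
  shows "machine_at l m' s"
  using assms by (simp add: machine_at_def)

lemma machine_at_upd_reg:
  assumes "machine_at l m (R, h)" "r < K" "y \<in> words b0" "0 \<le> l" "l < S"
  shows "machine_at l (m(cell S l (int r) := y)) (R(r := y), h)"
  using assms unfolding machine_at_def by (auto simp: cell_eq_iff)

lemma machine_at_upd_mem:
  assumes "machine_at l m (R, h)" "y \<in> words b0" "0 \<le> l" "l < S"
  shows "machine_at l (m(cell S l (int K + int a) := y)) (R, h(a := y))"
  using assms unfolding machine_at_def by (auto simp: cell_eq_iff)

lemma cell_less:
  assumes "v < 2 ^ b0 + int K" "l < S"
  shows "cell S l v < 2 ^ b"
proof -
  have "(v + 2) * S \<le> (2 ^ b0 + int K + 2) * S"
    using assms S_pos by (intro mult_right_mono) auto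
  then show ?thesis using lanes_fit assms(2) by (simp add: cell_def algebra_simps)
qed

lemma cell_nonneg: "0 \<le> v \<Longrightarrow> 0 \<le> l \<Longrightarrow> 0 \<le> cell S l v"
  using cell_ge[of v S l] S_pos by simp

lemma K_less: "int K + 3 \<le> 2 ^ b"
proof -
  have "1 * (1 + int K + 2) \<le> S * (1 + int K + 2)" using S_pos by (intro mult_right_mono) auto
  also have "\<dots> \<le> (2 ^ b0 + int K + 2) * S"
    using S_pos by (subst mult.commute) (intro mult_right_mono, auto)
  finally show ?thesis using lanes_fit by simp
qed

lemma cell_factor_words:
  assumes "0 \<le> v" "v < 2 ^ b0 + int K" "0 \<le> l" "l < S"
  shows "(v + 1) * S \<in> words b" "v + 1 \<in> words b" "cell S l v \<in> words b"
proof -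
  have less: "cell S l v < 2 ^ b" by (rule cell_less[OF assms(2,4)])
  moreover have "v + 1 \<le> (v + 1) * S" using assms S_pos mult_left_mono[of 1 S "v + 1"] by simp
  ultimately have "(v + 1) * S < 2 ^ b" "v + 1 < 2 ^ b"
    using assms(3) unfolding cell_def by linarith+
  moreover have "0 \<le> (v + 1) * S" using assms S_pos by simp
  ultimately show "(v + 1) * S \<in> words b" "v + 1 \<in> words b" "cell S l v \<in> words b"
    using less assms cell_nonneg by (auto intro!: nonneg_in_words)
qed

lemma safe_reg_cell:
  assumes "r < K" "V rStride = S" "V rLane = l" "0 \<le> l" "l < S"
  shows "safe b (reg_cell r) V m" "val (reg_cell r) V m = cell S l (int r)"
proof -
  have "int r < 2 ^ b0 + int K" using assms(1) by (simp add: add_strict_increasing)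
  with cell_factor_words[of "int r" l] assms
  show "safe b (reg_cell r) V m" "val (reg_cell r) V m = cell S l (int r)"
    by (simp_all add: reg_cell_def cell_def)
qed

lemma safe_mem_cell:
  assumes "safe b e V m" "val e V m = a" "0 \<le> a" "a < 2 ^ b0"
    and "V rStride = S" "V rLane = l" "0 \<le> l" "l < S"
  shows "safe b (mem_cell K e) V m" "val (mem_cell K e) V m = cell S l (int K + a)"
proof -
  have "int K + 1 \<in> words b" using K_less by (intro nonneg_in_words) auto
  with cell_factor_words[of "int K + a" l] assms
  show "safe b (mem_cell K e) V m" "val (mem_cell K e) V m = cell S l (int K + a)"
    by (simp_all add: mem_cell_def cell_def add_ac)
qed

lemma cost_reg_cell [simp]: "cost (reg_cell r) = 5"
  by (simp add: reg_cell_def)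

lemma cost_mem_cell [simp]: "cost (mem_cell K e) = cost e + 6"
  by (simp add: mem_cell_def)

lemma safe_Deref_reg_cell:
  assumes "can_simulate l u V" "machine_at l m s" "r < K"
  shows "safe b (Deref (reg_cell r)) V m" "val (Deref (reg_cell r)) V m = fst s r"
  using assms safe_reg_cell[of r V l] cell_nonneg[of "int r" l]
  by (simp_all add: can_simulate_def machine_at_def)

lemma safe_mem_cell_Deref_reg_cell:
  assumes "can_simulate l u V" "machine_at l m s" "a < K" "0 \<le> fst s a"
  shows "safe b (mem_cell K (Deref (reg_cell a))) V m"
    and "val (mem_cell K (Deref (reg_cell a))) V m = cell S l (int K + fst s a)"
proof -
  have "fst s a < 2 ^ b0" using assms(2,3) by (simp add: machine_at_def words_def)
  note safe_mem_cell[OF safe_Deref_reg_cell[OF assms(1-3)] assms(4) this]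
  then show "safe b (mem_cell K (Deref (reg_cell a))) V m"
    "val (mem_cell K (Deref (reg_cell a))) V m = cell S l (int K + fst s a)"
    using assms(1) by (simp_all add: can_simulate_def)
qed

lemma wp_tick:
  assumes "can_simulate l 1 V" "Q (t + 3) (V(rSteps := V rSteps + 1)) m"
  shows "wp b tick Q t V m"
proof -
  have "1 \<in> words b" "V rSteps + 1 \<in> words b"
    using assms(1) K_less by (auto intro!: nonneg_in_words simp: can_simulate_def)
  with assms show ?thesis unfolding tick_def by (intro wp_assign) auto
qed

definition simulation :: "com \<Rightarrow> int \<Rightarrow> nat \<Rightarrow> state \<Rightarrow> env \<Rightarrow> imem \<Rightarrow> bool" where
  "simulation p l u s' V m \<longleftrightarrow> runs b p rSteps (lane_cells S l) 0
    (\<lambda>V' m'. V' = V(rSteps := V rSteps + int u) \<and> machine_at l m' s') V m"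

lemma simulation_tick_store:
  assumes "can_simulate l 1 V"
    and "\<And>V'. can_simulate l 0 V' \<Longrightarrow>
      safe b e1 V' m \<and> val e1 V' m = cell S l v \<and> safe b e2 V' m \<and> val e2 V' m = y"
    and "0 \<le> v" "cost e1 + cost e2 \<le> 200" "machine_at l (m(cell S l v := y)) s'"
  shows "simulation (tick ;; store e1 e2) l 1 s' V m"
proof -
  let ?V = "V(rSteps := V rSteps + 1)"
  have "can_simulate l 0 ?V" "0 \<le> l" using assms(1) by (auto simp: can_simulate_def)
  with assms show ?thesis unfolding simulation_def runs_def
    by (intro wp_Seq wp_tick wp_store)
      (auto simp: credit_def cell_nonneg cell_in_lane_cells)
qed

lemma simulation_tick_cond:
  assumes "can_simulate l (1 + u) V" "machine_at l m s" "r < K"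
    and "simulation (if fst s r \<noteq> 0 then p else q) l u s' (V(rSteps := V rSteps + 1)) m"
  shows "simulation (tick ;; IF Deref (reg_cell r) THEN p ELSE q) l (1 + u) s' V m"
proof -
  let ?V = "V(rSteps := V rSteps + 1)"
  have can: "can_simulate l 1 V" "can_simulate l u ?V"
    using can_simulate_le[OF assms(1)] can_simulate_steps[of l 1 u V] assms(1) by simp_all
  have "wp b (if fst s r \<noteq> 0 then p else q) (\<lambda>t V' m'. t + credit V \<le> 0 + credit V' \<and>
      agree_off {rSteps..} V V' \<and> agree_off (lane_cells S l) m m' \<and>
      V' = V(rSteps := V rSteps + int (1 + u)) \<and> machine_at l m' s') 10 ?V m"
    using assms(4) unfolding simulation_def
    by (rule wp_runs) (auto simp: credit_def algebra_simps)
  then show ?thesis unfolding simulation_def runs_def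
    using safe_Deref_reg_cell[OF can(2) assms(2,3)] can(1)
    by (intro wp_Seq wp_tick wp_cond) auto
qed

lemma simulation_tick_unfold:
  assumes "can_simulate l (1 + u) V" "machine_at l m s" "r < K" "fst s r \<noteq> 0"
    and "simulation (p ;; tick ;; WHILE Deref (reg_cell r) DO (p ;; tick)) l u s'
      (V(rSteps := V rSteps + 1)) m"
  shows "simulation (tick ;; WHILE Deref (reg_cell r) DO (p ;; tick)) l (1 + u) s' V m"
proof -
  let ?V = "V(rSteps := V rSteps + 1)"
  have can: "can_simulate l 1 V" "can_simulate l u ?V"
    using can_simulate_le[OF assms(1)] can_simulate_steps[of l 1 u V] assms(1) by simp_all
  have "wp b (p ;; tick ;; WHILE Deref (reg_cell r) DO (p ;; tick))
      (\<lambda>t V' m'. t + credit V \<le> 0 + credit V' \<and>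
        agree_off {rSteps..} V V' \<and> agree_off (lane_cells S l) m m' \<and>
        V' = V(rSteps := V rSteps + int (1 + u)) \<and> machine_at l m' s') 10 ?V m"
    using assms(5) unfolding simulation_def
    by (rule wp_runs) (auto simp: credit_def algebra_simps)
  then show ?thesis unfolding simulation_def runs_def
    using safe_Deref_reg_cell[OF can(2) assms(2,3)] assms(4)
    by (intro wp_Seq[of _ tick] wp_tick[OF can(1)]) (rule wp_loop_unfold[OF _ _ wp_Seq_assoc], auto)
qed

lemma simulation_Seq:
  assumes "simulation p l u s1 V m"
    and "\<And>m1. machine_at l m1 s1 \<Longrightarrow> simulation q l u' s2 (V(rSteps := V rSteps + int u)) m1"
  shows "simulation (p ;; q) l (u + u') s2 V m"
  unfolding simulation_def
proof (rule runs_Seq[OF assms(1)[unfolded simulation_def] order_refl order_refl], elim conjE)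
  fix V1 m1
  assume V1: "V1 = V(rSteps := V rSteps + int u)" and "machine_at l m1 s1"
  then have "simulation q l u' s2 V1 m1" using assms(2) by simp
  then show "runs b q rSteps (lane_cells S l) (0 - 0)
      (\<lambda>V' m'. V' = V(rSteps := V rSteps + int (u + u')) \<and> machine_at l m' s2) V1 m1"
    unfolding simulation_def by (rule runs_mono) (auto simp: V1 add.assoc)
qed

lemma simulation_Const:
  assumes "k \<in> words b0" "r < K" "machine_at l m (R, h)" "can_simulate l 1 V"
  shows "simulation (sim K (Const r k)) l 1 (R(r := k), h) V m"
proof -
  have "k \<in> words b" "0 \<le> l" "l < S"
    using assms words_mono[OF b0_le] by (auto simp: can_simulate_def)
  then show ?thesis unfolding sim.simps
    by (intro simulation_tick_store[where v = "int r" and y = k] machine_at_upd_reg)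
      (use assms in \<open>auto simp: can_simulate_def safe_reg_cell\<close>)
qed

lemma simulation_Op:
  assumes "bop_val f (R r1) (R r2) \<in> words b0" "r < K" "r1 < K" "r2 < K"
    and "machine_at l m (R, h)" "can_simulate l 1 V"
  shows "simulation (sim K (Op f r r1 r2)) l 1 (R(r := bop_val f (R r1) (R r2)), h) V m"
proof -
  have "bop_val f (R r1) (R r2) \<in> words b" "0 \<le> l" "l < S"
    using assms words_mono[OF b0_le] by (auto simp: can_simulate_def)
  moreover have "safe b (Deref (reg_cell x)) V' m" "val (Deref (reg_cell x)) V' m = R x"
    if "can_simulate l 0 V'" "x < K" for V' x
    using safe_Deref_reg_cell[OF that(1) assms(5) that(2)] by auto
  ultimately show ?thesis unfolding sim.simps
    by (intro simulation_tick_store[where v = "int r" and y = "bop_val f (R r1) (R r2)"]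
        machine_at_upd_reg)
      (use assms in
        \<open>auto simp: can_simulate_def safe_reg_cell simp del: safe.simps(4) val.simps(4)\<close>)
qed

lemma simulation_Load:
  assumes "0 \<le> R a" "r < K" "a < K" "machine_at l m (R, h)" "can_simulate l 1 V"
  shows "simulation (sim K (Load r a)) l 1 (R(r := h (nat (R a))), h) V m"
proof -
  have "0 \<le> l" "l < S" using assms by (auto simp: can_simulate_def)
  moreover have "h (nat (R a)) \<in> words b0" "m (cell S l (int K + R a)) = h (nat (R a))"
    using assms(4)[unfolded machine_at_def, THEN conjunct2, rule_format, of "nat (R a)"] assms(1)
    by auto
  ultimately show ?thesis unfolding sim.simps
    using safe_mem_cell_Deref_reg_cell[OF _ assms(4), of 0 _ a]
    by (intro simulation_tick_store[where v = "int r" and y = "h (nat (R a))"] machine_at_upd_reg)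
      (use assms in \<open>auto simp: can_simulate_def safe_reg_cell cell_nonneg\<close>)
qed

lemma simulation_Store:
  assumes "0 \<le> R a" "a < K" "r < K" "machine_at l m (R, h)" "can_simulate l 1 V"
  shows "simulation (sim K (Store a r)) l 1 (R, h(nat (R a) := R r)) V m"
proof -
  have "0 \<le> l" "l < S" "R r \<in> words b0"
    using assms by (auto simp: can_simulate_def machine_at_def)
  then show ?thesis unfolding sim.simps
    using safe_mem_cell_Deref_reg_cell[OF _ assms(4), of 0 _ a]
      safe_Deref_reg_cell[OF _ assms(4), of 0 _ r]
      machine_at_upd_mem[OF assms(4), of "R r" "nat (R a)"]
    by (intro simulation_tick_store[where v = "int K + R a"])
      (use assms in \<open>auto simp del: safe.simps(4) val.simps(4)\<close>)
qed

lemma simulation_While_exit: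
  assumes "fst s r = 0" "r < K" "machine_at l m s" "can_simulate l 1 V"
  shows "simulation (sim K (While r p)) l 1 s V m"
proof -
  have "can_simulate l 0 (V(rSteps := V rSteps + 1))"
    using can_simulate_steps[of l 1 0 V] assms(4) by simp
  from safe_Deref_reg_cell[OF this assms(3), of r] show ?thesis
    unfolding sim.simps simulation_def runs_def
    by (intro wp_Seq wp_tick wp_loop_exit)
      (use assms in \<open>auto simp: credit_def simp del: safe.simps(4) val.simps(4)\<close>)
qed

lemma simulation_sim:
  assumes "exec b0 p s u s'" "reg_bound p \<le> K" "machine_at l m s" "can_simulate l u V"
  shows "simulation (sim K p) l u s' V m"
  using assms
proof (induction arbitrary: V m rule: exec.induct)
  case (Skip s)
  then show ?case unfolding simulation_def runs_def
    by (simp, intro wp_tick) (auto simp: credit_def)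
next
  case (Seq p s u1 s1 q u2 s2)
  then show ?case unfolding sim.simps
    using can_simulate_le[of l "u1 + u2" V u1] can_simulate_steps[of l u1 u2 V]
    by (intro simulation_Seq) auto
next
  case (IfTrue s r p u s' q)
  then show ?case unfolding sim.simps using can_simulate_steps[of l 1 u V]
    by (intro simulation_tick_cond) auto
next
  case (IfFalse s r q u s' p)
  then show ?case unfolding sim.simps using can_simulate_steps[of l 1 u V]
    by (intro simulation_tick_cond) auto
next
  case (WhileTrue s r p u1 s1 u2 s2)
  let ?V = "V(rSteps := V rSteps + 1)"
  have can: "can_simulate l (u1 + u2) ?V"
    using can_simulate_steps[of l 1 "u1 + u2" V] WhileTrue.prems by (simp add: add.assoc)
  have "simulation (sim K p ;; sim K (While r p)) l (u1 + u2) s2 ?V m"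
    using WhileTrue can can_simulate_le[OF can, of u1] can_simulate_steps[OF can]
    by (intro simulation_Seq) auto
  from simulation_tick_unfold[OF _ WhileTrue.prems(2) _ _ this[unfolded sim.simps]]
  show ?case unfolding sim.simps using WhileTrue by (simp add: add.assoc)
qed (simp_all add: simulation_Const simulation_Op simulation_Load simulation_Store
    simulation_While_exit del: sim.simps One_nat_def)

end


section \<open>Sorting the columns with a tournament tree\<close>

text \<open>Tree nodes hold \<open>0\<close> for an empty subtree and \<open>i + 1\<close> for row \<open>i\<close>.\<close>

definition better :: "(int \<Rightarrow> int) \<Rightarrow> int \<Rightarrow> int \<Rightarrow> int" where
  "better key a c = (if a = 0 then c else if c = 0 then a else
     if key (c - 1) < key (a - 1) then c else a)"

definition tournament_at :: "(int \<Rightarrow> int) \<Rightarrow> (int \<Rightarrow> int) \<Rightarrow> int \<Rightarrow> bool" where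
  "tournament_at key f x \<longleftrightarrow> f x = better key (f (2 * x)) (f (2 * x + 1))"

lemma tournament_root_le:
  assumes "\<And>x. 1 \<le> x \<Longrightarrow> x < n \<Longrightarrow> tournament_at key f x"
    and "1 \<le> y" "y < 2 * n" "f y \<noteq> 0"
  shows "f 1 \<noteq> 0 \<and> key (f 1 - 1) \<le> key (f y - 1)"
  using assms(2-)
proof (induction "nat y" arbitrary: y rule: less_induct)
  case less
  show ?case
  proof (cases "y = 1")
    case False
    define x where "x = y div 2"
    have x: "1 \<le> x" "x < n" "y = 2 * x \<or> y = 2 * x + 1" "x < y"
      using less.prems False by (auto simp: x_def)
    from assms(1)[OF x(1,2)] x(3) less.prems(3)
    have "f x \<noteq> 0 \<and> key (f x - 1) \<le> key (f y - 1)"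
      unfolding tournament_at_def better_def by (auto split: if_splits)
    then show ?thesis using less.hyps[of x] x less.prems by fastforce
  qed (use less.prems in auto)
qed

lemma tournament_winner_is_leaf:
  assumes "\<And>x. 1 \<le> x \<Longrightarrow> x < n \<Longrightarrow> tournament_at key f x"
    and "1 \<le> x" "x < 2 * n" "f x \<noteq> 0"
  shows "\<exists>y. n \<le> y \<and> y < 2 * n \<and> f y = f x"
  using assms(2-)
proof (induction "nat (2 * n - x)" arbitrary: x rule: less_induct)
  case less
  show ?case
  proof (cases "n \<le> x")
    case False
    then have "tournament_at key f x" using assms(1) less.prems by simp
    then have "f x = f (2 * x) \<or> f x = f (2 * x + 1)"
      unfolding tournament_at_def better_def by (auto split: if_splits)
    then show ?thesis
      using less.hyps[of "2 * x"] less.hyps[of "2 * x + 1"] less.prems False by fastforce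
  qed (use less.prems in auto)
qed

definition sorts :: "int \<Rightarrow> (int \<Rightarrow> int) \<Rightarrow> (int \<Rightarrow> int) \<Rightarrow> bool" where
  "sorts n key p \<longleftrightarrow> bij_betw p {0..<n} {0..<n} \<and> mono_on {0..<n} (\<lambda>r. key (p r))"

definition sorts_except :: "int \<Rightarrow> (int \<Rightarrow> int) \<Rightarrow> int set \<Rightarrow> (int \<Rightarrow> int) \<Rightarrow> int \<Rightarrow> bool" where
  "sorts_except n key U p r \<longleftrightarrow> U \<subseteq> {0..<n} \<and> bij_betw p {0..<r} ({0..<n} - U) \<and>
    mono_on {0..<r} (\<lambda>a. key (p a)) \<and> (\<forall>a \<in> {0..<r}. \<forall>u \<in> U. key (p a) \<le> key u)"

lemma sorts_cong: "(\<And>r. 0 \<le> r \<Longrightarrow> r < n \<Longrightarrow> p r = p' r) \<Longrightarrow> sorts n key p \<longleftrightarrow> sorts n key p'"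
  unfolding sorts_def mono_on_def by (subst bij_betw_cong[of _ p p']) auto

lemma sorts_except_start: "sorts_except n key {0..<n} p 0"
  by (auto simp: sorts_except_def bij_betw_def mono_on_def)

lemma sorts_except_card:
  assumes "sorts_except n key U p r" "0 \<le> r" "0 \<le> n"
  shows "finite U" "int (card U) = n - r"
proof -
  have U: "U \<subseteq> {0..<n}" "bij_betw p {0..<r} ({0..<n} - U)"
    using assms(1) by (simp_all add: sorts_except_def)
  then show "finite U" by (auto intro: finite_subset)
  have "nat r = card ({0..<n} - U)" using bij_betw_same_card[OF U(2)] by simp
  also have "\<dots> = nat n - card U" using U(1) by (subst card_Diff_subset) (auto intro: finite_subset)
  finally show "int (card U) = n - r"
    using card_mono[OF _ U(1)] assms(2,3) by simp
qed

lemma sorts_except_end: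
  assumes "sorts_except n key U p n" "0 \<le> n"
  shows "U = {}" "sorts n key p"
proof -
  show "U = {}" using sorts_except_card[OF assms(1,2,2)] by simp
  then show "sorts n key p" using assms(1) by (simp add: sorts_except_def sorts_def)
qed

lemma sorts_except_nonempty: "sorts_except n key U p r \<Longrightarrow> 0 \<le> r \<Longrightarrow> r < n \<Longrightarrow> U \<noteq> {}"
  using sorts_except_card(2)[of n key U p r] by auto

lemma sorts_except_step:
  assumes "sorts_except n key U p r" "i \<in> U" "\<And>u. u \<in> U \<Longrightarrow> key i \<le> key u" "0 \<le> r"
    and p': "\<And>a. 0 \<le> a \<Longrightarrow> a < r \<Longrightarrow> p' a = p a" "p' r = i"
  shows "sorts_except n key (U - {i}) p' (r + 1)"
proof -
  have U: "U \<subseteq> {0..<n}" and bij: "bij_betw p {0..<r} ({0..<n} - U)"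
    and mono: "mono_on {0..<r} (\<lambda>a. key (p a))"
    and below: "\<And>a u. a \<in> {0..<r} \<Longrightarrow> u \<in> U \<Longrightarrow> key (p a) \<le> key u"
    using assms(1) by (simp_all add: sorts_except_def)
  have range: "{0..<r + 1} = insert r {0..<r}" using assms(4) by auto
  have "bij_betw p' {0..<r} ({0..<n} - U)"
    using bij p'(1) by (subst bij_betw_cong[of _ _ p]) auto
  then have "bij_betw p' (insert r {0..<r}) (insert (p' r) ({0..<n} - U))"
    using p'(2) assms(2)
    by (subst notIn_Un_bij_betw3[symmetric, of r "{0..<r}" p' "{0..<n} - U", simplified]) auto
  moreover have "insert (p' r) ({0..<n} - U) = {0..<n} - (U - {i})"
    using p'(2) U assms(2) by auto
  ultimately have "bij_betw p' {0..<r + 1} ({0..<n} - (U - {i}))" by (simp add: range)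
  moreover have "mono_on {0..<r + 1} (\<lambda>a. key (p' a))"
    using mono below assms(2) p' by (auto simp: mono_on_def range)
  moreover have "key (p' a) \<le> key u" if "a \<in> {0..<r + 1}" "u \<in> U - {i}" for a u
    using that below assms(3) p' by (cases "a = r") auto
  ultimately show ?thesis using U by (auto simp: sorts_except_def)
qed

definition matrix_entry :: "exp \<Rightarrow> exp" where
  "matrix_entry e = Deref (e *\<^sub>e Var rDim +\<^sub>e Var rCol)"

definition perm_cell :: "exp \<Rightarrow> exp" where
  "perm_cell e = Var rPerm +\<^sub>e Var rCol *\<^sub>e Var rDim +\<^sub>e e"

definition node_cell :: exp where
  "node_cell = Var rTree +\<^sub>e Var rNode"

definition store_winner :: com where
  "store_winner =
    IF Var rLeft =\<^sub>e Lit 0 THEN store node_cell (Var rRight)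
    ELSE IF Var rRight =\<^sub>e Lit 0 THEN store node_cell (Var rLeft)
    ELSE IF matrix_entry (Var rRight -\<^sub>e Lit 1) <\<^sub>e matrix_entry (Var rLeft -\<^sub>e Lit 1)
      THEN store node_cell (Var rRight)
    ELSE store node_cell (Var rLeft)"

definition sift_step :: com where
  "sift_step =
    rNode ::= BinOp Div (Var rNode) (Lit 2) ;;
    rLeft ::= Deref (Var rTree +\<^sub>e Lit 2 *\<^sub>e Var rNode) ;;
    rRight ::= Deref (Var rTree +\<^sub>e (Lit 2 *\<^sub>e Var rNode +\<^sub>e Lit 1)) ;;
    store_winner"

definition sift_up :: com where
  "sift_up = WHILE Lit 1 <\<^sub>e Var rNode DO sift_step"

definition set_leaf :: "exp \<Rightarrow> com" where
  "set_leaf e = rNode ::= Var rDim +\<^sub>e Var rRow ;; store node_cell e ;; sift_up"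

definition insert_leaves :: com where
  "insert_leaves = FOR rRow FROM Lit 0 BELOW rDim DO set_leaf (Var rRow +\<^sub>e Lit 1)"

definition extract_min :: com where
  "extract_min =
    rRow ::= Deref (Var rTree +\<^sub>e Lit 1) -\<^sub>e Lit 1 ;;
    store (perm_cell (Var rRank)) (Var rRow) ;;
    set_leaf (Lit 0)"

definition sort_column :: com where
  "sort_column = insert_leaves ;; FOR rRank FROM Lit 0 BELOW rDim DO extract_min"

definition sort_columns :: com where
  "sort_columns = FOR rCol FROM Lit 0 BELOW rDim DO sort_column"

lemma cost_matrix_entry [simp]: "cost (matrix_entry e) = cost e + 5"
  by (simp add: matrix_entry_def)

lemma cost_perm_cell [simp]: "cost (perm_cell e) = cost e + 6"
  by (simp add: perm_cell_def)

locale layout =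
  fixes n S :: int and b :: nat and M :: "int \<Rightarrow> int \<Rightarrow> int"
  assumes n_pos: "1 \<le> n" and S_ge: "10 * (n * n) \<le> S" and S_fits: "S \<le> 2 ^ b"
begin

text \<open>
  The cells below \<open>S\<close> hold the matrix, the query, the answer from \<open>answer_base\<close> on, the sorting
  permutations of the columns from \<open>perm_base\<close> on, and the tournament tree from \<open>tree_base\<close> on.
\<close>

definition nn :: int where "nn = n * n"

definition answer_base :: int where "answer_base = nn + n"
definition perm_base :: int where "perm_base = nn + 2 * n"
definition tree_base :: int where "tree_base = 2 * nn + 2 * n"

lemmas region_defs = answer_base_def perm_base_def tree_base_def

abbreviation tree_cells :: "int set" where "tree_cells \<equiv> {tree_base + 1..<tree_base + 2 * n}"
abbreviation perm_cells :: "int \<Rightarrow> int set"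
  where "perm_cells k \<equiv> {perm_base + k * n..<perm_base + k * n + n}"

definition static_env :: "env \<Rightarrow> bool" where
  "static_env V \<longleftrightarrow> V rDim = n \<and> V rSquare = nn \<and> V rAnswer = answer_base \<and> V rPerm = perm_base \<and>
    V rTree = tree_base \<and> V rStride = S"

definition at_column :: "int \<Rightarrow> env \<Rightarrow> bool" where
  "at_column k V \<longleftrightarrow> static_env V \<and> V rCol = k \<and> 0 \<le> k \<and> k < n"

definition has_matrix :: "imem \<Rightarrow> bool" where
  "has_matrix m \<longleftrightarrow> (\<forall>i k. 0 \<le> i \<and> i < n \<and> 0 \<le> k \<and> k < n \<longrightarrow> m (i * n + k) = M i k)"

definition tree :: "imem \<Rightarrow> int \<Rightarrow> int" where
  "tree m x = m (tree_base + x)"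

definition perm :: "imem \<Rightarrow> int \<Rightarrow> int \<Rightarrow> int" where
  "perm m k r = m (perm_base + k * n + r)"

abbreviation column :: "int \<Rightarrow> int \<Rightarrow> int" where
  "column k \<equiv> (\<lambda>i. M i k)"

lemma tree_upd [simp]: "tree (m(tree_base + x := y)) = (tree m)(x := y)"
  by (auto simp: tree_def)

lemma tree_agree: "agree_off F m m' \<Longrightarrow> tree_base + x \<notin> F \<Longrightarrow> tree m' x = tree m x"
  unfolding tree_def by (rule agree_offD)

lemma static_env_upd [simp]: "rStride < x \<Longrightarrow> static_env (V(x := y)) \<longleftrightarrow> static_env V"
  by (simp add: static_env_def)

lemma at_column_upd [simp]: "rCol < x \<Longrightarrow> at_column k (V(x := y)) \<longleftrightarrow> at_column k V"
  by (simp add: at_column_def)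

lemma static_env_agree: "static_env V \<Longrightarrow> agree_off {r..} V V' \<Longrightarrow> rStride < r \<Longrightarrow> static_env V'"
  by (simp add: static_env_def agree_off_def)

lemma at_column_agree: "at_column k V \<Longrightarrow> agree_off {r..} V V' \<Longrightarrow> rCol < r \<Longrightarrow> at_column k V'"
  using static_env_agree[of V r V'] agree_offD[of "{r..}" V V' rCol] by (simp add: at_column_def)

lemma n_le_nn: "n \<le> nn"
  using n_pos mult_right_mono[of 1 n n] by (simp add: nn_def)

lemma row_major_bound:
  assumes "0 \<le> i" "i < n" "0 \<le> k" "k < n"
  shows "0 \<le> i * n" "i * n + k < nn" "i * n + n \<le> nn"
proof -
  have "(i + 1) * n \<le> nn" unfolding nn_def using assms n_pos by (intro mult_right_mono) auto
  then show "i * n + n \<le> nn" by (simp add: algebra_simps)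
  then show "i * n + k < nn" using assms by linarith
  show "0 \<le> i * n" using assms n_pos by simp
qed

lemma small_word: "0 \<le> x \<Longrightarrow> x < 10 * nn \<Longrightarrow> x \<in> words b"
  using S_ge S_fits by (intro nonneg_in_words) (auto simp: nn_def)

lemma small_numeral_word [simp]: "0 \<in> words b" "1 \<in> words b" "2 \<in> words b"
  using n_pos n_le_nn by (auto intro!: small_word)

lemma of_bool_word [simp]: "of_bool P \<in> words b"
  by (simp add: of_bool_def)

lemma b_pos: "1 \<le> b"
proof (rule ccontr)
  assume "\<not> 1 \<le> b"
  then have "b = 0" by simp
  then have "S \<le> 1" using S_fits by simp
  then show False using S_ge n_le_nn n_pos unfolding nn_def by linarith
qed

lemma n_less_word: "n < 2 ^ b"
  using S_ge S_fits n_le_nn n_pos unfolding nn_def by linarith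

lemma has_matrix_agree:
  assumes "has_matrix m" "agree_off F m m'" "F \<subseteq> {nn..}"
  shows "has_matrix m'"
  unfolding has_matrix_def
proof (intro allI impI)
  fix i k assume ik: "0 \<le> i \<and> i < n \<and> 0 \<le> k \<and> k < n"
  then have "i * n + k \<notin> F" using row_major_bound(2)[of i k] assms(3) by auto
  then show "m' (i * n + k) = M i k"
    using ik assms(1) agree_offD[OF assms(2)] by (simp add: has_matrix_def)
qed

lemma safe_matrix_entry:
  assumes "at_column k V" "has_matrix m" "safe b e V m" "val e V m = i" "0 \<le> i" "i < n"
  shows "safe b (matrix_entry e) V m" "val (matrix_entry e) V m = M i k"
proof -
  have k: "V rDim = n" "V rCol = k" "0 \<le> k" "k < n"
    using assms(1) by (simp_all add: at_column_def static_env_def)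
  then have "i * n \<in> words b" "i * n + k \<in> words b"
    using row_major_bound[of i k] assms(5,6) n_pos n_le_nn by (auto intro!: small_word)
  then show "safe b (matrix_entry e) V m" "val (matrix_entry e) V m = M i k"
    using assms k row_major_bound[of i k]
    by (simp_all add: matrix_entry_def has_matrix_def)
qed

lemma safe_perm_cell:
  assumes "at_column k V" "safe b e V m" "val e V m = r" "0 \<le> r" "r < n"
  shows "safe b (perm_cell e) V m" "val (perm_cell e) V m = perm_base + k * n + r"
proof -
  have k: "V rDim = n" "V rCol = k" "V rPerm = perm_base" "0 \<le> k" "k < n"
    using assms(1) by (simp_all add: at_column_def static_env_def)
  then have "k * n \<in> words b" "perm_base + k * n \<in> words b" "perm_base + k * n + r \<in> words b"
    using row_major_bound[of k r] assms(4,5) n_pos n_le_nn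
    by (auto simp: region_defs intro!: small_word)
  then show "safe b (perm_cell e) V m" "val (perm_cell e) V m = perm_base + k * n + r"
    using assms k by (simp_all add: perm_cell_def)
qed

definition tournament_except :: "int \<Rightarrow> int \<Rightarrow> imem \<Rightarrow> bool" where
  "tournament_except k z m \<longleftrightarrow>
    (\<forall>y. 1 \<le> y \<and> y < n \<and> y \<noteq> z \<longrightarrow> tournament_at (column k) (tree m) y)"

definition tree_range :: "imem \<Rightarrow> bool" where
  "tree_range m \<longleftrightarrow> (\<forall>y. 1 \<le> y \<and> y < 2 * n \<longrightarrow> 0 \<le> tree m y \<and> tree m y \<le> n)"

definition tree_leaves :: "int set \<Rightarrow> imem \<Rightarrow> bool" where
  "tree_leaves U m \<longleftrightarrow> (\<forall>i. 0 \<le> i \<and> i < n \<longrightarrow> tree m (n + i) = (if i \<in> U then i + 1 else 0))"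

definition tournament_of :: "int \<Rightarrow> int set \<Rightarrow> imem \<Rightarrow> bool" where
  "tournament_of k U m \<longleftrightarrow> tree_range m \<and> tournament_except k 0 m \<and> tree_leaves U m"

definition tree_empty :: "imem \<Rightarrow> bool" where
  "tree_empty m \<longleftrightarrow> (\<forall>y. 1 \<le> y \<and> y < 2 * n \<longrightarrow> tree m y = 0)"

lemma tree_leavesD:
  "tree_leaves U m \<Longrightarrow> 0 \<le> i \<Longrightarrow> i < n \<Longrightarrow> tree m (n + i) = (if i \<in> U then i + 1 else 0)"
  by (simp add: tree_leaves_def)

lemma tournament_ofD:
  assumes "tournament_of k U m" "1 \<le> x" "x < n"
  shows "tournament_at (column k) (tree m) x"
  using assms by (simp add: tournament_of_def tournament_except_def)

lemma tournament_of_cong: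
  assumes "tournament_of k U m" "\<And>y. 1 \<le> y \<Longrightarrow> y < 2 * n \<Longrightarrow> tree m' y = tree m y"
  shows "tournament_of k U m'"
  using assms n_pos
  by (simp add: tournament_of_def tree_range_def tree_leaves_def tournament_except_def
      tournament_at_def)

lemma tournament_root:
  assumes "tournament_of k U m" "U \<subseteq> {0..<n}" "u \<in> U"
  shows "tree m 1 - 1 \<in> U" "M (tree m 1 - 1) k \<le> M u k"
proof -
  have leaves: "tree_leaves U m" using assms(1) by (simp add: tournament_of_def)
  have u: "tree m (n + u) = u + 1" "0 \<le> u" "u < n" using assms tree_leavesD[OF leaves, of u] by auto
  have root: "tree m 1 \<noteq> 0" "M (tree m 1 - 1) k \<le> M u k"
    using tournament_root_le[of n "column k" "tree m" "n + u", OF tournament_ofD[OF assms(1)]]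
      u n_pos
    by auto
  then show "M (tree m 1 - 1) k \<le> M u k" by simp
  obtain y where "n \<le> y" "y < 2 * n" "tree m y = tree m 1"
    using tournament_winner_is_leaf[of n "column k" "tree m" 1, OF tournament_ofD[OF assms(1)]]
      root n_pos by auto
  with tree_leavesD[OF leaves, of "y - n"] root(1)
  show "tree m 1 - 1 \<in> U" by (auto split: if_splits)
qed

lemma tournament_of_empty: "tournament_of k {} m \<longleftrightarrow> tree_empty m"
proof
  assume tournament: "tournament_of k {} m"
  show "tree_empty m" unfolding tree_empty_def
  proof (intro allI impI, rule ccontr)
    fix y assume "1 \<le> y \<and> y < 2 * n" and nonzero: "tree m y \<noteq> 0"
    then obtain z where "n \<le> z" "z < 2 * n" "tree m z = tree m y"
      using tournament_winner_is_leaf[of n "column k" "tree m" y, OF tournament_ofD[OF tournament]]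
      by auto
    with nonzero show False
      using tournament tree_leavesD[of "{}" m "z - n"] by (simp add: tournament_of_def)
  qed
next
  assume "tree_empty m"
  then show "tournament_of k {} m"
    using n_pos
    by (simp add: tree_empty_def tournament_of_def tree_range_def tree_leaves_def
        tournament_except_def tournament_at_def better_def)
qed

definition winner :: "int \<Rightarrow> imem \<Rightarrow> int \<Rightarrow> int" where
  "winner k m x = better (column k) (tree m (2 * x)) (tree m (2 * x + 1))"

lemma tournament_except_parent:
  assumes "tournament_except k x m"
  shows "tournament_except k (x div 2) (m(tree_base + x := winner k m x))"
  unfolding tournament_except_def
proof (intro allI impI)
  fix y assume y: "1 \<le> y \<and> y < n \<and> y \<noteq> x div 2"
  then have "2 * y \<noteq> x" "2 * y + 1 \<noteq> x" by auto
  with y show "tournament_at (column k) (tree (m(tree_base + x := winner k m x))) y"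
    using assms by (cases "y = x") (auto simp: tournament_except_def tournament_at_def winner_def)
qed

lemma runs_store_winner:
  assumes column: "at_column k V" and "has_matrix m"
    and node: "1 \<le> V rNode" "V rNode < n"
    and children: "0 \<le> V rLeft" "V rLeft \<le> n" "0 \<le> V rRight" "V rRight \<le> n"
    and "Q V (m(tree_base + V rNode := better (column k) (V rLeft) (V rRight)))" "40 \<le> T"
  shows "runs b store_winner rNode {tree_base + 1..<tree_base + n} T Q V m"
proof -
  have env: "V rTree = tree_base" using column by (simp add: at_column_def static_env_def)
  have address: "tree_base + V rNode \<in> words b" "0 \<le> tree_base + V rNode" using node n_le_nn n_pos
    by (auto simp: region_defs intro!: small_word)
  have store: "runs b (store node_cell (Var y)) rNode {tree_base + 1..<tree_base + n} T Q V m"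
    if "V y = better (column k) (V rLeft) (V rRight)" "y < nvars" "5 \<le> T" for y T
    unfolding node_cell_def
    by (rule runs_store) (use that env address node assms(9) in simp_all)
  have entry: "safe b (matrix_entry (Var y -\<^sub>e Lit 1)) V m"
    "val (matrix_entry (Var y -\<^sub>e Lit 1)) V m = M (V y - 1) k"
    if "V y \<noteq> 0" "0 \<le> V y" "V y \<le> n" "y < nvars" for y
  proof -
    have "V y - 1 \<in> words b" using that n_le_nn by (intro small_word) auto
    then show "safe b (matrix_entry (Var y -\<^sub>e Lit 1)) V m"
      "val (matrix_entry (Var y -\<^sub>e Lit 1)) V m = M (V y - 1) k"
      using safe_matrix_entry[OF column assms(2), of "Var y -\<^sub>e Lit 1" "V y - 1"] that by simp_all
  qed
  show ?thesis unfolding store_winner_def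
    by (intro runs_cond store) (use assms(10) in \<open>simp_all add: children entry better_def\<close>)
qed

lemma runs_sift_step:
  assumes column: "at_column k V" and mem: "has_matrix m" "tree_range m"
    and node: "1 < V rNode" "V rNode < 2 * n"
  shows "runs b sift_step rNode {tree_base + 1..<tree_base + n} 60
    (\<lambda>V' m'. V' rNode = V rNode div 2 \<and>
    m' = m(tree_base + V rNode div 2 := winner k m (V rNode div 2))) V m"
proof -
  define x where "x = V rNode div 2"
  have x: "1 \<le> x" "x < n" using node by (auto simp: x_def)
  define left right where "left = tree m (2 * x)" and "right = tree m (2 * x + 1)"
  have loads: "m (tree_base + 2 * x) = left" "m (tree_base + (2 * x + 1)) = right"
    by (simp_all add: left_def right_def tree_def)
  have children: "0 \<le> left" "left \<le> n" "0 \<le> right" "right \<le> n"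
    using mem(2) x by (auto simp: tree_range_def left_def right_def)
  have env: "V rTree = tree_base" using column by (simp add: at_column_def static_env_def)
  have words: "tree_base + (2 * x + 1) \<in> words b" "x \<in> words b" "2 * x \<in> words b"
    "2 * x + 1 \<in> words b"
    "tree_base + 2 * x \<in> words b" and nonneg: "0 \<le> tree_base"
    using x n_le_nn n_pos by (auto simp: region_defs intro!: small_word)
  have "runs b store_winner rNode {tree_base + 1..<tree_base + n} 43
      (\<lambda>V' m'. V' rNode = x \<and> m' = m(tree_base + x := winner k m x))
      (V(rNode := x, rLeft := left, rRight := right)) m"
    by (rule runs_store_winner[where k = k])
      (use column mem children x in \<open>simp_all add: winner_def left_def right_def\<close>)
  then show ?thesis unfolding sift_step_def x_def[symmetric]
    by (intro runs_assign_Seq)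
      (use words env x nonneg loads in \<open>simp_all add: x_def[symmetric]\<close>)
qed

lemma tree_range_winner:
  assumes "tree_range m" "1 \<le> x" "x < n"
  shows "tree_range (m(tree_base + x := winner k m x))"
proof -
  have "0 \<le> tree m y \<and> tree m y \<le> n" if "y = 2 * x \<or> y = 2 * x + 1" for y
    using that assms by (auto simp: tree_range_def)
  then have "0 \<le> winner k m x \<and> winner k m x \<le> n"
    by (auto simp: winner_def better_def)
  with assms(1) show ?thesis by (simp add: tree_range_def)
qed

lemma runs_sift_up:
  assumes column: "at_column k V" and mem: "has_matrix m" "tree_range m"
    and node: "1 \<le> V rNode" "V rNode < 2 * n"
    and tournament: "tournament_except k (V rNode div 2) m"
  shows "runs b sift_up rNode {tree_base + 1..<tree_base + n} (70 * bitlen (V rNode))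
    (\<lambda>_ m'. tree_range m' \<and> tournament_except k 0 m') V m"
  unfolding sift_up_def
proof -
  define I where "I = (\<lambda>T V' m'. tree_range m' \<and> 1 \<le> V' rNode \<and> V' rNode < 2 * n \<and>
    tournament_except k (V' rNode div 2) m' \<and> 70 * bitlen (V' rNode) \<le> T)"
  show "runs b (WHILE Lit 1 <\<^sub>e Var rNode DO sift_step) rNode {tree_base + 1..<tree_base + n}
    (70 * bitlen (V rNode)) (\<lambda>_ m'. tree_range m' \<and> tournament_except k 0 m') V m"
  proof (rule runs_loop[where measure = "\<lambda>V' _. nat (V' rNode)" and I = I])
    fix T V' m'
    assume frame: "agree_off {rNode..} V V'" "agree_off {tree_base + 1..<tree_base + n} m m'"
      and inv: "I T V' m'"
    let ?x = "V' rNode div 2"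
    have bitlen: "bitlen (V' rNode) = bitlen ?x + 1"
      using inv compute_bitlen[of "V' rNode"] by (simp add: I_def)
    show "safe b (Lit 1 <\<^sub>e Var rNode) V' m'" by simp
    show "int (cost (Lit 1 <\<^sub>e Var rNode)) + 1 \<le> T \<and> tree_range m' \<and> tournament_except k 0 m'"
      if "val (Lit 1 <\<^sub>e Var rNode) V' m' = 0"
    proof -
      have root: "V' rNode = 1" using that inv by (simp add: I_def split: if_splits)
      show ?thesis using inv bitlen unfolding I_def root by simp
    qed
    assume "val (Lit 1 <\<^sub>e Var rNode) V' m' \<noteq> 0"
    then have gt: "1 < V' rNode" by (simp split: if_splits)
    have "has_matrix m'"
      using n_pos n_le_nn by (intro has_matrix_agree[OF mem(1) frame(2)]) (auto simp: region_defs)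
    then have "runs b sift_step rNode {tree_base + 1..<tree_base + n} 60
        (\<lambda>V'' m''. V'' rNode = ?x \<and> m'' = m'(tree_base + ?x := winner k m' ?x)) V' m'"
      using inv gt at_column_agree[OF column frame(1)]
      by (intro runs_sift_step) (auto simp: I_def)
    moreover have "tree_range (m'(tree_base + ?x := winner k m' ?x))"
      using inv gt by (intro tree_range_winner) (auto simp: I_def)
    ultimately show "\<exists>c. runs b sift_step rNode {tree_base + 1..<tree_base + n} c (\<lambda>V'' m''.
        I (T - int (cost (Lit 1 <\<^sub>e Var rNode)) - 1 - c) V'' m'' \<and>
            nat (V'' rNode) < nat (V' rNode)) V' m'"
      by (intro exI[of _ 60], elim runs_mono)
        (use inv gt bitlen tournament_except_parent[of k ?x m'] in \<open>auto simp: I_def\<close>)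
  qed (use mem node tournament in \<open>simp add: I_def\<close>)
qed

definition depth :: int where
  "depth = bitlen (2 * n)"

lemma bitlen_node_le_depth: "0 \<le> x \<Longrightarrow> x < 2 * n \<Longrightarrow> bitlen x \<le> depth"
  unfolding depth_def bitlen_def by (intro of_nat_mono floorlog_mono) simp

lemma runs_set_leaf:
  assumes column: "at_column k V" and row: "V rRow = i" "0 \<le> i" "i < n"
    and mem: "has_matrix m" "tournament_of k U m"
    and e: "\<And>x. safe b e (V(rNode := x)) m \<and>
        val e (V(rNode := x)) m = (if i \<in> U' then i + 1 else 0)"
      "cost e \<le> 3"
    and U': "\<And>j. j \<noteq> i \<Longrightarrow> j \<in> U' \<longleftrightarrow> j \<in> U"
  shows "runs b (set_leaf e) rNode tree_cells (70 * depth + 20) (\<lambda>_. tournament_of k U') V m"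
proof -
  let ?x = "n + i" and ?y = "if i \<in> U' then i + 1 else 0"
  let ?V = "V(rNode := ?x)" and ?m = "m(tree_base + ?x := ?y)"
  have env: "V rDim = n" "V rTree = tree_base" "at_column k ?V"
    using column by (simp_all add: at_column_def static_env_def)
  have words: "?x \<in> words b" "tree_base + ?x \<in> words b" "0 \<le> tree_base + ?x"
    using row n_pos n_le_nn by (auto simp: region_defs intro!: small_word)
  have "has_matrix ?m"
    using row n_pos n_le_nn
    by (intro has_matrix_agree[OF mem(1), of "{tree_base + ?x}"]) (auto simp: region_defs)
  moreover have "tree_range ?m"
    using mem(2) row by (auto simp: tournament_of_def tree_range_def)
  moreover have "tournament_except k (?x div 2) ?m"
    unfolding tournament_except_def
  proof (intro allI impI)
    fix y assume y: "1 \<le> y \<and> y < n \<and> y \<noteq> ?x div 2"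
    then have "2 * y \<noteq> ?x" "2 * y + 1 \<noteq> ?x" by auto
    with y show "tournament_at (column k) (tree ?m) y"
      using tournament_ofD[OF mem(2), of y] row by (simp add: tournament_at_def)
  qed
  ultimately have sift: "runs b sift_up rNode {tree_base + 1..<tree_base + n} (70 * bitlen ?x)
      (\<lambda>_ m'. tree_range m' \<and> tournament_except k 0 m') ?V ?m"
    using runs_sift_up[of k ?V ?m] env row by simp
  have leaves: "tree_leaves U' m'" if "agree_off {tree_base + 1..<tree_base + n} ?m m'" for m'
  proof -
    have "tree m' (n + j) = tree ?m (n + j)" if "0 \<le> j" for j
      by (rule tree_agree[OF \<open>agree_off _ ?m m'\<close>]) (use that in auto)
    then show ?thesis
      using mem(2) U' row by (auto simp: tournament_of_def tree_leaves_def)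
  qed
  have "runs b sift_up rNode tree_cells T (\<lambda>_. tournament_of k U') ?V ?m" if "70 * depth \<le> T" for T
    by (rule runs_mono[OF sift])
      (use that bitlen_node_le_depth[of ?x] row n_pos leaves in \<open>auto simp: tournament_of_def\<close>)
  then show ?thesis unfolding set_leaf_def node_cell_def
    by (intro runs_assign_Seq runs_store_Seq) (use words e row n_pos in \<open>simp_all add: env\<close>)
qed

lemma has_matrix_sort_agree:
  assumes "has_matrix m" "agree_off (tree_cells \<union> perm_cells k) m m'" "0 \<le> k" "k < n"
  shows "has_matrix m'"
proof (rule has_matrix_agree[OF assms(1,2)])
  have "0 \<le> k * n" using assms n_pos by simp
  then show "tree_cells \<union> perm_cells k \<subseteq> {nn..}" using n_pos n_le_nn by (auto simp: region_defs)
qed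

lemma runs_insert_leaves:
  assumes column: "at_column k V" and mem: "has_matrix m" "tree_empty m"
  shows "runs b insert_leaves rRow tree_cells (n * (70 * depth + 27) + 5)
    (\<lambda>_. tournament_of k {0..<n}) V m"
  unfolding insert_leaves_def
proof (rule runs_for_loop_const[where c = "70 * depth + 20" and lo = 0 and
      J = "\<lambda>i. tournament_of k {0..<i}"])
  fix i V' m'
  assume i: "0 \<le> i" "i < n" "V' rRow = i"
    and frame: "agree_off {rRow..} V V'" "agree_off tree_cells m m'"
    and inv: "tournament_of k {0..<i} m'"
  have "i + 1 \<in> words b" using i n_le_nn by (intro small_word) auto
  moreover have "has_matrix m'"
    using column by (intro has_matrix_sort_agree[OF mem(1) agree_off_mono[OF frame(2)], of k])
      (auto simp: at_column_def)
  ultimately show "runs b (set_leaf (Var rRow +\<^sub>e Lit 1)) (Suc rRow) tree_cells (70 * depth + 20)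
      (\<lambda>_. tournament_of k {0..<i + 1}) V' m'"
    using i inv at_column_agree[OF column frame(1)]
    by (simp, intro runs_set_leaf[where i = i and U = "{0..<i}"]) auto
qed (use column mem n_pos n_less_word b_pos in
    \<open>auto simp: tournament_of_empty at_column_def static_env_def\<close>)

definition partly_sorted :: "int \<Rightarrow> int \<Rightarrow> imem \<Rightarrow> bool" where
  "partly_sorted k r m \<longleftrightarrow>
    (\<exists>U. tournament_of k U m \<and> sorts_except n (column k) U (perm m k) r)"

lemma partly_sorted_all:
  assumes "partly_sorted k n m"
  shows "tree_empty m" "sorts n (column k) (perm m k)"
proof -
  obtain U where U: "tournament_of k U m" "sorts_except n (column k) U (perm m k) n"
    using assms by (auto simp: partly_sorted_def)
  have "U = {}" using sorts_except_end(1)[OF U(2)] n_pos by simp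
  with U(1) show "tree_empty m" by (simp add: tournament_of_empty)
  show "sorts n (column k) (perm m k)" using sorts_except_end(2)[OF U(2)] n_pos by simp
qed

lemma perm_cell_between:
  assumes "0 \<le> k" "k < n" "0 \<le> r" "r < n"
  shows "nn \<le> perm_base + k * n + r" "perm_base + k * n + r < tree_base"
  using row_major_bound[OF assms] assms(3) n_pos by (auto simp: region_defs)

lemma runs_remove_leaf:
  assumes column: "at_column k V" and "V rRow = i" "0 \<le> i" "i < n"
    and mem: "has_matrix m" "tournament_of k U m" and rank: "0 \<le> r" "r < n"
  shows "runs b (set_leaf (Lit 0)) rNode tree_cells (70 * depth + 20)
    (\<lambda>_. tournament_of k (U - {i})) V (m(perm_base + k * n + r := x))"
proof (rule runs_set_leaf[where i = i and U = U])
  have below: "nn \<le> perm_base + k * n + r" "perm_base + k * n + r < tree_base"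
    using perm_cell_between[of k r] column rank by (simp_all add: at_column_def)
  then show "has_matrix (m(perm_base + k * n + r := x))"
    by (intro has_matrix_agree[OF mem(1), of "{perm_base + k * n + r}"]) auto
  show "tournament_of k U (m(perm_base + k * n + r := x))"
    using below by (intro tournament_of_cong[OF mem(2)]) (auto simp: tree_def)
qed (use assms in \<open>auto simp: at_column_def static_env_def\<close>)

lemma runs_extract_min:
  assumes column: "at_column k V" and rank: "V rRank = r" "0 \<le> r" "r < n"
    and mem: "has_matrix m" "partly_sorted k r m"
  shows "runs b extract_min rRow (tree_cells \<union> perm_cells k) (70 * depth + 40)
    (\<lambda>_. partly_sorted k (r + 1)) V m"
proof -
  obtain U where tournament: "tournament_of k U m"
    and sorted: "sorts_except n (column k) U (perm m k) r"
    using mem(2) by (auto simp: partly_sorted_def)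
  define i where "i = tree m 1 - 1"
  let ?V = "V(rRow := i)" and ?m = "m(perm_base + k * n + r := i)"
  have env: "V rTree = tree_base" "at_column k ?V" "0 \<le> k" "k < n"
    using column by (simp_all add: at_column_def static_env_def)
  have U: "U \<subseteq> {0..<n}" using sorted by (simp add: sorts_except_def)
  obtain u where "u \<in> U" using sorts_except_nonempty[OF sorted rank(2,3)] by blast
  then have min: "i \<in> U" "\<And>u. u \<in> U \<Longrightarrow> M i k \<le> M u k"
    using tournament_root[OF tournament U] by (auto simp: i_def)
  then have i: "0 \<le> i" "i < n" using U by auto
  note cell = perm_cell_between[OF env(3,4) rank(2,3)]
  have "sorts_except n (column k) (U - {i}) (perm m' k) (r + 1)"
    if frame: "agree_off tree_cells ?m m'" for m'
  proof (rule sorts_except_step[OF sorted min rank(2)])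
    have "perm m' k a = perm ?m k a" if "a \<le> r" for a
      unfolding perm_def by (rule agree_offD[OF frame]) (use that cell(2) in auto)
    then show "perm m' k r = i" "\<And>a. 0 \<le> a \<Longrightarrow> a < r \<Longrightarrow> perm m' k a = perm m k a"
      by (auto simp: perm_def)
  qed
  then have "runs b (set_leaf (Lit 0)) rRow (tree_cells \<union> perm_cells k) T
      (\<lambda>_. partly_sorted k (r + 1)) ?V ?m"
    if "70 * depth + 20 \<le> T" for T
    by (intro runs_mono[OF runs_remove_leaf[OF env(2) _ i mem(1) tournament rank(2,3)]])
      (use that in \<open>auto simp: partly_sorted_def\<close>)
  moreover have "safe b (perm_cell (Var rRank)) ?V m"
    "val (perm_cell (Var rRank)) ?V m = perm_base + k * n + r"
    using safe_perm_cell[OF env(2), of "Var rRank" m r] rank by simp_all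
  moreover have "tree_base + 1 \<in> words b" "i \<in> words b" "0 \<le> tree_base" "0 \<le> perm_base + k * n + r"
    using i cell n_pos n_le_nn by (auto simp: region_defs intro!: small_word)
  moreover have "m (tree_base + 1) - 1 = i" by (simp add: i_def tree_def)
  ultimately show ?thesis unfolding extract_min_def
    by (intro runs_assign_Seq runs_store_Seq) (use rank in \<open>simp_all add: env\<close>)
qed

lemma runs_extract_all:
  assumes column: "at_column k V" and mem: "has_matrix m" "tournament_of k {0..<n} m"
  shows "runs b (FOR rRank FROM Lit 0 BELOW rDim DO extract_min) rRank (tree_cells \<union> perm_cells k)
    (n * (70 * depth + 47) + 5) (\<lambda>_. partly_sorted k n) V m"
proof (rule runs_for_loop_const[where c = "70 * depth + 40" and lo = 0 and J = "partly_sorted k"])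
  fix r V' m'
  assume r: "0 \<le> r" "r < n" "V' rRank = r"
    and frame: "agree_off {rRank..} V V'" "agree_off (tree_cells \<union> perm_cells k) m m'"
    and inv: "partly_sorted k r m'"
  have "has_matrix m'"
    using column by (intro has_matrix_sort_agree[OF mem(1) frame(2)]) (auto simp: at_column_def)
  then show "runs b extract_min (Suc rRank) (tree_cells \<union> perm_cells k) (70 * depth + 40)
      (\<lambda>_. partly_sorted k (r + 1)) V' m'"
    using r inv runs_extract_min[of k V' r m'] at_column_agree[OF column frame(1)] by simp
qed (use column mem sorts_except_start n_pos n_less_word b_pos in
    \<open>auto simp: partly_sorted_def at_column_def static_env_def\<close>)

lemma runs_sort_column:
  assumes column: "at_column k V" and mem: "has_matrix m" "tree_empty m"
  shows "runs b sort_column rRank (tree_cells \<union> perm_cells k) (n * (140 * depth + 80) + 10)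
    (\<lambda>_ m'. tree_empty m' \<and> sorts n (column k) (perm m' k)) V m"
  unfolding sort_column_def
proof (rule runs_Seq[OF runs_insert_leaves[OF assms]])
  fix V1 m1
  assume frame: "agree_off {rRow..} V V1" "agree_off tree_cells m m1"
    and "tournament_of k {0..<n} m1"
  moreover have "has_matrix m1"
    using column by (intro has_matrix_sort_agree[OF mem(1) agree_off_mono[OF frame(2)], of k])
      (auto simp: at_column_def)
  ultimately show "runs b (FOR rRank FROM Lit 0 BELOW rDim DO extract_min) rRank
      (tree_cells \<union> perm_cells k)
      (n * (140 * depth + 80) + 10 - (n * (70 * depth + 27) + 5))
      (\<lambda>_ m'. tree_empty m' \<and> sorts n (column k) (perm m' k)) V1 m1"
    using at_column_agree[OF column frame(1)] n_pos
    by (intro runs_mono[OF runs_extract_all]) (auto simp: partly_sorted_all algebra_simps)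
qed auto

lemma row_major_inj:
  assumes "0 \<le> r" "r < n" "0 \<le> r'" "r' < n" "k * n + r = k' * n + r'"
  shows "k = k' \<and> r = r'"
proof -
  have "(k * n + r) mod n = r" "(k' * n + r') mod n = r'" using assms(1-4) by simp_all
  then have "r = r'" using assms(5) by metis
  then show ?thesis using assms n_pos by simp
qed

lemma perm_cells_disjoint:
  assumes "0 \<le> r" "r < n" "j \<noteq> k"
  shows "perm_base + j * n + r \<notin> perm_cells k"
proof
  assume "perm_base + j * n + r \<in> perm_cells k"
  then obtain r' where "0 \<le> r'" "r' < n" "j * n + r = k * n + r'"
    by (intro that[of "j * n + r - k * n"]) auto
  then show False using row_major_inj[of r r' j k] assms by simp
qed

lemma sorts_perm_agree:
  assumes "sorts n (column j) (perm m j)" "agree_off (tree_cells \<union> perm_cells k) m m'"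
    and "0 \<le> j" "j < n" "j \<noteq> k"
  shows "sorts n (column j) (perm m' j)"
proof -
  have "perm m' j r = perm m j r" if "0 \<le> r" "r < n" for r
    unfolding perm_def
    using agree_offD[OF assms(2)] perm_cells_disjoint[OF that assms(5)]
      row_major_bound[of j r] that assms(3,4) by (auto simp: region_defs)
  then show ?thesis using assms(1) sorts_cong[of n "perm m' j" "perm m j"] by simp
qed

lemma runs_sort_columns:
  assumes env: "static_env V" and mem: "has_matrix m" "tree_empty m"
  shows "runs b sort_columns rCol {perm_base..<tree_base + 2 * n} (nn * (140 * depth + 107) + 5)
    (\<lambda>_ m'. \<forall>k. 0 \<le> k \<and> k < n \<longrightarrow> sorts n (column k) (perm m' k)) V m"
proof -
  define J where "J = (\<lambda>k m'. tree_empty m' \<and>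
    (\<forall>j. 0 \<le> j \<and> j < k \<longrightarrow> sorts n (column j) (perm m' j)))"
  have "runs b sort_columns rCol {perm_base..<tree_base + 2 * n}
      (nn * (140 * depth + 107) + 5) (\<lambda>_. J n) V m"
    unfolding sort_columns_def
  proof (rule runs_for_loop_const[where c = "n * (140 * depth + 80) + 10" and lo = 0])
    fix k V' m'
    assume k: "0 \<le> k" "k < n" "V' rCol = k"
      and frame: "agree_off {rCol..} V V'" "agree_off {perm_base..<tree_base + 2 * n} m m'"
      and inv: "J k m'"
    have column: "at_column k V'"
      using k static_env_agree[OF env frame(1)] by (simp_all add: at_column_def)
    have "has_matrix m'"
      using n_pos by (intro has_matrix_agree[OF mem(1) frame(2)]) (auto simp: region_defs)
    then have sort: "runs b sort_column rRank (tree_cells \<union> perm_cells k)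
        (n * (140 * depth + 80) + 10)
        (\<lambda>_ m'. tree_empty m' \<and> sorts n (column k) (perm m' k)) V' m'"
      using inv column by (intro runs_sort_column) (simp_all add: J_def)
    have "sorts n (column j) (perm m'' j)"
      if "agree_off (tree_cells \<union> perm_cells k) m' m''" "sorts n (column k) (perm m'' k)"
        "0 \<le> j" "j < k + 1" for j m''
      using sorts_perm_agree[OF _ that(1), of j] that inv k by (cases "j = k") (auto simp: J_def)
    moreover have "tree_cells \<union> perm_cells k \<subseteq> {perm_base..<tree_base + 2 * n}"
      using row_major_bound[of k k] k n_le_nn n_pos by (auto simp: region_defs)
    ultimately show "runs b sort_column (Suc rCol) {perm_base..<tree_base + 2 * n}
        (n * (140 * depth + 80) + 10)
        (\<lambda>_. J (k + 1)) V' m'"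
      by (intro runs_mono[OF sort]) (auto simp: J_def)
  next
    show "int (cost (Lit 0)) + 4 + (n - 0) * (n * (140 * depth + 80) + 10 + 7) \<le>
        nn * (140 * depth + 107) + 5"
    proof -
      have "n * (n * (140 * depth + 80) + 17) = nn * (140 * depth + 80) + 17 * n"
        by (simp add: nn_def algebra_simps)
      then show ?thesis using n_le_nn n_pos by (simp add: algebra_simps)
    qed
  qed (use env mem n_pos n_less_word b_pos in \<open>auto simp: J_def static_env_def\<close>)
  then show ?thesis by (rule runs_mono) (simp_all add: J_def)
qed

end


section \<open>One level of buckets\<close>

definition perm_entry :: "exp \<Rightarrow> exp" where
  "perm_entry e = Deref (perm_cell e)"

definition query_entry :: exp where
  "query_entry = Deref (Var rSquare +\<^sub>e Var rCol)"

definition set_end :: com where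
  "set_end = rEnd ::= Var rStart +\<^sub>e Var rSize ;;
    WHEN Var rDim <\<^sub>e Var rEnd DO rEnd ::= Var rDim +\<^sub>e Lit 0"

definition mark_row :: com where
  "mark_row = store (Var rAnswer +\<^sub>e Var rRow) (Lit 1)"

definition scan :: com where
  "scan = FOR rRank FROM Var rStart +\<^sub>e Lit 0 BELOW rEnd DO
    (rRow ::= perm_entry (Var rRank) ;;
     WHEN matrix_entry (Var rRow) =\<^sub>e Var rQuery DO mark_row)"

definition straddling :: exp where
  "straddling = (Var rFirst <\<^sub>e Var rLast) *\<^sub>e
    ((Lit 1 -\<^sub>e (Var rQuery <\<^sub>e Var rFirst)) *\<^sub>e (Lit 1 -\<^sub>e (Var rLast <\<^sub>e Var rQuery)))"

definition scan_straddling :: com where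
  "scan_straddling = WHEN straddling DO scan"

definition feed_bucket :: "nat \<Rightarrow> com" where
  "feed_bucket K =
    rFirst ::= matrix_entry (perm_entry (Var rStart)) ;;
    rLast ::= matrix_entry (perm_entry (Var rEnd -\<^sub>e Lit 1)) ;;
    rQuery ::= query_entry ;;
    store (mem_cell K (Var rSquare +\<^sub>e Var rCol))
      ((Var rFirst =\<^sub>e Var rLast) *\<^sub>e (Var rFirst =\<^sub>e Var rQuery)) ;;
    scan_straddling"

definition feed :: "nat \<Rightarrow> com" where
  "feed K = FOR rCol FROM Lit 0 BELOW rDim DO feed_bucket K"

definition collect :: "nat \<Rightarrow> com" where
  "collect K = FOR rRow FROM Lit 0 BELOW rDim DO
    WHEN Deref (mem_cell K (Var rAnswer +\<^sub>e Var rRow)) DO mark_row"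

definition ask :: "nat \<Rightarrow> com \<Rightarrow> com" where
  "ask K p = sim K p ;; collect K"

text \<open>
  Charging \<open>n\<close> steps for a query, on top of the simulated ones, pays for feeding it to the machine
  and for collecting the answer.
\<close>

definition query_level :: "nat \<Rightarrow> com \<Rightarrow> com" where
  "query_level K p =
    set_end ;; feed K ;; ask K p ;; rSteps ::= Var rSteps +\<^sub>e Var rDim"

definition load_cell :: "nat \<Rightarrow> com" where
  "load_cell K = store (mem_cell K (perm_entry (Var rRank) *\<^sub>e Var rDim +\<^sub>e Var rCol)) (Lit 1)"

definition load_column :: "nat \<Rightarrow> com" where
  "load_column K = FOR rRank FROM Var rStart +\<^sub>e Lit 0 BELOW rEnd DO load_cell K"

definition load_columns :: "nat \<Rightarrow> com" where
  "load_columns K = FOR rCol FROM Lit 0 BELOW rDim DO load_column K"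

definition load_level :: "nat \<Rightarrow> com" where
  "load_level K = set_end ;; load_columns K ;; store (reg_cell 0) (Var rDim)"

lemma cost_perm_entry [simp]: "cost (perm_entry e) = cost e + 7"
  by (simp add: perm_entry_def)

lemma cost_query_entry [simp]: "cost query_entry = 4"
  by (simp add: query_entry_def)

lemma entries_neq_Var [simp]: "matrix_entry e \<noteq> Var x" "perm_entry e \<noteq> Var x" "query_entry \<noteq> Var x"
  by (simp_all add: matrix_entry_def perm_entry_def query_entry_def)

locale layout_lanes = layout n S b M + lanes K b0 b S
  for n S b M K b0 +
  assumes K_pos: "1 \<le> K" and layout_fits: "nn + 2 * n \<le> 2 ^ b0"

locale buckets = layout_lanes n S b M K b0
  for n S b M K b0 +
  fixes \<sigma> :: "int \<Rightarrow> int \<Rightarrow> int"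
  assumes perm_sorts: "\<And>k. 0 \<le> k \<Longrightarrow> k < n \<Longrightarrow> sorts n (column k) (\<sigma> k)"
begin

abbreviation N :: nat where "N \<equiv> nat n"

abbreviation answer_cells :: "int set" where "answer_cells \<equiv> {answer_base..<answer_base + n}"

definition answer :: "imem \<Rightarrow> int \<Rightarrow> int" where
  "answer m i = m (answer_base + i)"

definition has_query :: "(int \<Rightarrow> int) \<Rightarrow> imem \<Rightarrow> bool" where
  "has_query q m \<longleftrightarrow> (\<forall>k. 0 \<le> k \<and> k < n \<longrightarrow> m (nn + k) = q k)"

definition static_mem :: "imem \<Rightarrow> bool" where
  "static_mem m \<longleftrightarrow> has_matrix m \<and>
    (\<forall>k r. 0 \<le> k \<and> k < n \<and> 0 \<le> r \<and> r < n \<longrightarrow> perm m k r = \<sigma> k r)"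

definition marked :: "(int \<Rightarrow> bool) \<Rightarrow> imem \<Rightarrow> imem \<Rightarrow> bool" where
  "marked H m m' \<longleftrightarrow> (\<forall>i. 0 \<le> i \<and> i < n \<longrightarrow> answer m' i = (if H i then 1 else answer m i))"

lemma tree_base_less_S: "tree_base + 2 * n < S"
  using S_ge n_le_nn n_pos unfolding nn_def[symmetric] by (simp add: region_defs)

lemma perm_range: "0 \<le> k \<Longrightarrow> k < n \<Longrightarrow> 0 \<le> r \<Longrightarrow> r < n \<Longrightarrow> 0 \<le> \<sigma> k r \<and> \<sigma> k r < n"
  using perm_sorts[of k] by (auto simp: sorts_def dest: bij_betwE)

lemma perm_mono:
  assumes "0 \<le> k" "k < n" "0 \<le> r" "r \<le> r'" "r' < n"
  shows "M (\<sigma> k r) k \<le> M (\<sigma> k r') k"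
  using perm_sorts[OF assms(1,2)] assms(3-) by (auto simp: sorts_def mono_on_def)

lemma lane_cells_ge_S: "0 \<le> l \<Longrightarrow> lane_cells S l \<subseteq> {S..}"
  by (rule lane_cells_ge[OF S_pos])

lemma cell_ge_S: "0 \<le> v \<Longrightarrow> 0 \<le> l \<Longrightarrow> S \<le> cell S l v"
  by (rule cell_ge[OF _ S_pos])

lemma answer_cells_below_S: "x \<in> answer_cells \<Longrightarrow> x < S"
  using tree_base_less_S n_le_nn n_pos by (auto simp: region_defs)

lemma static_mem_cong:
  assumes "static_mem m" "\<And>x. 0 \<le> x \<Longrightarrow> x < nn \<or> perm_base \<le> x \<and> x < tree_base \<Longrightarrow> m' x = m x"
  shows "static_mem m'"
proof -
  have "m' (i * n + k) = m (i * n + k)" if "0 \<le> i" "i < n" "0 \<le> k" "k < n" for i k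
    using row_major_bound[OF that(1-3)] that by (intro assms(2)) auto
  moreover have "perm m' k r = perm m k r" if "0 \<le> k" "k < n" "0 \<le> r" "r < n" for k r
  proof -
    have "perm_base \<le> perm_base + k * n + r" "perm_base + k * n + r < tree_base" "0 \<le> perm_base"
      using row_major_bound[OF that(1-3)] that n_pos n_le_nn by (simp_all add: region_defs)
    then show ?thesis unfolding perm_def by (intro assms(2)) auto
  qed
  ultimately show ?thesis using assms(1) by (simp add: static_mem_def has_matrix_def)
qed

lemma static_mem_agree:
  assumes "static_mem m" "agree_off F m m'" "F \<subseteq> answer_cells \<union> {S..}"
  shows "static_mem m'"
proof (rule static_mem_cong[OF assms(1)])
  fix x assume "0 \<le> x" "x < nn \<or> perm_base \<le> x \<and> x < tree_base"
  then have "x \<notin> F" using assms(3) tree_base_less_S n_pos n_le_nn by (auto simp: region_defs)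
  then show "m' x = m x" by (rule agree_offD[OF assms(2)])
qed

lemma query_agree:
  assumes "agree_off F m m'" "F \<subseteq> answer_cells \<union> {S..}" "0 \<le> k" "k < n"
  shows "m' (nn + k) = m (nn + k)"
  using assms tree_base_less_S n_le_nn by (intro agree_offD[OF assms(1)]) (auto simp: region_defs)

lemma has_query_agree:
  "has_query q m \<Longrightarrow> agree_off F m m' \<Longrightarrow> F \<subseteq> answer_cells \<union> {S..} \<Longrightarrow> has_query q m'"
  using query_agree[of F m m'] by (simp add: has_query_def)

lemma answer_upd [simp]: "answer (m(answer_base + i := y)) = (answer m)(i := y)"
  by (auto simp: answer_def)

lemma answer_agree:
  assumes "agree_off F m m'" "F \<subseteq> {S..}" "i < n"
  shows "answer m' i = answer m i"
  unfolding answer_def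
  using assms tree_base_less_S n_le_nn n_pos
  by (intro agree_offD[OF assms(1)]) (auto simp: region_defs)

lemma marked_agree: "agree_off F m m' \<Longrightarrow> F \<subseteq> {S..} \<Longrightarrow> marked (\<lambda>_. False) m m'"
  using answer_agree by (simp add: marked_def)

lemma marked_refl: "marked (\<lambda>_. False) m m"
  by (simp add: marked_def)

lemma marked_trans: "marked H m m1 \<Longrightarrow> marked H' m1 m2 \<Longrightarrow> marked (\<lambda>i. H i \<or> H' i) m m2"
  by (simp add: marked_def)

lemma marked_upd: "marked H m m' \<Longrightarrow> marked (\<lambda>j. H j \<or> j = i) m (m'(answer_base + i := 1))"
  by (simp add: marked_def)

lemma marked_cong:
  "marked H m m' \<Longrightarrow> (\<And>i. 0 \<le> i \<Longrightarrow> i < n \<Longrightarrow> H i \<longleftrightarrow> H' i) \<Longrightarrow> marked H' m m'"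
  by (simp add: marked_def)

lemma safe_perm_entry:
  assumes "at_column k V" "static_mem m" "safe b e V m" "val e V m = r" "0 \<le> r" "r < n"
  shows "safe b (perm_entry e) V m" "val (perm_entry e) V m = \<sigma> k r"
proof -
  have k: "0 \<le> k" "k < n" using assms(1) by (simp_all add: at_column_def)
  then have "m (perm_base + k * n + r) = \<sigma> k r" "0 \<le> perm_base + k * n + r"
    using assms(2,5,6) row_major_bound[of k r] n_pos n_le_nn
    by (auto simp: static_mem_def perm_def region_defs)
  with safe_perm_cell[OF assms(1,3-6)]
  show "safe b (perm_entry e) V m" "val (perm_entry e) V m = \<sigma> k r"
    by (simp_all add: perm_entry_def)
qed

lemma safe_matrix_entry_perm:
  assumes "at_column k V" "static_mem m" "safe b e V m" "val e V m = r" "0 \<le> r" "r < n"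
  shows "safe b (matrix_entry (perm_entry e)) V m"
    and "val (matrix_entry (perm_entry e)) V m = M (\<sigma> k r) k"
proof -
  have "has_matrix m" "0 \<le> \<sigma> k r" "\<sigma> k r < n"
    using assms(1,2,5,6) perm_range[of k r] by (auto simp: static_mem_def at_column_def)
  then show "safe b (matrix_entry (perm_entry e)) V m"
    "val (matrix_entry (perm_entry e)) V m = M (\<sigma> k r) k"
    using safe_matrix_entry[OF assms(1) _ safe_perm_entry[OF assms]] by simp_all
qed

lemma safe_query_entry:
  assumes "at_column k V" "has_query q m"
  shows "safe b query_entry V m" "val query_entry V m = q k"
proof -
  have k: "V rSquare = nn" "V rCol = k" "0 \<le> k" "k < n"
    using assms(1) by (simp_all add: at_column_def static_env_def)
  then have "nn + k \<in> words b" using n_pos n_le_nn by (intro small_word) auto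
  then show "safe b query_entry V m" "val query_entry V m = q k"
    using k assms(2) n_le_nn by (simp_all add: query_entry_def has_query_def)
qed

lemma safe_mem_cell_lane:
  assumes "safe b e V m" "val e V m = a" "0 \<le> a" "a < perm_base" "static_env V"
    "V rLane = l" "0 \<le> l" "l < S"
  shows "safe b (mem_cell K e) V m" "val (mem_cell K e) V m = cell S l (int K + a)"
  using safe_mem_cell[of e V m a l] assms layout_fits
  by (simp_all add: static_env_def perm_base_def)

lemma runs_mark_row:
  assumes "static_env V" "V rRow = i" "0 \<le> i" "i < n" "5 \<le> T" "Q V (m(answer_base + i := 1))"
  shows "runs b mark_row r answer_cells T Q V m"
proof -
  have "answer_base + i \<in> words b" "0 \<le> answer_base + i"
    using assms(3,4) n_pos n_le_nn by (auto simp: region_defs intro!: small_word)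
  then show ?thesis unfolding mark_row_def
    by (intro runs_store) (use assms in \<open>simp_all add: static_env_def\<close>)
qed

lemma runs_set_end:
  assumes "static_env V" "V rStart = a" "V rSize = g" "0 \<le> a" "a < n" "0 \<le> g" "n + g \<le> S"
  shows "runs b set_end rEnd {} 10 (\<lambda>V' m'. V' = V(rEnd := min (a + g) n) \<and> m' = m) V m"
proof -
  have "V rDim = n" using assms(1) by (simp add: static_env_def)
  moreover have "a + g \<in> words b" "n \<in> words b"
    using assms S_fits n_less_word n_pos by (auto intro!: nonneg_in_words)
  ultimately show ?thesis
    unfolding set_end_def using assms
    by (intro runs_assign_Seq runs_cond runs_assign runs_Skip)
      (auto simp: min_def split: if_splits)
qed

definition hit :: "(int \<Rightarrow> int) \<Rightarrow> int \<Rightarrow> int \<Rightarrow> int \<Rightarrow> int \<Rightarrow> bool" where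
  "hit q a e k i \<longleftrightarrow> (\<exists>r. a \<le> r \<and> r < e \<and> \<sigma> k r = i \<and> M i k = q k)"

lemma hit_empty: "\<not> hit q a a k i"
  by (auto simp: hit_def)

lemma hit_Suc:
  "a \<le> r \<Longrightarrow> hit q a (r + 1) k i \<longleftrightarrow> hit q a r k i \<or> (i = \<sigma> k r \<and> M i k = q k)"
  by (auto simp: hit_def less_le)

lemma hit_join:
  assumes "a \<le> c" "c \<le> e"
  shows "hit q a c k i \<or> hit q c e k i \<longleftrightarrow> hit q a e k i"
proof -
  have "a \<le> r \<and> r < e \<longleftrightarrow> (a \<le> r \<and> r < c) \<or> (c \<le> r \<and> r < e)" for r
    using assms by auto
  then show ?thesis unfolding hit_def by blast
qed

lemma hit_all:
  assumes "0 \<le> k" "k < n" "0 \<le> i" "i < n"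
  shows "hit q 0 n k i \<longleftrightarrow> M i k = q k"
proof -
  have "i \<in> \<sigma> k ` {0..<n}"
    using perm_sorts[OF assms(1,2)] assms(3,4) by (simp add: sorts_def bij_betw_def)
  then show ?thesis by (auto simp: hit_def)
qed

lemma runs_scan:
  assumes column: "at_column k V" and "V rStart = a" "V rEnd = e" "V rQuery = q k"
    and range: "0 \<le> a" "a \<le> e" "e \<le> n" and mem: "static_mem m"
  shows "runs b scan rRank answer_cells (40 * (e - a) + 10) (\<lambda>_. marked (hit q a e k) m) V m"
  unfolding scan_def
proof (rule runs_for_loop_const[where c = 33 and lo = a and J = "\<lambda>r. marked (hit q a r k) m"])
  have "a \<in> words b" using range n_pos n_le_nn by (intro small_word) auto
  then show "safe b (Var rStart +\<^sub>e Lit 0) V m" using assms(2) by simp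
  show "marked (hit q a a k) m m" using marked_refl hit_empty by (simp add: marked_def)
  fix r V' m'
  assume r: "a \<le> r" "r < e" "V' rRank = r"
    and frame: "agree_off {rRank..} V V'" "agree_off answer_cells m m'"
    and inv: "marked (hit q a r k) m m'"
  define i where "i = \<sigma> k r"
  have i: "0 \<le> i" "i < n"
    using perm_range[of k r] r range column by (auto simp: i_def at_column_def)
  have mem': "static_mem m'" by (rule static_mem_agree[OF mem frame(2)]) simp
  have column': "at_column k V'" by (rule at_column_agree[OF column frame(1)]) simp
  have "V' rQuery = q k" using agree_offD[OF frame(1), of rQuery] assms(4) by simp
  moreover have "safe b (perm_entry (Var rRank)) V' m'" "val (perm_entry (Var rRank)) V' m' = i"
    using safe_perm_entry[OF column' mem', of "Var rRank" r] r range by (simp_all add: i_def)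
  moreover have "safe b (matrix_entry (Var rRow)) (V'(rRow := i)) m'"
    "val (matrix_entry (Var rRow)) (V'(rRow := i)) m' = M i k"
    using safe_matrix_entry[of k "V'(rRow := i)" m' "Var rRow" i] column' mem' i
    by (simp_all add: static_mem_def)
  moreover have "marked (hit q a (r + 1) k) m (m'(answer_base + i := 1))" if "M i k = q k"
    using marked_upd[OF inv, of i] that r
    by (elim marked_cong) (auto simp: hit_Suc i_def)
  moreover have "marked (hit q a (r + 1) k) m m'" if "M i k \<noteq> q k"
    using inv that r by (elim marked_cong) (auto simp: hit_Suc i_def)
  ultimately show "runs b (rRow ::= perm_entry (Var rRank) ;;
      WHEN matrix_entry (Var rRow) =\<^sub>e Var rQuery DO mark_row) (Suc rRank) answer_cells 33
      (\<lambda>_. marked (hit q a (r + 1) k) m) V' m'"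
    using column' i
    by (intro runs_assign_Seq runs_cond runs_mark_row[where i = i] runs_Skip)
      (simp_all add: at_column_def)
qed (use assms n_less_word b_pos in auto)

definition uniform :: "int \<Rightarrow> int \<Rightarrow> int \<Rightarrow> bool" where
  "uniform a e k \<longleftrightarrow> M (\<sigma> k a) k = M (\<sigma> k (e - 1)) k"

definition query_bit :: "(int \<Rightarrow> int) \<Rightarrow> int \<Rightarrow> int \<Rightarrow> int \<Rightarrow> int" where
  "query_bit q a e k = of_bool (uniform a e k \<and> M (\<sigma> k a) k = q k)"

definition straddles :: "(int \<Rightarrow> int) \<Rightarrow> int \<Rightarrow> int \<Rightarrow> int \<Rightarrow> bool" where
  "straddles q a e k \<longleftrightarrow>
    \<not> uniform a e k \<and> M (\<sigma> k a) k \<le> q k \<and> q k \<le> M (\<sigma> k (e - 1)) k"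

definition straddle_count :: "(int \<Rightarrow> int) \<Rightarrow> int \<Rightarrow> int \<Rightarrow> int" where
  "straddle_count q a e = (\<Sum>k \<in> {0..<n}. of_bool (straddles q a e k))"

lemma hit_cases:
  assumes "0 \<le> k" "k < n" "0 \<le> a" "e \<le> n"
  shows "hit q a e k i \<longleftrightarrow> query_bit q a e k = 1 \<and> i \<in> \<sigma> k ` {a..<e} \<or> straddles q a e k \<and>
      hit q a e k i"
proof -
  have bounds: "M (\<sigma> k a) k \<le> M (\<sigma> k r) k \<and> M (\<sigma> k r) k \<le> M (\<sigma> k (e - 1)) k"
    if "r \<in> {a..<e}" for r
    using perm_mono[of k a r] perm_mono[of k r "e - 1"] that assms by auto
  have hit: "hit q a e k i \<longleftrightarrow> (\<exists>r \<in> {a..<e}. i = \<sigma> k r \<and> M (\<sigma> k r) k = q k)"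
    by (auto simp: hit_def)
  show ?thesis
  proof (cases "uniform a e k")
    case True
    then have "M (\<sigma> k r) k = M (\<sigma> k a) k" if "r \<in> {a..<e}" for r
      using bounds[OF that] by (simp add: uniform_def)
    then have "hit q a e k i \<longleftrightarrow> M (\<sigma> k a) k = q k \<and> i \<in> \<sigma> k ` {a..<e}"
      unfolding hit image_iff by metis
    with True show ?thesis by (simp add: query_bit_def straddles_def)
  next
    case False
    have "straddles q a e k" if "hit q a e k i"
      using that False bounds unfolding hit straddles_def by metis
    with False show ?thesis by (auto simp: query_bit_def)
  qed
qed

lemma runs_scan_straddling:
  assumes "at_column k V" "V rStart = a" "V rEnd = e" "V rQuery = q k"
    and ends: "V rFirst = M (\<sigma> k a) k" "V rLast = M (\<sigma> k (e - 1)) k"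
    and range: "0 \<le> a" "a < e" "e \<le> n" and "static_mem m"
    and T: "20 + of_bool (straddles q a e k) * (40 * (e - a) + 10) \<le> T"
  shows "runs b scan_straddling rRank answer_cells T
    (\<lambda>_. marked (\<lambda>i. straddles q a e k \<and> hit q a e k i) m) V m"
  unfolding scan_straddling_def
proof (rule runs_cond)
  have k: "0 \<le> k" "k < n" using assms(1) by (simp_all add: at_column_def)
  have "M (\<sigma> k a) k \<le> M (\<sigma> k (e - 1)) k" using perm_mono[of k a "e - 1"] k range by simp
  then have guard: "val straddling V m = of_bool (straddles q a e k)"
    using ends assms(4) by (auto simp: straddling_def straddles_def uniform_def)
  show "safe b straddling V m"
    by (auto simp: straddling_def of_bool_def)
  have cost: "cost straddling = 15" by (simp add: straddling_def)
  show "runs b scan rRank answer_cells (T - int (cost straddling) - 1)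
      (\<lambda>_. marked (\<lambda>i. straddles q a e k \<and> hit q a e k i) m) V m" if "val straddling V m \<noteq> 0"
  proof -
    have "straddles q a e k" using that unfolding guard by (simp split: if_splits)
    then show ?thesis using assms cost
      by (intro runs_mono[OF runs_scan[where k = k and a = a and e = e and q = q]]) auto
  qed
  show "runs b Skip rRank answer_cells (T - int (cost straddling) - 1)
      (\<lambda>_. marked (\<lambda>i. straddles q a e k \<and> hit q a e k i) m) V m" if "val straddling V m = 0"
    using that T cost unfolding guard by (intro runs_Skip) (auto simp: marked_refl split: if_splits)
qed

lemma runs_scan_straddling_upd:
  assumes column: "at_column k V" and env: "V rStart = a" "V rEnd = e" "V rQuery = q k"
    "V rFirst = M (\<sigma> k a) k" "V rLast = M (\<sigma> k (e - 1)) k"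
    and range: "0 \<le> a" "a < e" "e \<le> n" "e \<le> a + g" and mem: "static_mem m" "S \<le> x"
    and T: "30 + 50 * g * of_bool (straddles q a e k) \<le> T"
  shows "runs b scan_straddling rFirst (insert x answer_cells) T
    (\<lambda>_ m'. m' x = y \<and> marked (\<lambda>i. straddles q a e k \<and> hit q a e k i) m m') V (m(x := y))"
proof (rule runs_mono[OF runs_scan_straddling[of k V a e q, OF column env range(1-3)]])
  show "static_mem (m(x := y))" using mem(2) by (intro static_mem_agree[OF mem(1), of "{x}"]) auto
  show "20 + of_bool (straddles q a e k) * (40 * (e - a) + 10) \<le> T"
    using T range by (cases "straddles q a e k") simp_all
  fix m' assume frame: "agree_off answer_cells (m(x := y)) m'"
    and marks: "marked (\<lambda>i. straddles q a e k \<and> hit q a e k i) (m(x := y)) m'"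
  have "x \<notin> answer_cells" using mem(2) tree_base_less_S n_le_nn n_pos by (auto simp: region_defs)
  then have "m' x = y" using agree_offD[OF frame, of x] by simp
  moreover have "marked (\<lambda>_. False) m (m(x := y))" using mem(2)
    by (intro marked_agree[of "{x}"]) auto
  ultimately show "m' x = y \<and> marked (\<lambda>i. straddles q a e k \<and> hit q a e k i) m m'"
    using marked_trans[OF _ marks, of "\<lambda>_. False"] by simp
qed auto

lemma runs_feed_bucket:
  assumes column: "at_column k V" and env: "V rStart = a" "V rEnd = e" "V rLane = l"
    and range: "0 \<le> a" "a < e" "e \<le> n" "e \<le> a + g" "0 \<le> l" "l < S"
    and mem: "static_mem m" "has_query q m"
  shows "runs b (feed_bucket K) rFirst (insert (cell S l (int K + (nn + k))) answer_cells)
    (90 + 50 * g * of_bool (straddles q a e k))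
    (\<lambda>_ m'. m' (cell S l (int K + (nn + k))) = query_bit q a e k \<and>
      marked (\<lambda>i. straddles q a e k \<and> hit q a e k i) m m') V m"
proof -
  let ?x = "cell S l (int K + (nn + k))"
  let ?first = "M (\<sigma> k a) k" and ?last = "M (\<sigma> k (e - 1)) k"
  let ?V = "V(rFirst := ?first, rLast := ?last, rQuery := q k)"
  have k: "V rSquare = nn" "V rCol = k" "0 \<le> k" "k < n" "static_env V"
    using column by (simp_all add: at_column_def static_env_def)
  have words: "e - 1 \<in> words b" "nn + k \<in> words b"
    using range k n_pos n_le_nn by (auto intro!: small_word)
  have x: "S \<le> ?x" using range k n_le_nn by (intro cell_ge_S) auto
  have reads: "safe b (matrix_entry (perm_entry (Var rStart))) V m"
    "val (matrix_entry (perm_entry (Var rStart))) V m = ?first"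
    "safe b (matrix_entry (perm_entry (Var rEnd -\<^sub>e Lit 1))) (V(rFirst := ?first)) m"
    "val (matrix_entry (perm_entry (Var rEnd -\<^sub>e Lit 1))) (V(rFirst := ?first)) m = ?last"
    "safe b query_entry (V(rFirst := ?first, rLast := ?last)) m"
    "val query_entry (V(rFirst := ?first, rLast := ?last)) m = q k"
    using safe_matrix_entry_perm[OF column mem(1), of "Var rStart" a]
      safe_matrix_entry_perm[of k "V(rFirst := ?first)" m "Var rEnd -\<^sub>e Lit 1" "e - 1"]
      safe_query_entry[of k "V(rFirst := ?first, rLast := ?last)" q m] column env range mem words
    by simp_all
  have bit_cell: "safe b (mem_cell K (Var rSquare +\<^sub>e Var rCol)) ?V m"
    "val (mem_cell K (Var rSquare +\<^sub>e Var rCol)) ?V m = ?x"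
    using safe_mem_cell_lane[of "Var rSquare +\<^sub>e Var rCol" ?V m "nn + k" l]
      k env range words n_le_nn
    by (simp_all add: perm_base_def)
  have "of_bool (?first = ?last) * of_bool (?first = q k) = query_bit q a e k"
    by (simp add: query_bit_def uniform_def)
  moreover have "query_bit q a e k \<in> words b" by (simp add: query_bit_def)
  ultimately show ?thesis unfolding feed_bucket_def
    by (intro runs_assign_Seq runs_store_Seq)
      (use reads bit_cell words x S_pos column env range mem
        runs_scan_straddling_upd[of k ?V a e q g] in simp_all)
qed

definition query_cells :: "int \<Rightarrow> int set" where
  "query_cells l = (\<lambda>k. cell S l (int K + (nn + k))) ` {0..<n}"

lemma query_cells_subset: "query_cells l \<subseteq> lane_cells S l"
  using n_le_nn n_pos by (auto simp: query_cells_def intro!: cell_in_lane_cells)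

definition fed :: "(int \<Rightarrow> int) \<Rightarrow> int \<Rightarrow> int \<Rightarrow> int \<Rightarrow> int \<Rightarrow> imem \<Rightarrow> imem \<Rightarrow> bool" where
  "fed q a e l k m m' \<longleftrightarrow>
    (\<forall>j. 0 \<le> j \<and> j < k \<longrightarrow> m' (cell S l (int K + (nn + j))) = query_bit q a e j) \<and>
    marked (\<lambda>i. \<exists>j. 0 \<le> j \<and> j < k \<and> straddles q a e j \<and> hit q a e j i) m m'"

lemma fed_Suc:
  assumes "fed q a e l k m m'" "0 \<le> k" "0 \<le> l" "l < S"
    and frame: "agree_off (insert (cell S l (int K + (nn + k))) answer_cells) m' m''"
    and bit: "m'' (cell S l (int K + (nn + k))) = query_bit q a e k"
    and marks: "marked (\<lambda>i. straddles q a e k \<and> hit q a e k i) m' m''"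
  shows "fed q a e l (k + 1) m m''"
  unfolding fed_def
proof (intro conjI allI impI)
  fix j assume j: "0 \<le> j \<and> j < k + 1"
  then have "S \<le> cell S l (int K + (nn + j))" using assms(3) n_le_nn n_pos by (intro cell_ge_S) auto
  then have "cell S l (int K + (nn + j)) \<notin> answer_cells" using answer_cells_below_S by fastforce
  then show "m'' (cell S l (int K + (nn + j))) = query_bit q a e j"
    using assms(1,3,4) frame bit j by (cases "j = k") (auto simp: fed_def cell_eq_iff agree_off_def)
next
  have "marked (\<lambda>i. (\<exists>j. 0 \<le> j \<and> j < k \<and> straddles q a e j \<and> hit q a e j i) \<or>
      straddles q a e k \<and> hit q a e k i) m m''"
    using assms(1) marks by (auto simp: fed_def intro: marked_trans)
  then show "marked (\<lambda>i. \<exists>j. 0 \<le> j \<and> j < k + 1 \<and> straddles q a e j \<and> hit q a e j i) m m''"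
    using assms(2) by (elim marked_cong) (auto simp: less_le)
qed

lemma runs_feed:
  assumes env: "static_env V" "V rStart = a" "V rEnd = e" "V rLane = l"
    and range: "0 \<le> a" "a < e" "e \<le> n" "e \<le> a + g" "0 \<le> l" "l < S"
    and mem: "static_mem m" "has_query q m"
  shows "runs b (feed K) rCol (answer_cells \<union> query_cells l)
    (97 * n + 5 + 50 * g * straddle_count q a e) (\<lambda>_. fed q a e l n m) V m"
  unfolding feed_def
proof (rule runs_for_loop[where lo = 0 and J = "\<lambda>k. fed q a e l k m" and
      c = "\<lambda>k. 90 + 50 * g * of_bool (straddles q a e k)"])
  fix k V' m'
  assume k: "0 \<le> k" "k < n" "V' rCol = k"
    and frame: "agree_off {rCol..} V V'" "agree_off (answer_cells \<union> query_cells l) m m'"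
    and inv: "fed q a e l k m m'"
  have cells: "answer_cells \<union> query_cells l \<subseteq> answer_cells \<union> {S..}"
    using query_cells_subset lane_cells_ge_S[OF range(5)] by auto
  have bucket: "runs b (feed_bucket K) rFirst (insert (cell S l (int K + (nn + k))) answer_cells)
      (90 + 50 * g * of_bool (straddles q a e k))
      (\<lambda>_ m''. m'' (cell S l (int K + (nn + k))) = query_bit q a e k \<and>
        marked (\<lambda>i. straddles q a e k \<and> hit q a e k i) m' m'') V' m'"
    using k env range static_env_agree[OF env(1) frame(1)] agree_offD[OF frame(1)]
      static_mem_agree[OF mem(1) frame(2) cells] has_query_agree[OF mem(2) frame(2) cells]
    by (intro runs_feed_bucket) (simp_all add: at_column_def)
  show "runs b (feed_bucket K) (Suc rCol) (answer_cells \<union> query_cells l)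
      (90 + 50 * g * of_bool (straddles q a e k)) (\<lambda>_. fed q a e l (k + 1) m) V' m'"
    using k fed_Suc[OF inv k(1) range(5,6)]
    by (intro runs_mono[OF bucket]) (auto simp: query_cells_def)
next
  show "fed q a e l 0 m m" by (auto simp: fed_def marked_def)
  show "int (cost (Lit 0)) + 4 + (\<Sum>k \<in> {0..<n}. 90 + 50 * g * of_bool (straddles q a e k) + 7) \<le>
      97 * n + 5 + 50 * g * straddle_count q a e"
    using n_pos by (simp add: straddle_count_def sum.distrib sum_distrib_left del: sum_of_bool_eq)
qed (use env n_pos n_less_word b_pos in \<open>simp_all add: static_env_def\<close>)

lemma runs_collect:
  assumes env: "static_env V" "V rLane = l" and l: "0 \<le> l" "l < S" and machine: "machine_at l m s"
  shows "runs b (collect K) rRow answer_cells (40 * n + 5)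
    (\<lambda>_. marked (\<lambda>i. snd s (nat (answer_base + i)) \<noteq> 0) m) V m"
proof -
  define J where "J = (\<lambda>j. marked (\<lambda>i. i < j \<and> snd s (nat (answer_base + i)) \<noteq> 0) m)"
  have "runs b (collect K) rRow answer_cells (40 * n + 5) (\<lambda>_. J n) V m"
    unfolding collect_def
  proof (rule runs_for_loop_const[where lo = 0 and c = 32])
    fix i V' m'
    assume i: "0 \<le> i" "i < n" "V' rRow = i"
      and frame: "agree_off {rRow..} V V'" "agree_off answer_cells m m'" and inv: "J i m'"
    have env': "static_env V'" "V' rLane = l" "V' rAnswer = answer_base"
      using static_env_agree[OF env(1) frame(1)] agree_offD[OF frame(1), of rLane] env(2)
      by (simp_all add: static_env_def)
    let ?c = "cell S l (int K + (answer_base + i))"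
    have address: "0 \<le> answer_base + i" "answer_base + i \<in> words b" "answer_base + i < perm_base"
      using i n_pos n_le_nn by (auto simp: region_defs intro!: small_word)
    have c: "S \<le> ?c" using address l by (intro cell_ge_S) auto
    then have "?c \<notin> answer_cells" using tree_base_less_S n_le_nn n_pos by (auto simp: region_defs)
    then have "m' ?c = m ?c" by (rule agree_offD[OF frame(2)])
    also have "\<dots> = snd s (nat (answer_base + i))"
      using machine[unfolded machine_at_def, THEN conjunct2, rule_format,
          of "nat (answer_base + i)"] address by simp
    finally have "m' ?c = snd s (nat (answer_base + i))" .
    moreover have "safe b (mem_cell K (Var rAnswer +\<^sub>e Var rRow)) V' m'"
      "val (mem_cell K (Var rAnswer +\<^sub>e Var rRow)) V' m' = ?c"
      using safe_mem_cell_lane[of "Var rAnswer +\<^sub>e Var rRow" V' m' "answer_base + i" l]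
        env' i address l by simp_all
    moreover have "J (i + 1) (m'(answer_base + i := 1))" if "snd s (nat (answer_base + i)) \<noteq> 0"
      using marked_upd[OF inv[unfolded J_def], of i] that unfolding J_def
      by (elim marked_cong) (auto simp: less_le)
    moreover have "J (i + 1) m'" if "snd s (nat (answer_base + i)) = 0"
      using inv that unfolding J_def by (elim marked_cong) (auto simp: less_le)
    ultimately show "runs b (WHEN Deref (mem_cell K (Var rAnswer +\<^sub>e Var rRow)) DO mark_row)
        (Suc rRow)
        answer_cells 32 (\<lambda>_. J (i + 1)) V' m'"
      by (intro runs_cond runs_mark_row[where i = i] runs_Skip) (use env' i c S_pos in simp_all)
  qed (use env n_pos n_less_word b_pos marked_refl in
      \<open>simp_all add: static_env_def J_def marked_def\<close>)
  then show ?thesis by (rule runs_mono) (auto simp: J_def elim: marked_cong)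
qed

definition bucket_matrix :: "int \<Rightarrow> int \<Rightarrow> int mat" where
  "bucket_matrix a e = mat N N (\<lambda>(i, k). of_bool (int i \<in> \<sigma> (int k) ` {a..<e}))"

definition query_vec :: "(int \<Rightarrow> int) \<Rightarrow> int \<Rightarrow> int \<Rightarrow> int vec" where
  "query_vec q a e = vec N (\<lambda>k. query_bit q a e (int k))"

lemma int_N: "int N = n" "int (N * N) = nn"
  using n_pos by (simp_all add: nn_def)

lemma query_cell_iff: "x \<in> {N * N..<N * N + N} \<longleftrightarrow> nn \<le> int x \<and> int x < nn + n"
proof -
  have "x \<in> {N * N..<N * N + N} \<longleftrightarrow> int (N * N) \<le> int x \<and> int x < int (N * N) + int N"
    by (simp only: atLeastLessThan_iff of_nat_le_iff of_nat_less_iff flip: of_nat_add)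
  then show ?thesis by (simp only: int_N)
qed

lemma bits_b0: "(0::int) \<in> words b0" "(1::int) \<in> words b0" "n \<in> words b0"
  using layout_fits n_le_nn n_pos by (auto intro!: nonneg_in_words)

lemma snd_put_query:
  "snd (put_query N v s) x =
    (if nn \<le> int x \<and> int x < nn + n then v $ nat (int x - nn) else snd s x)"
proof -
  have "x - N * N = nat (int x - nn)" if "nn \<le> int x" "int x < nn + n"
    using that int_N(2) query_cell_iff[of x] by (simp add: nat_diff_distrib nat_mult_distrib nn_def)
  then show ?thesis by (simp add: put_query_def query_cell_iff del: atLeastLessThan_iff)
qed

lemma machine_at_put_query:
  assumes machine: "machine_at l m s" and l: "0 \<le> l" "l < S"
    and frame: "agree_off (answer_cells \<union> query_cells l) m m'"
    and bits: "\<And>k. 0 \<le> k \<Longrightarrow> k < n \<Longrightarrow> m' (cell S l (int K + (nn + k))) = query_bit q a e k"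
  shows "machine_at l m' (put_query N (query_vec q a e) s)"
proof -
  have kept: "m' (cell S l v) = m (cell S l v)"
    if "0 \<le> v" "\<not> (int K + nn \<le> v \<and> v < int K + nn + n)" for v
  proof (rule agree_offD[OF frame])
    have "cell S l v \<notin> answer_cells"
      using cell_ge_S[OF that(1) l(1)] tree_base_less_S n_le_nn n_pos by (auto simp: region_defs)
    moreover have "cell S l v \<notin> query_cells l"
      using that(2) l by (auto simp: query_cells_def cell_eq_iff)
    ultimately show "cell S l v \<notin> answer_cells \<union> query_cells l" by simp
  qed
  let ?s = "put_query N (query_vec q a e) s"
  have "m' (cell S l (int K + int x)) = snd ?s x \<and> snd ?s x \<in> words b0" for x
  proof (cases "nn \<le> int x \<and> int x < nn + n")
    case True
    then show ?thesis using bits[of "int x - nn"] bits_b0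
      by (simp add: snd_put_query query_vec_def query_bit_def)
  next
    case False
    then show ?thesis
      using kept[of "int K + int x"] machine by (auto simp: snd_put_query machine_at_def)
  qed
  moreover have "m' (cell S l (int r)) = fst s r \<and> fst s r \<in> words b0" if "r < K" for r
    using kept[of "int r"] machine that n_le_nn n_pos by (simp add: machine_at_def)
  ultimately show ?thesis by (simp add: machine_at_def put_query_def)
qed

lemma boolean_answer_bucket:
  assumes answer: "read_answer N s' = boolean_answer (bucket_matrix a e) (query_vec q a e)"
    and i: "0 \<le> i" "i < n"
  shows "snd s' (nat (answer_base + i)) \<noteq> 0 \<longleftrightarrow>
    (\<exists>k. 0 \<le> k \<and> k < n \<and> query_bit q a e k = 1 \<and> i \<in> \<sigma> k ` {a..<e})"
proof -
  have N: "nat i < N" "nat (answer_base + i) = N * N + N + nat i"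
    using i n_pos by (simp_all add: region_defs nat_add_distrib nn_def nat_mult_distrib)
  have "snd s' (nat (answer_base + i)) = read_answer N s' $ nat i"
    using N by (simp add: read_answer_def)
  also have "\<dots> = of_bool (\<exists>k < N. query_bit q a e (int k) = 1 \<and> i \<in> \<sigma> (int k) ` {a..<e})"
    unfolding answer boolean_answer_def using N(1) i
    by (auto simp: bucket_matrix_def query_vec_def)
  finally have "snd s' (nat (answer_base + i)) \<noteq> 0 \<longleftrightarrow>
      (\<exists>k < N. query_bit q a e (int k) = 1 \<and> i \<in> \<sigma> (int k) ` {a..<e})" by auto
  also have "\<dots> \<longleftrightarrow> (\<exists>k. 0 \<le> k \<and> k < n \<and> query_bit q a e k = 1 \<and> i \<in> \<sigma> k ` {a..<e})"
    by (metis int_N(1) nat_0_le of_nat_0_le_iff of_nat_less_iff)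
  finally show ?thesis .
qed

lemma other_lane_agree:
  assumes "agree_off (answer_cells \<union> lane_cells S l) m m'"
    and "0 \<le> l" "l < S" "0 \<le> l'" "l' < S" "l' \<noteq> l" "0 \<le> v"
  shows "m' (cell S l' v) = m (cell S l' v)"
proof (rule agree_offD[OF assms(1)])
  have "cell S l' v \<notin> answer_cells"
    using cell_ge_S[OF assms(7,4)] answer_cells_below_S by fastforce
  then show "cell S l' v \<notin> answer_cells \<union> lane_cells S l"
    using cell_notin_lane_cells[OF assms(4,5,2,3,6)] by simp
qed

lemma machine_at_answer_agree:
  assumes "machine_at l m s" "agree_off answer_cells m m'" "0 \<le> l"
  shows "machine_at l m' s"
proof (rule machine_at_cong[OF assms(1)])
  fix v :: int assume "0 \<le> v"
  then have "cell S l v \<notin> answer_cells"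
    using cell_ge_S[OF _ assms(3)] answer_cells_below_S by fastforce
  then show "m' (cell S l v) = m (cell S l v)" by (rule agree_offD[OF assms(2)])
qed

lemma runs_ask:
  assumes env: "static_env V" "can_simulate l u V" and machine: "machine_at l m s"
    and exec: "exec b0 p s u s'" "reg_bound p \<le> K"
  shows "runs b (ask K p) rSteps (answer_cells \<union> lane_cells S l) (40 * n + 5)
    (\<lambda>V' m'. V' rSteps = V rSteps + int u \<and> machine_at l m' s' \<and>
      marked (\<lambda>i. snd s' (nat (answer_base + i)) \<noteq> 0) m m') V m"
  unfolding ask_def
proof (rule runs_Seq[OF simulation_sim[OF exec machine env(2), unfolded simulation_def]])
  have l: "0 \<le> l" "l < S" "V rLane = l" using env(2) by (simp_all add: can_simulate_def)
  fix V1 m1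
  assume frame: "agree_off (lane_cells S l) m m1"
    and post: "V1 = V(rSteps := V rSteps + int u) \<and> machine_at l m1 s'"
  have collect: "runs b (collect K) rRow answer_cells (40 * n + 5)
      (\<lambda>_. marked (\<lambda>i. snd s' (nat (answer_base + i)) \<noteq> 0) m1) V1 m1"
    using post env(1) l by (intro runs_collect) auto
  have "marked (\<lambda>i. snd s' (nat (answer_base + i)) \<noteq> 0) m m2"
    if "marked (\<lambda>i. snd s' (nat (answer_base + i)) \<noteq> 0) m1 m2" for m2
    using marked_trans[OF marked_agree[OF frame lane_cells_ge_S[OF l(1)]] that] by simp
  moreover have "V2 rSteps = V rSteps + int u" if "agree_off {rRow..} V1 V2" for V2
    using agree_offD[OF that, of rSteps] post by simp
  ultimately show "runs b (collect K) rSteps (answer_cells \<union> lane_cells S l) (40 * n + 5 - 0)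
      (\<lambda>V' m'. V' rSteps = V rSteps + int u \<and> machine_at l m' s' \<and>
        marked (\<lambda>i. snd s' (nat (answer_base + i)) \<noteq> 0) m m') V1 m1"
    using post machine_at_answer_agree[of l m1 s', OF _ _ l(1)]
    by (intro runs_mono[OF collect]) auto
qed auto

lemma runs_ask_charge:
  assumes env: "static_env V" "can_simulate l (u + N) V" and machine: "machine_at l m s"
    and exec: "exec b0 p s u s'" "reg_bound p \<le> K"
  shows "runs b (ask K p ;; rSteps ::= Var rSteps +\<^sub>e Var rDim) rSteps
    (answer_cells \<union> lane_cells S l)
    (- 97 * n - 15)
    (\<lambda>V' m'. V' rSteps = V rSteps + int (u + N) \<and> machine_at l m' s' \<and>
      marked (\<lambda>i. snd s' (nat (answer_base + i)) \<noteq> 0) m m') V m"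
proof (rule runs_Seq[OF runs_ask[OF env(1) can_simulate_le[OF env(2)] machine exec]])
  fix V1 m1
  assume frame: "agree_off {rSteps..} V V1"
    and post: "V1 rSteps = V rSteps + int u \<and> machine_at l m1 s' \<and>
      marked (\<lambda>i. snd s' (nat (answer_base + i)) \<noteq> 0) m m1"
  have "V1 rDim = n" using static_env_agree[OF env(1) frame] by (simp add: static_env_def)
  moreover have "V1 rSteps + n \<in> words b"
    using env(2) post n_pos by (intro nonneg_in_words) (auto simp: can_simulate_def)
  ultimately show "runs b (rSteps ::= Var rSteps +\<^sub>e Var rDim) rSteps
      (answer_cells \<union> lane_cells S l)
      (- 97 * n - 15 - (40 * n + 5))
      (\<lambda>V' m'. V' rSteps = V rSteps + int (u + N) \<and> machine_at l m' s' \<and>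
        marked (\<lambda>i. snd s' (nat (answer_base + i)) \<noteq> 0) m m') V1 m1"
    using post n_pos by (intro runs_assign_credit) (auto simp: credit_def)
qed auto

lemma marked_bucket:
  assumes "0 \<le> a" "e \<le> n" and fed: "fed q a e l n m m1"
    and answer: "read_answer N s' = boolean_answer (bucket_matrix a e) (query_vec q a e)"
    and marks: "marked (\<lambda>i. snd s' (nat (answer_base + i)) \<noteq> 0) m1 m2"
  shows "marked (\<lambda>i. \<exists>k. 0 \<le> k \<and> k < n \<and> hit q a e k i) m m2"
proof (rule marked_cong[OF marked_trans[OF conjunct2[OF fed[unfolded fed_def]] marks]])
  fix i assume i: "0 \<le> i" "i < n"
  show "(\<exists>k. 0 \<le> k \<and> k < n \<and> straddles q a e k \<and> hit q a e k i) \<or>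
      snd s' (nat (answer_base + i)) \<noteq> 0 \<longleftrightarrow>
      (\<exists>k. 0 \<le> k \<and> k < n \<and> hit q a e k i)"
    unfolding boolean_answer_bucket[OF answer i] using hit_cases[OF _ _ assms(1,2), of _ q i]
    by metis
qed

lemma runs_query_level:
  assumes env: "static_env V" "V rStart = a" "V rSize = g" and can: "can_simulate l (u + N) V"
    and range: "0 \<le> a" "a < n" "1 \<le> g" "n + g \<le> S" and e: "e = min (a + g) n"
    and mem: "static_mem m" "has_query q m" "machine_at l m s"
    and exec: "exec b0 p (put_query N (query_vec q a e) s) u s'" "reg_bound p \<le> K"
    and answer: "read_answer N s' = boolean_answer (bucket_matrix a e) (query_vec q a e)"
  shows "runs b (query_level K p) rSteps (answer_cells \<union> lane_cells S l)
    (50 * g * straddle_count q a e)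
    (\<lambda>V' m'. V' rSteps = V rSteps + int (u + N) \<and> machine_at l m' s' \<and>
      marked (\<lambda>i. \<exists>k. 0 \<le> k \<and> k < n \<and> hit q a e k i) m m') V m" (is "runs b _ _ ?F ?T ?Q V m")
  unfolding query_level_def
proof (rule runs_Seq[OF runs_set_end[OF env range(1,2)]])
  let ?ask = "ask K p ;; rSteps ::= Var rSteps +\<^sub>e Var rDim"
  have l: "0 \<le> l" "l < S" "V rLane = l" using can by (simp_all add: can_simulate_def)
  have range': "a < e" "e \<le> n" "e \<le> a + g" using range e by auto
  fix V1 m1 assume "V1 = V(rEnd := min (a + g) n) \<and> m1 = m"
  then have V1: "V1 = V(rEnd := min (a + g) n)" "m1 = m" by simp_all
  have feed: "runs b (feed K) rCol (answer_cells \<union> query_cells l)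
      (97 * n + 5 + 50 * g * straddle_count q a e) (\<lambda>_. fed q a e l n m) V1 m"
    using V1 e env l range range' mem by (intro runs_feed) simp_all
  show "runs b (feed K ;; ?ask) rSteps ?F (?T - 10) ?Q V1 m1"
    unfolding V1(2)
  proof (rule runs_Seq[OF feed])
    show "answer_cells \<union> query_cells l \<subseteq> ?F" using query_cells_subset by blast
    fix V2 m2
    assume frame: "agree_off {rCol..} V1 V2" "agree_off (answer_cells \<union> query_cells l) m m2"
      and fed: "fed q a e l n m m2"
    have frame_env: "agree_off {rEnd..} V V2" using frame(1) V1(1) by (auto simp: agree_off_def)
    have V2: "static_env V2" "can_simulate l (u + N) V2" "V2 rSteps = V rSteps"
      using static_env_agree[OF env(1) frame_env] agree_offD[OF frame_env] can
      by (simp_all add: can_simulate_def)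
    have "machine_at l m2 (put_query N (query_vec q a e) s)"
      using machine_at_put_query[OF mem(3) l(1,2) frame(2)] fed by (simp add: fed_def)
    note ask = runs_ask_charge[OF V2(1,2) this exec]
    show "runs b ?ask rSteps ?F (?T - 10 - (97 * n + 5 + 50 * g * straddle_count q a e)) ?Q V2 m2"
      by (rule runs_mono[OF ask])
        (use V2(3) marked_bucket[OF range(1) range'(2) fed answer] in simp_all)
  qed simp
qed (use range in auto)

definition bucket_column :: "int \<Rightarrow> int \<Rightarrow> int \<Rightarrow> int set" where
  "bucket_column a e k = (\<lambda>r. \<sigma> k r * n + k) ` {a..<e}"

definition bucket_columns :: "int \<Rightarrow> int \<Rightarrow> int \<Rightarrow> int set" where
  "bucket_columns a e k = (\<Union>j \<in> {0..<k}. bucket_column a e j)"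

definition loaded :: "int \<Rightarrow> int set \<Rightarrow> imem \<Rightarrow> bool" where
  "loaded l X m \<longleftrightarrow> (\<forall>v\<ge>0. m (cell S l v) = of_bool (v - int K \<in> X))"

lemma bucket_column_empty: "bucket_column a a k = {}"
  by (simp add: bucket_column_def)

lemma bucket_column_Suc:
  assumes "a \<le> r"
  shows "bucket_column a (r + 1) k = insert (\<sigma> k r * n + k) (bucket_column a r k)"
proof -
  have "{a..<r + 1} = insert r {a..<r}" using assms by auto
  then show ?thesis by (simp add: bucket_column_def)
qed

lemma bucket_columns_Suc:
  assumes "0 \<le> k"
  shows "bucket_columns a e (k + 1) = bucket_columns a e k \<union> bucket_column a e k"
proof -
  have "{0..<k + 1} = insert k {0..<k}" using assms by auto
  then show ?thesis by (auto simp: bucket_columns_def)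
qed

lemma bucket_columns_range:
  assumes "x \<in> bucket_columns a e n" "0 \<le> a" "e \<le> n"
  shows "0 \<le> x" "x < nn"
proof -
  obtain k r where "k \<in> {0..<n}" "r \<in> {a..<e}" "x = \<sigma> k r * n + k"
    using assms(1) by (auto simp: bucket_columns_def bucket_column_def)
  moreover from this have "0 \<le> k" "k < n" "0 \<le> r" "r < n" using assms(2,3) by auto
  ultimately show "0 \<le> x" "x < nn"
    using row_major_bound[of "\<sigma> k r" k] perm_range[of k r] by simp_all
qed

lemma loaded_insert:
  "loaded l X m \<Longrightarrow> 0 \<le> x \<Longrightarrow> 0 \<le> l \<Longrightarrow> l < S \<Longrightarrow>
    loaded l (insert x X) (m(cell S l (int K + x) := 1))"
  by (simp add: loaded_def cell_eq_iff)

lemma mem_bucket_columns_iff: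
  assumes "x < N * N"
  shows "int x \<in> bucket_columns a e n \<longleftrightarrow> int (x div N) \<in> \<sigma> (int (x mod N)) ` {a..<e}"
proof -
  have "0 < N" using n_pos by simp
  then have div: "x div N < N" "x mod N < N" using assms
    by (simp_all add: less_mult_imp_div_less)
  have x: "int x = int (x div N) * n + int (x mod N)"
    using int_N(1) by (metis div_mult_mod_eq of_nat_add of_nat_mult)
  have row_col: "int x = \<sigma> k r * n + k \<longleftrightarrow> k = int (x mod N) \<and> \<sigma> k r = int (x div N)"
    if "0 \<le> k" "k < n" for k r
    using row_major_inj[of k "int (x mod N)" "\<sigma> k r" "int (x div N)"] div that x int_N(1)
    by auto
  have "int x \<in> bucket_columns a e n \<longleftrightarrow> (\<exists>k \<in> {0..<n}. \<exists>r \<in> {a..<e}. int x = \<sigma> k r * n + k)"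
    by (simp add: bucket_columns_def bucket_column_def image_iff)
  also have "\<dots> \<longleftrightarrow> (\<exists>k \<in> {0..<n}. \<exists>r \<in> {a..<e}. k = int (x mod N) \<and> \<sigma> k r = int (x div N))"
    by (intro bex_cong refl row_col) auto
  also have "\<dots> \<longleftrightarrow> (\<exists>r \<in> {a..<e}. \<sigma> (int (x mod N)) r = int (x div N))"
    using div(2) by (auto simp: zless_nat_eq_int_zless)
  finally show ?thesis by (simp add: image_iff eq_commute)
qed

lemma loaded_init_state:
  assumes loaded: "loaded l (bucket_columns a e n) m" and "0 \<le> a" "e \<le> n" and l: "0 \<le> l" "l < S"
  shows "machine_at l (m(cell S l 0 := n)) (init_state N (bucket_matrix a e))"
proof -
  have "m (cell S l (int K + int x)) = snd (init_state N (bucket_matrix a e)) x \<and>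
    snd (init_state N (bucket_matrix a e)) x \<in> words b0" for x
  proof (cases "x < N * N")
    case True
    then have "x div N < N" "x mod N < N" using n_pos by (simp_all add: less_mult_imp_div_less)
    with loaded True bits_b0 mem_bucket_columns_iff[OF True] show ?thesis
      by (simp add: loaded_def init_state_def bucket_matrix_def)
  next
    case False
    then have "nn \<le> int x" unfolding int_N(2)[symmetric] by (simp only: of_nat_le_iff not_less)
    then have "int x \<notin> bucket_columns a e n" using bucket_columns_range[of "int x" a e] assms
      by auto
    with loaded False bits_b0 show ?thesis by (simp add: loaded_def init_state_def)
  qed
  moreover have "m (cell S l (int r)) = 0" if "r < K" for r
    using loaded bucket_columns_range[of "int r - int K" a e] assms(2,3) that
    by (auto simp: loaded_def)
  moreover have "cell S l (int K + int x) \<noteq> cell S l 0"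
    "cell S l (int r) = cell S l 0 \<longleftrightarrow> r = 0" for x r
    using K_pos l by (simp_all add: cell_eq_iff)
  ultimately show ?thesis
    unfolding machine_at_def using bits_b0 int_N(1) by (auto simp: init_state_def)
qed

lemma runs_load_cell:
  assumes column: "at_column k V" and "V rRank = r" "V rLane = l"
    and range: "0 \<le> r" "r < n" "0 \<le> l" "l < S" and mem: "static_mem m"
    and "Q V (m(cell S l (int K + (\<sigma> k r * n + k)) := 1))"
  shows "runs b (load_cell K) x (lane_cells S l) 20 Q V m"
proof -
  let ?x = "\<sigma> k r * n + k"
  have k: "V rDim = n" "V rCol = k" "0 \<le> k" "k < n" "static_env V"
    using column by (simp_all add: at_column_def static_env_def)
  have "0 \<le> \<sigma> k r" "\<sigma> k r < n" using perm_range k range by simp_all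
  then have x: "0 \<le> \<sigma> k r * n" "0 \<le> ?x" "?x < nn" using row_major_bound[of "\<sigma> k r" k] k by simp_all
  then have "\<sigma> k r * n \<in> words b" "?x \<in> words b" "?x < perm_base"
    using k n_le_nn n_pos by (auto simp: perm_base_def intro!: small_word)
  then have "safe b (mem_cell K (perm_entry (Var rRank) *\<^sub>e Var rDim +\<^sub>e Var rCol)) V m"
    "val (mem_cell K (perm_entry (Var rRank) *\<^sub>e Var rDim +\<^sub>e Var rCol)) V m =
        cell S l (int K + ?x)"
    using safe_mem_cell_lane[of "perm_entry (Var rRank) *\<^sub>e Var rDim +\<^sub>e Var rCol" V m ?x l]
      safe_perm_entry[OF column mem, of "Var rRank" r] assms(2,3) range k x by simp_all
  moreover have "0 \<le> cell S l (int K + ?x)" "cell S l (int K + ?x) \<in> lane_cells S l"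
    using cell_nonneg[of "int K + ?x" l] cell_in_lane_cells[of "int K + ?x"] x range by simp_all
  ultimately show ?thesis using assms(9) unfolding load_cell_def by (intro runs_store) simp_all
qed

lemma runs_load_column:
  assumes column: "at_column k V" and "V rStart = a" "V rEnd = e" "V rLane = l"
    and range: "0 \<le> a" "a < e" "e \<le> n" "e \<le> a + g" "0 \<le> l" "l < S"
    and mem: "static_mem m" "loaded l (bucket_columns a e k) m"
  shows "runs b (load_column K) rRank (lane_cells S l) (27 * g + 7)
    (\<lambda>_. loaded l (bucket_columns a e (k + 1))) V m"
proof -
  have k: "0 \<le> k" "k < n" using column by (simp_all add: at_column_def)
  have lane: "lane_cells S l \<subseteq> answer_cells \<union> {S..}" using lane_cells_ge_S range by blast
  define J where "J = (\<lambda>r. loaded l (bucket_columns a e k \<union> bucket_column a r k))"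
  have "runs b (load_column K) rRank (lane_cells S l) (27 * g + 7) (\<lambda>_. J e) V m"
    unfolding load_column_def
  proof (rule runs_for_loop_const[where lo = a and c = 20])
    have "a \<in> words b" using range n_pos n_le_nn by (intro small_word) auto
    then show "safe b (Var rStart +\<^sub>e Lit 0) V m" using assms(2) by simp
    fix r V' m'
    assume r: "a \<le> r" "r < e" "V' rRank = r"
      and frame: "agree_off {rRank..} V V'" "agree_off (lane_cells S l) m m'" and inv: "J r m'"
    have "\<sigma> k r * n + k \<ge> 0"
      using row_major_bound(1)[of "\<sigma> k r" k] perm_range[of k r] k r range by simp
    then have "J (r + 1) (m'(cell S l (int K + (\<sigma> k r * n + k)) := 1))"
      using inv r range loaded_insert[of l _ m' "\<sigma> k r * n + k"]
      by (simp add: J_def bucket_column_Suc)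
    moreover have "static_mem m'" by (rule static_mem_agree[OF mem(1) frame(2) lane])
    ultimately show "runs b (load_cell K) (Suc rRank) (lane_cells S l) 20 (\<lambda>_. J (r + 1)) V' m'"
      using at_column_agree[OF column frame(1)] agree_offD[OF frame(1), of rLane] assms(4) r range
      by (intro runs_load_cell[where k = k and r = r]) auto
  qed (use assms(2,3) range mem(2) n_less_word b_pos in \<open>simp_all add: J_def bucket_column_empty\<close>)
  then show ?thesis using k by (simp add: J_def bucket_columns_Suc)
qed

lemma runs_load_columns:
  assumes env: "static_env V" "V rStart = a" "V rEnd = e" "V rLane = l"
    and range: "0 \<le> a" "a < e" "e \<le> n" "e \<le> a + g" "0 \<le> l" "l < S"
    and mem: "static_mem m" "\<And>v. 0 \<le> v \<Longrightarrow> m (cell S l v) = 0"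
  shows "runs b (load_columns K) rCol (lane_cells S l) (n * (27 * g + 14) + 5)
    (\<lambda>_. loaded l (bucket_columns a e n)) V m"
  unfolding load_columns_def
proof (rule runs_for_loop_const[where lo = 0 and c = "27 * g + 7" and
      J = "\<lambda>k. loaded l (bucket_columns a e k)"])
  fix k V' m'
  assume "0 \<le> k" "k < n" "V' rCol = k" "loaded l (bucket_columns a e k) m'"
    and frame: "agree_off {rCol..} V V'" "agree_off (lane_cells S l) m m'"
  moreover have "lane_cells S l \<subseteq> answer_cells \<union> {S..}" using lane_cells_ge_S range by blast
  then have "static_mem m'" by (rule static_mem_agree[OF mem(1) frame(2)])
  ultimately show "runs b (load_column K) (Suc rCol) (lane_cells S l) (27 * g + 7)
      (\<lambda>_. loaded l (bucket_columns a e (k + 1))) V' m'"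
    using env range static_env_agree[OF env(1) frame(1)] agree_offD[OF frame(1)]
    by (intro runs_mono[OF runs_load_column]) (auto simp: at_column_def)
qed (use env mem n_pos n_less_word b_pos in
    \<open>auto simp: static_env_def loaded_def bucket_columns_def\<close>)

lemma runs_load_level:
  assumes env: "static_env V" "V rStart = a" "V rSize = g" "V rLane = l"
    and range: "0 \<le> a" "a < n" "1 \<le> g" "n + g \<le> S" "0 \<le> l" "l < S" and e: "e = min (a + g) n"
    and mem: "static_mem m" "\<And>v. 0 \<le> v \<Longrightarrow> m (cell S l v) = 0"
  shows "runs b (load_level K) rEnd (lane_cells S l) (80 * (g * n))
    (\<lambda>_ m'. machine_at l m' (init_state N (bucket_matrix a e))) V m"
proof -
  let ?V = "V(rEnd := e)" and ?P = "\<lambda>_ m'. machine_at l m' (init_state N (bucket_matrix a e))"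
  have range': "a < e" "e \<le> n" "e \<le> a + g" using range e by auto
  have time: "n * (27 * g + 14) + 5 + 17 \<le> 80 * (g * n)"
  proof -
    have "n \<le> g * n" using range n_pos mult_right_mono[of 1 g n] by simp
    moreover have "n * (27 * g + 14) = 27 * (g * n) + 14 * n" by (simp add: algebra_simps)
    ultimately show ?thesis using n_pos by linarith
  qed
  have load: "runs b (load_columns K) rCol (lane_cells S l) (n * (27 * g + 14) + 5)
      (\<lambda>_. loaded l (bucket_columns a e n)) ?V m"
    using env range range' mem by (intro runs_load_columns) simp_all
  have "runs b (load_columns K ;; store (reg_cell 0) (Var rDim)) rEnd (lane_cells S l)
      (80 * (g * n) - 10) ?P ?V m"
  proof (rule runs_Seq[OF load])
    fix V1 m1
    assume frame: "agree_off {rCol..} ?V V1" and loaded: "loaded l (bucket_columns a e n) m1"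
    have "V1 rStride = S" "V1 rLane = l" "V1 rDim = n"
      using agree_offD[OF frame] env by (simp_all add: static_env_def)
    then show "runs b (store (reg_cell 0) (Var rDim)) rEnd (lane_cells S l)
        (80 * (g * n) - 10 - (n * (27 * g + 14) + 5)) ?P V1 m1"
      using safe_reg_cell[of 0 V1 l m1] K_pos range time cell_nonneg[of 0 l]
        cell_in_lane_cells[of 0 S l] loaded_init_state[OF loaded range(1) range'(2) range(5,6)]
      by (intro runs_store) simp_all
  qed auto
  then show ?thesis unfolding load_level_def
    by (intro runs_Seq[OF runs_set_end[OF env(1-3) range(1,2)]]) (use range e in auto)
qed

end


section \<open>Phases of doubling bucket size\<close>

context layout
begin

definition levels :: "int \<Rightarrow> nat" where
  "levels g = (LEAST j. n \<le> int j * g)"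

definition cut :: "int \<Rightarrow> nat \<Rightarrow> int" where
  "cut g j = min (int j * g) n"

lemma less_levels_iff:
  assumes "1 \<le> g"
  shows "j < levels g \<longleftrightarrow> int j * g < n"
proof
  show "int j * g < n" if "j < levels g"
    using not_less_Least[OF that[unfolded levels_def]] by simp
next
  assume less: "int j * g < n"
  have "n * 1 \<le> n * g" using assms n_pos by (intro mult_left_mono) auto
  then have "n \<le> int (nat n) * g" using n_pos by simp
  then have "n \<le> int (levels g) * g" unfolding levels_def by (rule LeastI)
  with less have "int j * g < int (levels g) * g" by simp
  then show "j < levels g" using assms by simp
qed

lemma levels_le:
  assumes "1 \<le> g"
  shows "int (levels g) \<le> n"
proof -
  have "n * 1 \<le> n * g" using assms n_pos by (intro mult_left_mono) auto
  then have "\<not> nat n < levels g" using less_levels_iff[OF assms, of "nat n"] n_pos by simp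
  then show ?thesis using n_pos by simp
qed

lemma levels_mult_less:
  assumes "1 \<le> g"
  shows "int (levels g) * g < n + g"
proof (cases "levels g")
  case (Suc j)
  then have "int j * g < n" using less_levels_iff[OF assms, of j] by simp
  with Suc show ?thesis by (simp add: algebra_simps)
qed (use assms n_pos in simp)

lemma cut_0 [simp]: "cut g 0 = 0"
  using n_pos by (simp add: cut_def)

lemma cut_levels: "1 \<le> g \<Longrightarrow> cut g (levels g) = n"
  using less_levels_iff[of g "levels g"] by (simp add: cut_def)

lemma cut_less: "1 \<le> g \<Longrightarrow> j < levels g \<Longrightarrow> cut g j = int j * g"
  using less_levels_iff[of g j] by (simp add: cut_def)

lemma cut_range:
  assumes "1 \<le> g"
  shows "0 \<le> cut g j" "cut g j \<le> n" "cut g j \<le> cut g (Suc j)"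
  using assms n_pos by (auto simp: cut_def algebra_simps)

lemma cut_mono:
  assumes "1 \<le> g" "i \<le> j"
  shows "cut g i \<le> cut g j"
proof -
  have "int i * g \<le> int j * g" using assms by (intro mult_right_mono) auto
  then show ?thesis by (auto simp: cut_def)
qed

end

lemma card_le_2_if_nothing_between:
  fixes A :: "'a::linorder set"
  assumes "finite A" "\<And>x y z. x \<in> A \<Longrightarrow> y \<in> A \<Longrightarrow> z \<in> A \<Longrightarrow> x < y \<Longrightarrow> y < z \<Longrightarrow> False"
  shows "card A \<le> 2"
proof (cases "A = {}")
  case False
  have "A \<subseteq> {Min A, Max A}"
  proof
    fix y assume "y \<in> A"
    then show "y \<in> {Min A, Max A}"
      using assms(2)[of "Min A" y "Max A"] Min_in[OF assms(1) False] Max_in[OF assms(1) False]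
        Min_le[OF assms(1)] Max_ge[OF assms(1)] by (auto simp: order.order_iff_strict)
  qed
  then have "card A \<le> card {Min A, Max A}" by (intro card_mono) auto
  also have "\<dots> \<le> 2" by (simp add: card_insert_if)
  finally show ?thesis .
qed simp

definition levels_left :: exp where
  "levels_left = (Var rStart <\<^sub>e Var rDim) *\<^sub>e (Var rSteps <\<^sub>e Var rSize *\<^sub>e Var rSquare)"

definition next_level :: com where
  "next_level = rStart ::= Var rStart +\<^sub>e Var rSize ;; rLane ::= Var rLane +\<^sub>e Lit 1"

definition for_levels :: "com \<Rightarrow> com" where
  "for_levels p = rLane ::= Var rDim *\<^sub>e Var rSize ;; rStart ::= Lit 0 ;;
    WHILE levels_left DO (p ;; next_level)"

definition build :: "nat \<Rightarrow> com \<Rightarrow> com" where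
  "build K pre = rSteps ::= Lit 0 ;; for_levels (load_level K ;; sim K pre)"

definition clear_answer :: com where
  "clear_answer = FOR rRow FROM Lit 0 BELOW rDim DO store (Var rAnswer +\<^sub>e Var rRow) (Lit 0)"

definition query_levels :: "nat \<Rightarrow> com \<Rightarrow> com" where
  "query_levels K query = clear_answer ;; for_levels (query_level K query)"

definition scan_all :: com where
  "scan_all = rStart ::= Lit 0 ;; rEnd ::= Var rDim +\<^sub>e Lit 0 ;;
    FOR rCol FROM Lit 0 BELOW rDim DO (rQuery ::= query_entry ;; scan)"

definition next_phase :: "nat \<Rightarrow> com \<Rightarrow> com" where
  "next_phase K pre = clear_answer ;; scan_all ;; rSize ::= Var rSize +\<^sub>e Var rSize ;; build K pre"

definition eq_query :: "nat \<Rightarrow> com \<Rightarrow> com \<Rightarrow> com" where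
  "eq_query K pre query =
    query_levels K query ;; WHEN Var rStart <\<^sub>e Var rDim DO next_phase K pre"

context buckets
begin

abbreviation straddles_level :: "(int \<Rightarrow> int) \<Rightarrow> int \<Rightarrow> int \<Rightarrow> nat \<Rightarrow> bool" where
  "straddles_level q g k j \<equiv> straddles q (cut g j) (cut g (Suc j)) k"

lemma straddles_not_between:
  assumes "1 \<le> g" "0 \<le> k" "k < n" and levels: "x < y" "y < z" "z < levels g"
    and outer: "straddles_level q g k x" "straddles_level q g k z"
  shows "\<not> straddles_level q g k y"
proof
  assume "straddles_level q g k y"
  then have "\<not> uniform (cut g y) (cut g (Suc y)) k" by (simp add: straddles_def)
  have strict: "cut g j < cut g (Suc j)" if "j < levels g" for j
    using cut_less[OF assms(1) that] less_levels_iff[OF assms(1), of j] that assms(1)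
    by (simp add: cut_def algebra_simps)
  have cuts: "0 \<le> cut g x" "cut g x < cut g (Suc x)" "cut g (Suc x) \<le> cut g y"
    "cut g y < cut g (Suc y)" "cut g (Suc y) \<le> cut g z" "cut g z < n"
    using cut_mono[OF assms(1), of "Suc x" y] cut_mono[OF assms(1), of "Suc y" z]
      cut_range(1)[OF assms(1), of x] cut_range(2)[OF assms(1), of "Suc z"]
      strict[of x] strict[of y] strict[of z] levels by auto
  have "q k \<le> M (\<sigma> k (cut g (Suc x) - 1)) k" using outer(1) by (simp add: straddles_def)
  also have "\<dots> \<le> M (\<sigma> k (cut g y)) k" using cuts assms by (intro perm_mono) auto
  finally have "q k \<le> M (\<sigma> k (cut g y)) k" .
  moreover have "M (\<sigma> k (cut g (Suc y) - 1)) k \<le> M (\<sigma> k (cut g z)) k"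
    using cuts assms by (intro perm_mono) auto
  moreover have "M (\<sigma> k (cut g z)) k \<le> q k" using outer(2) by (simp add: straddles_def)
  moreover have "M (\<sigma> k (cut g y)) k \<le> M (\<sigma> k (cut g (Suc y) - 1)) k"
    using cuts assms by (intro perm_mono) auto
  ultimately have "uniform (cut g y) (cut g (Suc y)) k" unfolding uniform_def by linarith
  with \<open>\<not> uniform _ _ k\<close> show False ..
qed

lemma straddle_count_sum:
  assumes "1 \<le> g"
  shows "(\<Sum>j < levels g. straddle_count q (cut g j) (cut g (Suc j))) \<le> 2 * n"
proof -
  have "(\<Sum>j < levels g. straddle_count q (cut g j) (cut g (Suc j))) =
      (\<Sum>k \<in> {0..<n}. \<Sum>j < levels g. of_bool (straddles_level q g k j))"
    unfolding straddle_count_def by (rule sum.swap)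
  also have "\<dots> \<le> (\<Sum>k \<in> {0..<n}. 2)"
  proof (rule sum_mono)
    fix k assume "k \<in> {0..<n}"
    then have "card ({..<levels g} \<inter> {j. straddles_level q g k j}) \<le> 2"
      using straddles_not_between[OF assms, of k _ _ _ q]
      by (intro card_le_2_if_nothing_between) auto
    then show "(\<Sum>j < levels g. of_bool (straddles_level q g k j)) \<le> (2::int)"
      by (simp add: sum_of_bool_eq)
  qed
  also have "\<dots> = 2 * n" using n_pos by simp
  finally show ?thesis .
qed

definition matches :: "(int \<Rightarrow> int) \<Rightarrow> int \<Rightarrow> bool" where
  "matches q i \<longleftrightarrow> (\<exists>k. 0 \<le> k \<and> k < n \<and> M i k = q k)"

definition answers :: "(int \<Rightarrow> int) \<Rightarrow> imem \<Rightarrow> bool" where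
  "answers q m \<longleftrightarrow> (\<forall>i. 0 \<le> i \<and> i < n \<longrightarrow> answer m i = of_bool (matches q i))"

definition no_answer :: "imem \<Rightarrow> bool" where
  "no_answer m \<longleftrightarrow> (\<forall>i. 0 \<le> i \<and> i < n \<longrightarrow> answer m i = 0)"

lemma answers_if_marked:
  assumes "no_answer m" "marked (\<lambda>i. \<exists>k. 0 \<le> k \<and> k < n \<and> hit q 0 n k i) m m'"
  shows "answers q m'"
  unfolding answers_def
proof (intro allI impI)
  fix i assume i: "0 \<le> i \<and> i < n"
  then have "(\<exists>k. 0 \<le> k \<and> k < n \<and> hit q 0 n k i) \<longleftrightarrow> matches q i"
    using hit_all[of _ i q] unfolding matches_def by blast
  with i assms show "answer m' i = of_bool (matches q i)"
    by (simp add: marked_def no_answer_def)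
qed

lemma runs_clear_answer:
  assumes env: "static_env V"
  shows "runs b clear_answer rRow answer_cells (20 * n) (\<lambda>_. no_answer) V m"
proof -
  define J where "J = (\<lambda>j m'. \<forall>i. 0 \<le> i \<and> i < j \<longrightarrow> answer m' i = 0)"
  have "runs b clear_answer rRow answer_cells (20 * n) (\<lambda>_. J n) V m"
    unfolding clear_answer_def
  proof (rule runs_for_loop_const[where lo = 0 and c = 5 and J = J])
    fix i V' m'
    assume i: "0 \<le> i" "i < n" "V' rRow = i" and frame: "agree_off {rRow..} V V'" and inv: "J i m'"
    have "V' rAnswer = answer_base" using agree_offD[OF frame] env by (simp add: static_env_def)
    moreover have "answer_base + i \<in> words b" "0 \<le> answer_base + i"
      using i n_pos n_le_nn by (auto simp: region_defs intro!: small_word)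
    moreover have "J (i + 1) (m'(answer_base + i := 0))"
      using inv by (auto simp: J_def)
    ultimately show "runs b (store (Var rAnswer +\<^sub>e Var rRow) (Lit 0)) (Suc rRow) answer_cells 5
        (\<lambda>_. J (i + 1)) V' m'"
      using i by (intro runs_store) simp_all
  qed (use env n_pos n_less_word b_pos in \<open>simp_all add: static_env_def J_def\<close>)
  then show ?thesis by (simp add: J_def no_answer_def[abs_def])
qed

lemma runs_scan_all:
  assumes env: "static_env V" and mem: "static_mem m" "has_query q m" "no_answer m"
  shows "runs b scan_all rStart answer_cells (80 * nn)
    (\<lambda>V' m'. V' rSteps = V rSteps \<and> answers q m') V m"
proof -
  let ?V = "V(rStart := 0, rEnd := n)"
  define J where "J = (\<lambda>k. marked (\<lambda>i. \<exists>j. 0 \<le> j \<and> j < k \<and> hit q 0 n j i) m)"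
  have nn: "n * (40 * n + 10 + 4 + 7) = 40 * nn + 21 * n" by (simp add: nn_def algebra_simps)
  have "runs b (FOR rCol FROM Lit 0 BELOW rDim DO (rQuery ::= query_entry ;; scan)) rCol
      answer_cells (80 * nn - 4) (\<lambda>_. J n) ?V m"
  proof (rule runs_for_loop_const[where lo = 0 and c = "40 * n + 10 + 4" and J = J])
    fix k V' m'
    assume k: "0 \<le> k" "k < n" "V' rCol = k" and inv: "J k m'"
      and frame: "agree_off {rCol..} ?V V'" "agree_off answer_cells m m'"
    have env': "static_env V'" "V' rStart = 0" "V' rEnd = n"
      using static_env_agree[OF _ frame(1)] agree_offD[OF frame(1)] env by simp_all
    then have column: "at_column k V'" using k by (simp add: at_column_def)
    have mem': "static_mem m'" "has_query q m'"
      using static_mem_agree[OF mem(1) frame(2)] has_query_agree[OF mem(2) frame(2)] by simp_all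
    have scan: "runs b scan rRank answer_cells (40 * (n - 0) + 10)
        (\<lambda>_. marked (hit q 0 n k) m') (V'(rQuery := val query_entry V' m')) m'"
      using safe_query_entry(2)[OF column mem'(2)] column env' mem' n_pos
      by (intro runs_scan) simp_all
    have "J (k + 1) m''" if "marked (hit q 0 n k) m' m''" for m''
      using marked_trans[OF inv[unfolded J_def] that] k(1) unfolding J_def
      by (elim marked_cong) (auto simp: less_le)
    then show "runs b (rQuery ::= query_entry ;; scan) (Suc rCol) answer_cells (40 * n + 10 + 4)
        (\<lambda>_. J (k + 1)) V' m'"
      using safe_query_entry[OF column mem'(2)]
      by (intro runs_assign_Seq runs_mono[OF scan]) simp_all
  next
    show "J 0 m" by (auto simp: J_def marked_def)
  qed (use env nn n_le_nn n_pos n_less_word b_pos in \<open>simp_all add: static_env_def\<close>)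
  then have "runs b (FOR rCol FROM Lit 0 BELOW rDim DO (rQuery ::= query_entry ;; scan)) rStart
      answer_cells (80 * nn - 4) (\<lambda>V' m'. V' rSteps = V rSteps \<and> answers q m') ?V m"
    by (rule runs_mono)
      (use answers_if_marked[OF mem(3)] agree_offD[of "{rCol..}" ?V _ rSteps] in
        \<open>simp_all add: J_def\<close>)
  moreover have "n \<in> words b" using n_pos n_le_nn by (intro small_word) auto
  ultimately show ?thesis unfolding scan_all_def
    using env by (intro runs_assign_Seq) (simp_all add: static_env_def)
qed

lemma answers_agree: "answers q m \<Longrightarrow> agree_off F m m' \<Longrightarrow> F \<subseteq> {S..} \<Longrightarrow> answers q m'"
  using answer_agree by (simp add: answers_def)

lemma static_mem_put_query:
  "static_mem m \<Longrightarrow> agree_off {nn..<nn + n} m m' \<Longrightarrow> static_mem m'"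
  using n_pos by (elim static_mem_cong) (auto simp: region_defs elim!: agree_offD)

lemma put_query_represents:
  assumes "represents s V m"
  obtains m' where "represents (put_query N v s) V m'" "agree_off {nn..<nn + n} m m'"
    "has_query (\<lambda>k. v $ nat k) m'"
proof (rule that)
  let ?m = "\<lambda>x. if nn \<le> x \<and> x < nn + n then v $ nat (x - nn) else m x"
  show "represents (put_query N v s) V ?m"
    using assms by (simp add: represents_def snd_put_query) (simp add: put_query_def)
  show "agree_off {nn..<nn + n} m ?m" by (simp add: agree_off_def)
  show "has_query (\<lambda>k. v $ nat k) ?m" by (simp add: has_query_def)
qed

lemma read_answer_equality:
  assumes "represents s V m" "answers (\<lambda>k. v $ nat k) m"
    and A: "A \<in> carrier_mat N N" "\<And>i k. i < N \<Longrightarrow> k < N \<Longrightarrow> A $$ (i, k) = M (int i) (int k)"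
  shows "read_answer N s = equality_answer A v"
proof (rule eq_vecI)
  fix i assume "i < dim_vec (equality_answer A v)"
  then have i: "i < N" using A(1) by (simp add: equality_answer_def)
  then have i': "0 \<le> int i \<and> int i < n" by simp
  have "snd s (N * N + N + i) = answer m (int i)"
    using assms(1) int_N by (simp add: represents_def answer_def answer_base_def)
  also have "\<dots> = of_bool (matches (\<lambda>k. v $ nat k) (int i))"
    using assms(2) i' by (simp add: answers_def)
  also have "matches (\<lambda>k. v $ nat k) (int i) \<longleftrightarrow> (\<exists>k < N. A $$ (i, k) = v $ k)"
    unfolding matches_def using A(2)[OF i]
    by (metis int_N(1) nat_0_le nat_int of_nat_0_le_iff of_nat_less_iff)
  finally show "read_answer N s $ i = equality_answer A v $ i"
    using i A(1) by (simp add: read_answer_def equality_answer_def)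
qed (use A(1) in \<open>simp add: read_answer_def equality_answer_def\<close>)

end

definition boolean_vec :: "nat \<Rightarrow> int vec \<Rightarrow> bool" where
  "boolean_vec N v \<longleftrightarrow> v \<in> carrier_vec N \<and> vec_set v \<subseteq> {0, 1}"

definition boolean_mat :: "nat \<Rightarrow> int mat \<Rightarrow> bool" where
  "boolean_mat N A \<longleftrightarrow> A \<in> carrier_mat N N \<and> elements_mat A \<subseteq> {0, 1}"

lemma boolean_vec_zero: "boolean_vec N (0\<^sub>v N)"
  by (auto simp: boolean_vec_def vec_set_def)

text \<open>
  \<open>Y\<close> bounds the time that an instance of the Boolean problem is charged for, and \<open>G\<close> the bucket
  sizes that are used: a phase of bucket size \<open>g\<close> that is abandoned for taking too long satisfies
  the premise of \<open>abandoned_size\<close>.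
\<close>

locale boolean_solver = layout_lanes n S b M K b0
  for n S b M K b0 +
  fixes pre query :: com and Y :: nat and G :: int
  assumes reg_bounds: "reg_bound pre \<le> K" "reg_bound query \<le> K"
    and solves: "\<And>A vs. boolean_mat (nat n) A \<Longrightarrow> length vs = nat n \<Longrightarrow>
      \<forall>v \<in> set vs. boolean_vec (nat n) v \<Longrightarrow>
      \<exists>t0 s t. exec b0 pre (init_state (nat n) A) t0 s \<and>
        serves b0 query (nat n) (boolean_answer A) s vs t \<and> t0 + t + nat n * nat n \<le> Y"
    and G_pos: "1 \<le> G" and G_lanes: "n * G + n < S"
    and abandoned_size: "\<And>g. 1 \<le> g \<Longrightarrow> g * (g * (n * n)) \<le> (n + g) * int Y \<Longrightarrow> 2 * g \<le> G"
    and steps_fit: "G * (n * n) + int Y < 2 ^ b"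
begin

definition serves_within :: "int mat \<Rightarrow> int vec list \<Rightarrow> int \<Rightarrow> int \<Rightarrow> env \<Rightarrow> imem \<Rightarrow> bool" where
  "serves_within A vs T t V m \<longleftrightarrow> (\<forall>s. represents s V m \<longrightarrow>
    (\<exists>u. serves b (eq_query K pre query) (nat n) (equality_answer A) s vs u \<and> t + int u \<le> T))"

end

locale reduction = boolean_solver n S b M K b0 pre query Y G + buckets n S b M K b0 \<sigma>
  for n S b M K b0 pre query Y G \<sigma>
begin

definition can_serve :: "int mat \<Rightarrow> nat \<Rightarrow> state \<Rightarrow> nat \<Rightarrow> bool" where
  "can_serve A k s t \<longleftrightarrow> (\<forall>vs. length vs = k \<and> (\<forall>v \<in> set vs. boolean_vec N v) \<longrightarrow>
    (\<exists>t'. serves b0 query N (boolean_answer A) s vs t' \<and> t + t' + N * k \<le> Y))"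

lemma can_serveE:
  assumes "can_serve A k s t"
  obtains t' where "t + t' + N * k \<le> Y"
  using assms[unfolded can_serve_def, rule_format, of "replicate k (0\<^sub>v N)"] boolean_vec_zero
  by auto

lemma can_serve_init:
  assumes "boolean_mat N A"
  obtains t0 s where "exec b0 pre (init_state N A) t0 s" "can_serve A N s t0"
proof -
  obtain t0 s where init: "exec b0 pre (init_state N A) t0 s"
    using solves[OF assms, of "replicate N (0\<^sub>v N)"] boolean_vec_zero by auto
  have "can_serve A N s t0"
    unfolding can_serve_def
  proof (intro allI impI)
    fix vs assume "length vs = N \<and> (\<forall>v \<in> set vs. boolean_vec N v)"
    then obtain t0' s' t where "exec b0 pre (init_state N A) t0' s'"
      "serves b0 query N (boolean_answer A) s' vs t" "t0' + t + N * N \<le> Y"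
      using solves[OF assms, of vs] by blast
    moreover from this have "t0 = t0' \<and> s = s'" by (intro exec_deterministic[OF init])
    ultimately show "\<exists>t'. serves b0 query N (boolean_answer A) s vs t' \<and> t0 + t' + N * N \<le> Y"
      by auto
  qed
  with init show ?thesis by (rule that)
qed

lemma can_serve_step:
  assumes serve: "can_serve A (Suc k) s t" and v: "boolean_vec N v"
  obtains u s' where "exec b0 query (put_query N v s) u s'" "read_answer N s' = boolean_answer A v"
    "can_serve A k s' (t + (u + N))"
proof -
  have first: "\<exists>u s' t'. exec b0 query (put_query N v s) u s' \<and>
      read_answer N s' = boolean_answer A v \<and>
      serves b0 query N (boolean_answer A) s' vs t' \<and> t + (u + N) + t' + N * k \<le> Y"
    if "length vs = k \<and> (\<forall>v \<in> set vs. boolean_vec N v)" for vs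
  proof -
    have "length (v # vs) = Suc k \<and> (\<forall>v' \<in> set (v # vs). boolean_vec N v')" using that v by simp
    then obtain t' where served: "serves b0 query N (boolean_answer A) s (v # vs) t'"
      and "t + t' + N * Suc k \<le> Y"
      using serve unfolding can_serve_def by blast
    then show ?thesis by (cases rule: serves.cases[OF served]) (auto simp: algebra_simps)
  qed
  obtain u s' where exec: "exec b0 query (put_query N v s) u s'"
    "read_answer N s' = boolean_answer A v"
    using first[of "replicate k (0\<^sub>v N)"] boolean_vec_zero by auto
  have "can_serve A k s' (t + (u + N))"
    unfolding can_serve_def using first exec_deterministic[OF exec(1)] by blast
  with exec show ?thesis by (rule that)
qed

lemma boolean_query_vec: "boolean_vec N (query_vec q a e)"
  by (auto simp: boolean_vec_def query_vec_def vec_set_def query_bit_def)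

lemma boolean_bucket_matrix: "boolean_mat N (bucket_matrix a e)"
  by (auto simp: boolean_mat_def bucket_matrix_def elements_mat_def)

definition level_matrix :: "int \<Rightarrow> nat \<Rightarrow> int mat" where
  "level_matrix g j = bucket_matrix (cut g j) (cut g (Suc j))"

definition level_lane :: "int \<Rightarrow> nat \<Rightarrow> int" where
  "level_lane g j = n * g + int j"

definition level_ready :: "int \<Rightarrow> imem \<Rightarrow> nat \<Rightarrow> nat \<Rightarrow> nat \<Rightarrow> bool" where
  "level_ready g m j r t \<longleftrightarrow> (\<exists>s k. machine_at (level_lane g j) m s \<and> r \<le> k \<and>
    can_serve (level_matrix g j) k s t)"

definition levels_at :: "int \<Rightarrow> nat \<Rightarrow> (nat \<Rightarrow> nat) \<Rightarrow> imem \<Rightarrow> int \<Rightarrow> bool" where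
  "levels_at g J \<kappa> m c \<longleftrightarrow>
    (\<exists>T. (\<forall>j < J. level_ready g m j (\<kappa> j) (T j)) \<and> c = (\<Sum>j < J. int (T j)))"

definition exhausted :: "int \<Rightarrow> int \<Rightarrow> bool" where
  "exhausted g c \<longleftrightarrow> g * nn \<le> c \<and> c \<le> int (levels g) * int Y"

definition phase_at :: "int \<Rightarrow> nat \<Rightarrow> (nat \<Rightarrow> nat) \<Rightarrow> imem \<Rightarrow> int \<Rightarrow> bool" where
  "phase_at g J \<kappa> m c \<longleftrightarrow> 0 \<le> c \<and> c \<le> g * nn + int Y \<and> (levels_at g J \<kappa> m c \<or> exhausted g c)"

definition phase_lanes :: "int \<Rightarrow> int set" where
  "phase_lanes g = (\<Union>l \<in> {n * g..<n * g + n}. lane_cells S l)"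

definition fresh_from :: "int \<Rightarrow> imem \<Rightarrow> bool" where
  "fresh_from l0 m \<longleftrightarrow> (\<forall>l v. l0 \<le> l \<and> l < S \<and> 0 \<le> v \<longrightarrow> m (cell S l v) = 0)"

lemma level_ready_le: "level_ready g m j r t \<Longrightarrow> t \<le> Y"
  by (auto simp: level_ready_def elim!: can_serveE)

lemma levels_at_bound:
  assumes "levels_at g J \<kappa> m c"
  shows "0 \<le> c" "c \<le> int J * int Y"
proof -
  obtain T where T: "\<And>j. j < J \<Longrightarrow> T j \<le> Y" "c = (\<Sum>j < J. int (T j))"
    using assms level_ready_le unfolding levels_at_def by blast
  have "(\<Sum>j < J. int (T j)) \<le> (\<Sum>j < J. int Y)" using T(1) by (intro sum_mono) simp
  with T(2) show "0 \<le> c" "c \<le> int J * int Y" by (simp_all add: sum_nonneg)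
qed

lemma levels_at_0: "levels_at g 0 \<kappa> m 0"
  by (simp add: levels_at_def)

lemma level_ready_agree:
  assumes "level_ready g m j r t"
    and "\<And>v. 0 \<le> v \<Longrightarrow> m' (cell S (level_lane g j) v) = m (cell S (level_lane g j) v)"
  shows "level_ready g m' j r t"
  using assms machine_at_cong unfolding level_ready_def by metis

lemma levels_at_extend:
  assumes "levels_at g j \<kappa> m c" "level_ready g m' j (\<kappa> j) t"
    and "\<And>i v. i < j \<Longrightarrow> 0 \<le> v \<Longrightarrow> m' (cell S (level_lane g i) v) = m (cell S (level_lane g i) v)"
  shows "levels_at g (Suc j) \<kappa> m' (c + int t)"
proof -
  obtain T where T: "\<And>i. i < j \<Longrightarrow> level_ready g m i (\<kappa> i) (T i)" "c = (\<Sum>i < j. int (T i))"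
    using assms(1) unfolding levels_at_def by blast
  have "level_ready g m' i (\<kappa> i) ((T(j := t)) i)" if "i < Suc j" for i
    using T(1)[of i] level_ready_agree[OF T(1) assms(3)] assms(2) that by (cases "i = j") auto
  with T(2) show ?thesis unfolding levels_at_def by (intro exI[of _ "T(j := t)"]) auto
qed

lemma levels_at_update:
  assumes "levels_at g J \<kappa> m c" "j < J"
  obtains t where "level_ready g m j (\<kappa> j) t"
    and "\<And>m' r u. level_ready g m' j r (t + u) \<Longrightarrow>
      (\<And>i v. i < J \<Longrightarrow> i \<noteq> j \<Longrightarrow> 0 \<le> v \<Longrightarrow>
        m' (cell S (level_lane g i) v) = m (cell S (level_lane g i) v)) \<Longrightarrow>
      levels_at g J (\<kappa>(j := r)) m' (c + int u)"
proof -
  obtain T where T: "\<And>i. i < J \<Longrightarrow> level_ready g m i (\<kappa> i) (T i)" "c = (\<Sum>i < J. int (T i))"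
    using assms(1) unfolding levels_at_def by blast
  show ?thesis
  proof (rule that)
    show "level_ready g m j (\<kappa> j) (T j)" by (rule T(1)[OF assms(2)])
    fix m' r u
    assume ready: "level_ready g m' j r (T j + u)"
      and others: "\<And>i v. i < J \<Longrightarrow> i \<noteq> j \<Longrightarrow> 0 \<le> v \<Longrightarrow>
        m' (cell S (level_lane g i) v) = m (cell S (level_lane g i) v)"
    have "level_ready g m' i ((\<kappa>(j := r)) i) ((T(j := T j + u)) i)" if "i < J" for i
      using ready level_ready_agree[OF T(1)[OF that] others[OF that]] by (cases "i = j") auto
    moreover have "(\<Sum>i < J. int ((T(j := T j + u)) i)) = c + int u"
      using assms(2) by (simp add: T(2) sum.remove[of "{..<J}" j])
    ultimately show "levels_at g J (\<kappa>(j := r)) m' (c + int u)"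
      unfolding levels_at_def by (intro exI[of _ "T(j := T j + u)"]) auto
  qed
qed

lemma phase_at_less:
  assumes "phase_at g J \<kappa> m c" "c < g * nn"
  shows "levels_at g J \<kappa> m c"
  using assms by (auto simp: phase_at_def exhausted_def)

lemma phase_at_levels:
  assumes "levels_at g J \<kappa> m (c + int u)" "c < g * nn" "u \<le> Y"
  shows "phase_at g J \<kappa> m (c + int u)"
  using assms levels_at_bound(1)[OF assms(1)] by (simp add: phase_at_def)

lemma phase_at_exhausted:
  assumes "phase_at g J \<kappa> m c" "J \<le> levels g" "g * nn \<le> c"
  shows "exhausted g c"
proof -
  have "int J * int Y \<le> int (levels g) * int Y" using assms(2) by (intro mult_right_mono) auto
  then show ?thesis
    using assms levels_at_bound(2)[of g J \<kappa> m c] by (auto simp: phase_at_def exhausted_def)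
qed

lemma phase_at_exit:
  assumes "phase_at g J \<kappa> m c" "J \<le> levels g" "J = levels g \<or> g * nn \<le> c"
  shows "phase_at g (levels g) \<kappa> m c"
  using assms phase_at_exhausted[OF assms(1,2)] by (auto simp: phase_at_def)

lemma exhausted_size:
  assumes "exhausted g c" "1 \<le> g"
  shows "2 * g \<le> G"
proof (rule abandoned_size[OF assms(2)])
  have "g * (g * nn) \<le> g * (int (levels g) * int Y)"
    using assms by (intro mult_left_mono) (auto simp: exhausted_def)
  also have "\<dots> = (int (levels g) * g) * int Y" by simp
  also have "\<dots> \<le> (n + g) * int Y"
    using levels_mult_less[OF assms(2)] by (intro mult_right_mono) auto
  finally show "g * (g * (n * n)) \<le> (n + g) * int Y" by (simp add: nn_def)
qed

lemma G_mult_mono: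
  assumes "1 \<le> g" "g \<le> G"
  shows "n * g \<le> n * G" "g * nn \<le> G * nn" "n \<le> n * g" "nn \<le> g * nn" "n * g \<le> g * nn"
proof -
  show "n * g \<le> n * G" "n \<le> n * g"
    using assms n_pos mult_left_mono[of g G n] mult_left_mono[of 1 g n] by simp_all
  have "g * n \<le> g * nn" using assms n_le_nn by (intro mult_left_mono) auto
  then show "n * g \<le> g * nn" by (simp add: mult.commute)
  show "g * nn \<le> G * nn" "nn \<le> g * nn"
    using assms n_pos n_le_nn mult_right_mono[of g G nn] mult_right_mono[of 1 g nn] by simp_all
qed

lemma size_bounds:
  assumes "1 \<le> g" "g \<le> G"
  shows "n * g + n < S" "n + g < S" "g * nn + int Y < 2 ^ b" "g * nn \<in> words b" "n * g \<in> words b"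
proof -
  note mono = G_mult_mono[OF assms]
  have "1 * g \<le> n * g" using assms n_pos by (intro mult_right_mono) auto
  then show "n * g + n < S" "n + g < S" using mono(1) G_lanes by simp_all
  show steps: "g * nn + int Y < 2 ^ b" using mono(2) steps_fit by (simp add: nn_def)
  then show "g * nn \<in> words b" using mono(4) n_le_nn n_pos by (intro nonneg_in_words) auto
  show "n * g \<in> words b"
    using steps mono(3,5) n_pos by (intro nonneg_in_words) linarith+
qed

lemma safe_levels_left:
  assumes "static_env V" "V rSize = g" "1 \<le> g" "g \<le> G"
  shows "safe b levels_left V m" "val levels_left V m \<noteq> 0 \<longleftrightarrow> V rStart < n \<and> V rSteps < g * nn"
  using assms size_bounds[OF assms(3,4)]
  by (auto simp: levels_left_def static_env_def of_bool_def split: if_splits)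

lemma cost_levels_left [simp]: "cost levels_left = 9"
  by (simp add: levels_left_def)

lemma level_lane_range:
  assumes "1 \<le> g" "g \<le> G" "j < levels g"
  shows "0 \<le> level_lane g j" "level_lane g j < S - 1" "n * g \<le> level_lane g j"
    "level_lane g j < n * g + n"
  using assms levels_le[OF assms(1)] size_bounds[OF assms(1,2)] n_pos by (auto simp: level_lane_def)

lemma level_lane_cells_subset:
  assumes "1 \<le> g" "g \<le> G" "j < levels g"
  shows "lane_cells S (level_lane g j) \<subseteq> phase_lanes g"
  using level_lane_range[OF assms] by (auto simp: phase_lanes_def)

lemma runs_next_level:
  assumes "V rStart = int j * g" "V rSize = g" "V rLane = level_lane g j"
    and g: "1 \<le> g" "g \<le> G" "j < levels g"
    and "Q (V(rStart := int (Suc j) * g, rLane := level_lane g (Suc j))) m" "6 \<le> T"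
  shows "runs b next_level rLane F T Q V m"
proof -
  have "int j * g < n" using g less_levels_iff[OF g(1)] by simp
  then have "int j * g + g \<in> words b"
    using g size_bounds[OF g(1,2)] S_fits by (intro nonneg_in_words) auto
  moreover have "level_lane g j + 1 \<in> words b"
    using level_lane_range[OF g] S_fits by (intro nonneg_in_words) auto
  ultimately show ?thesis unfolding next_level_def
    by (intro runs_assign_Seq runs_assign)
      (use assms in \<open>simp_all add: level_lane_def algebra_simps\<close>)
qed

lemma runs_level_iteration:
  assumes env: "static_env V" "V rSize = g" "V rStart = int j * g" "V rLane = level_lane g j"
    and g: "1 \<le> g" "g \<le> G" "j < levels g"
    and body: "runs b p rSteps F c (\<lambda>V' m'. R (V' rSteps) m') V m"
  shows "runs b (p ;; next_level) rLane F (c + 6) (\<lambda>V' m'. R (V' rSteps) m' \<and>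
    V' rStart = int (Suc j) * g \<and> V' rLane = level_lane g (Suc j)) V m"
proof (rule runs_Seq[OF body])
  fix V1 m1 assume frame: "agree_off {rSteps..} V V1" and "R (V1 rSteps) m1"
  then show "runs b next_level rLane F (c + 6 - c) (\<lambda>V' m'. R (V' rSteps) m' \<and>
      V' rStart = int (Suc j) * g \<and> V' rLane = level_lane g (Suc j)) V1 m1"
    using agree_offD[OF frame] env g by (intro runs_next_level[where j = j and g = g]) simp_all
qed auto

text \<open>An iteration takes \<open>16\<close> steps in addition to the body.\<close>

lemma runs_levels_loop:
  assumes env: "static_env V" "V rSize = g" "V rStart = 0" "V rLane = n * g" "1 \<le> g" "g \<le> G"
    and c: "\<And>j. 0 \<le> c j" and init: "P 0 (V rSteps) m"
    and body: "\<And>j V' m'. j < levels g \<Longrightarrow> static_env V' \<Longrightarrow> V' rSize = g \<Longrightarrow>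
      V' rStart = cut g j \<Longrightarrow> V' rLane = level_lane g j \<Longrightarrow> V' rSteps < g * nn \<Longrightarrow>
      agree_off F m m' \<Longrightarrow> P j (V' rSteps) m' \<Longrightarrow>
      runs b p rSteps F (c j) (\<lambda>V'' m''. P (Suc j) (V'' rSteps) m'') V' m'"
  shows "runs b (WHILE levels_left DO (p ;; next_level)) rLane F (10 + (\<Sum>j < levels g. c j + 16))
    (\<lambda>V' m'. \<exists>j \<le> levels g. P j (V' rSteps) m' \<and>
      (V' rStart < n \<longleftrightarrow> j < levels g) \<and> (j = levels g \<or> g * nn \<le> V' rSteps)) V m"
    (is "runs b _ _ _ ?T ?Q V m")
proof -
  define I where "I = (\<lambda>T V' m'. \<exists>j \<le> levels g. P j (V' rSteps) m' \<and>
    V' rStart = int j * g \<and> V' rLane = level_lane g j \<and> 10 + (\<Sum>i \<in> {j..<levels g}. c i + 16) \<le> T)"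
  show ?thesis
  proof (rule runs_loop[where measure = "\<lambda>V' _. nat (n - V' rStart)" and I = I])
    show "I ?T V m"
      using init env by (auto simp: I_def level_lane_def lessThan_atLeast0 intro!: exI[of _ 0])
    fix T V' m'
    assume frame: "agree_off {rLane..} V V'" "agree_off F m m'" and inv: "I T V' m'"
    have env': "static_env V'" "V' rSize = g"
      using static_env_agree[OF env(1) frame(1)] agree_offD[OF frame(1), of rSize] env(2)
      by simp_all
    note guard = safe_levels_left[OF env' env(5,6), of m']
    show "safe b levels_left V' m'" by (rule guard(1))
    obtain j where j: "j \<le> levels g" "V' rStart = int j * g" "V' rLane = level_lane g j"
      and P: "P j (V' rSteps) m'" and time: "10 + (\<Sum>i \<in> {j..<levels g}. c i + 16) \<le> T"
      using inv unfolding I_def by blast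
    have start: "V' rStart < n \<longleftrightarrow> j < levels g"
      using j(2) less_levels_iff[OF env(5)] by simp
    show "int (cost levels_left) + 1 \<le> T \<and> ?Q V' m'" if "val levels_left V' m' = 0"
    proof -
      have "0 \<le> (\<Sum>i \<in> {j..<levels g}. c i + 16)"
        using c by (intro sum_nonneg) (simp add: add_nonneg_nonneg)
      moreover have "j = levels g \<or> g * nn \<le> V' rSteps" using that guard(2) start j(1) by auto
      ultimately show ?thesis using time j(1) P start by auto
    qed
    assume "val levels_left V' m' \<noteq> 0"
    then have less: "j < levels g" "V' rSteps < g * nn" using guard(2) start by simp_all
    have "V' rStart = cut g j" using j(2) cut_less[OF env(5) less(1)] by simp
    note iteration = runs_level_iteration[OF env' j(2,3) env(5,6) less(1)
        body[OF less(1) env' this j(3) less(2) frame(2) P]]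
    show "\<exists>c'. runs b (p ;; next_level) rLane F c' (\<lambda>V'' m''.
        I (T - int (cost levels_left) - 1 - c') V'' m'' \<and>
            nat (n - V'' rStart) < nat (n - V' rStart)) V' m'"
      using less(1) time start j(2) env(5) sum.atLeast_Suc_lessThan[OF less(1), of "\<lambda>i. c i + 16"]
      unfolding I_def by (intro exI[of _ "c j + 6"] runs_mono[OF iteration] conjI exI[of _ "Suc j"])
        (auto simp: algebra_simps)
  qed
qed

lemma runs_for_levels:
  assumes env: "static_env V" "V rSize = g" "1 \<le> g" "g \<le> G"
    and c: "\<And>j. 0 \<le> c j" and init: "P 0 (V rSteps) m"
    and body: "\<And>j V' m'. j < levels g \<Longrightarrow> static_env V' \<Longrightarrow> V' rSize = g \<Longrightarrow>
      V' rStart = cut g j \<Longrightarrow> V' rLane = level_lane g j \<Longrightarrow> V' rSteps < g * nn \<Longrightarrow>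
      agree_off F m m' \<Longrightarrow> P j (V' rSteps) m' \<Longrightarrow>
      runs b p rSteps F (c j) (\<lambda>V'' m''. P (Suc j) (V'' rSteps) m'') V' m'"
    and T: "14 + (\<Sum>j < levels g. c j + 16) \<le> T"
  shows "runs b (for_levels p) rLane F T (\<lambda>V' m'. \<exists>j \<le> levels g. P j (V' rSteps) m' \<and>
    (V' rStart < n \<longleftrightarrow> j < levels g) \<and> (j = levels g \<or> g * nn \<le> V' rSteps)) V m"
    (is "runs b _ _ _ _ ?Q V m")
proof -
  let ?V = "V(rLane := n * g, rStart := 0)"
  have "runs b (WHILE levels_left DO (p ;; next_level)) rLane F
      (10 + (\<Sum>j < levels g. c j + 16)) ?Q ?V m"
    by (rule runs_levels_loop[where c = c and P = P]) (fact env c body | use env init in simp)+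
  then have "runs b (WHILE levels_left DO (p ;; next_level)) rLane F (T - 4) ?Q ?V m"
    by (rule runs_mono) (use T in auto)
  then show ?thesis unfolding for_levels_def
    using env size_bounds[OF env(3,4)]
    by (intro runs_assign_Seq) (simp_all add: static_env_def)
qed

lemma phase_lanes_ge_S:
  assumes "1 \<le> g"
  shows "phase_lanes g \<subseteq> {S..}"
  unfolding phase_lanes_def
proof (rule UN_least)
  fix l assume "l \<in> {n * g..<n * g + n}"
  moreover have "0 \<le> n * g" using assms n_pos by simp
  ultimately show "lane_cells S l \<subseteq> {S..}" by (intro lane_cells_ge_S) simp
qed

lemma fresh_from_next_lane:
  assumes "fresh_from l m" "agree_off (lane_cells S l) m m'" "0 \<le> l" "l < S"
  shows "fresh_from (l + 1) m'"
  unfolding fresh_from_def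
proof (intro allI impI)
  fix l' v :: int assume "l + 1 \<le> l' \<and> l' < S \<and> 0 \<le> v"
  then show "m' (cell S l' v) = 0"
    using agree_offD[OF assms(2) cell_notin_lane_cells[of l' S l v]] assms
    by (simp add: fresh_from_def)
qed

lemma fresh_from_agree:
  assumes "fresh_from l0 m" "agree_off (answer_cells \<union> phase_lanes g) m m'" "n * g + n \<le> l0"
    and "1 \<le> g"
  shows "fresh_from l0 m'"
  unfolding fresh_from_def
proof (intro allI impI)
  fix l v :: int assume l: "l0 \<le> l \<and> l < S \<and> 0 \<le> v"
  have pos: "0 \<le> n * g" using assms(4) n_pos by simp
  have "cell S l v \<notin> lane_cells S l'" if "l' \<in> {n * g..<n * g + n}" for l'
    using cell_notin_lane_cells[of l S l' v] that l assms(3) pos by auto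
  moreover have "cell S l v \<notin> answer_cells"
    using cell_ge_S[of v l] answer_cells_below_S l assms(3) pos n_pos by fastforce
  ultimately have "m' (cell S l v) = m (cell S l v)"
    by (intro agree_offD[OF assms(2)]) (auto simp: phase_lanes_def)
  then show "m' (cell S l v) = 0" using assms(1) l by (simp add: fresh_from_def)
qed

lemma runs_init_level:
  assumes env: "static_env V" "V rSize = g" "V rStart = cut g j" "V rLane = level_lane g j"
    and g: "1 \<le> g" "g \<le> G" "j < levels g" and steps: "0 \<le> V rSteps" "V rSteps < g * nn"
    and mem: "static_mem m" "fresh_from (level_lane g j) m"
  shows "runs b (load_level K ;; sim K pre) rSteps (lane_cells S (level_lane g j)) (80 * (g * n))
    (\<lambda>V' m'. \<exists>t. V' rSteps = V rSteps + int t \<and> level_ready g m' j N t) V m"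
proof -
  let ?l = "level_lane g j"
  have l: "0 \<le> ?l" "?l < S" using level_lane_range[OF g] by simp_all
  obtain t0 s where init: "exec b0 pre (init_state N (level_matrix g j)) t0 s"
    and serve: "can_serve (level_matrix g j) N s t0"
    using can_serve_init[OF boolean_bucket_matrix] unfolding level_matrix_def .
  have load: "runs b (load_level K) rEnd (lane_cells S ?l) (80 * (g * n))
      (\<lambda>_ m'. machine_at ?l m' (init_state N (level_matrix g j))) V m"
    unfolding level_matrix_def
    using env g l mem cut_range[OF g(1)] less_levels_iff[OF g(1)] size_bounds[OF g(1,2)]
      cut_less[OF g(1,3)]
    by (intro runs_load_level) (auto simp: fresh_from_def cut_def algebra_simps)
  show ?thesis
  proof (rule runs_Seq[OF load])
    fix V1 m1
    assume frame: "agree_off {rEnd..} V V1"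
      and machine: "machine_at ?l m1 (init_state N (level_matrix g j))"
    have V1: "V1 rSteps = V rSteps" "V1 rLane = ?l" "V1 rStride = S"
      using agree_offD[OF frame] env by (simp_all add: static_env_def)
    moreover have "t0 \<le> Y" using serve by (auto elim: can_serveE)
    ultimately have "can_simulate ?l t0 V1"
      using l steps size_bounds[OF g(1,2)] by (simp add: can_simulate_def)
    note sim = simulation_sim[OF init reg_bounds(1) machine this, unfolded simulation_def]
    have "level_ready g m' j N t0" if "machine_at ?l m' s" for m'
      using that serve unfolding level_ready_def by blast
    with V1(1) show "runs b (sim K pre) rSteps (lane_cells S ?l) (80 * (g * n) - 80 * (g * n))
        (\<lambda>V' m'. \<exists>t. V' rSteps = V rSteps + int t \<and> level_ready g m' j N t) V1 m1"
      by (intro runs_mono[OF sim]) auto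
  qed simp_all
qed

lemma runs_build_level:
  assumes env: "static_env V" "V rSize = g" "V rStart = cut g j" "V rLane = level_lane g j"
    and g: "1 \<le> g" "g \<le> G" "j < levels g" and steps: "V rSteps < g * nn"
    and mem: "static_mem m" "fresh_from (level_lane g j) m"
    and phase: "phase_at g j (\<lambda>_. N) m (V rSteps)"
  shows "runs b (load_level K ;; sim K pre) rSteps (phase_lanes g) (80 * (g * n))
    (\<lambda>V' m'. phase_at g (Suc j) (\<lambda>_. N) m' (V' rSteps) \<and> fresh_from (level_lane g (Suc j)) m') V m"
proof -
  let ?l = "level_lane g j"
  have l: "0 \<le> ?l" "?l < S" using level_lane_range[OF g] by simp_all
  have "0 \<le> V rSteps" using phase by (simp add: phase_at_def)
  note init = runs_init_level[OF env g this steps mem]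
  show ?thesis
  proof (rule runs_mono[OF init])
    show "lane_cells S ?l \<subseteq> phase_lanes g" by (rule level_lane_cells_subset[OF g])
    fix V' m'
    assume frame: "agree_off (lane_cells S ?l) m m'"
      and "\<exists>t. V' rSteps = V rSteps + int t \<and> level_ready g m' j N t"
    then obtain t where t: "V' rSteps = V rSteps + int t" "level_ready g m' j N t" by blast
    have "m' (cell S (level_lane g i) v) = m (cell S (level_lane g i) v)" if "i < j" "0 \<le> v" for i v
      using other_lane_agree[OF agree_off_mono[OF frame], of ?l "level_lane g i" v] l that g(3)
        level_lane_range[OF g(1,2), of i] by (simp add: level_lane_def)
    then have "levels_at g (Suc j) (\<lambda>_. N) m' (V rSteps + int t)"
      using levels_at_extend[OF phase_at_less[OF phase steps] t(2)] by simp
    then have "phase_at g (Suc j) (\<lambda>_. N) m' (V' rSteps)"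
      using phase_at_levels[OF _ steps level_ready_le[OF t(2)]] t(1) by simp
    moreover have "fresh_from (level_lane g (Suc j)) m'"
      using fresh_from_next_lane[OF mem(2) frame l] by (simp add: level_lane_def add_ac)
    ultimately show "phase_at g (Suc j) (\<lambda>_. N) m' (V' rSteps) \<and>
        fresh_from (level_lane g (Suc j)) m'" ..
  qed simp_all
qed

lemma build_time_sum:
  assumes "1 \<le> g" "g \<le> G"
  shows "14 + (\<Sum>j < levels g. 80 * (g * n) + 16) \<le> 220 * (g * nn) - 1"
proof -
  have "(\<Sum>j < levels g. 80 * (g * n) + 16) = 80 * ((int (levels g) * g) * n) + 16 * int (levels g)"
    by (simp add: algebra_simps)
  moreover have "(int (levels g) * g) * n \<le> (n + g) * n"
    using levels_mult_less[OF assms(1)] n_pos by (intro mult_right_mono) auto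
  moreover have "(n + g) * n = nn + n * g" by (simp add: nn_def algebra_simps)
  ultimately show ?thesis
    using levels_le[OF assms(1)] G_mult_mono[OF assms] n_pos by linarith
qed

lemma runs_build:
  assumes env: "static_env V" "V rSize = g" "1 \<le> g" "g \<le> G"
    and mem: "static_mem m" "fresh_from (n * g) m"
  shows "runs b (build K pre) rLane (phase_lanes g) (credit V + 220 * (g * nn))
    (\<lambda>V' m'. phase_at g (levels g) (\<lambda>_. N) m' (V' rSteps)) V m"
proof -
  let ?V = "V(rSteps := 0)"
  define P where "P = (\<lambda>j c m'. phase_at g j (\<lambda>_. N) m' c \<and> fresh_from (level_lane g j) m')"
  have "runs b (for_levels (load_level K ;; sim K pre)) rLane (phase_lanes g) (220 * (g * nn) - 1)
    (\<lambda>V' m'. \<exists>j \<le> levels g. P j (V' rSteps) m' \<and>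
    (V' rStart < n \<longleftrightarrow> j < levels g) \<and> (j = levels g \<or> g * nn \<le> V' rSteps)) ?V m"
  proof (rule runs_for_levels[OF _ _ env(3,4) _ _ _ build_time_sum[OF env(3,4)]])
    show "static_env ?V" using env(1) by simp
    have "0 \<le> g * nn" using env(3) n_pos n_le_nn by simp
    then show "P 0 (?V rSteps) m" using mem(2) levels_at_0
      by (simp add: P_def phase_at_def level_lane_def)
    fix j V' m'
    assume "j < levels g" "static_env V'" "V' rSize = g" "V' rStart = cut g j"
      "V' rLane = level_lane g j" "V' rSteps < g * nn" "agree_off (phase_lanes g) m m'"
      "P j (V' rSteps) m'"
    moreover from this have "static_mem m'"
      using static_mem_agree[OF mem(1)] phase_lanes_ge_S[OF env(3)] by blast
    ultimately show "runs b (load_level K ;; sim K pre) rSteps (phase_lanes g) (80 * (g * n))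
        (\<lambda>V'' m''. P (Suc j) (V'' rSteps) m'') V' m'"
      using env unfolding P_def by (intro runs_build_level) auto
  qed (use env n_pos in simp_all)
  note levels = this
  have "runs b (rSteps ::= Lit 0) rLane (phase_lanes g) (1 + credit V)
      (\<lambda>V' m'. V' = ?V \<and> m' = m) V m"
    by (intro runs_assign_credit) (auto simp: credit_def)
  then show ?thesis unfolding build_def
  proof (rule runs_Seq)
    fix V1 m1 assume "V1 = ?V \<and> m1 = m"
    then show "runs b (for_levels (load_level K ;; sim K pre)) rLane (phase_lanes g)
        (credit V + 220 * (g * nn) - (1 + credit V))
        (\<lambda>V' m'. phase_at g (levels g) (\<lambda>_. N) m' (V' rSteps)) V1 m1"
      by (elim conjE ssubst, intro runs_mono[OF levels]) (auto simp: P_def intro: phase_at_exit)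
  qed auto
qed

lemma level_ready_mono: "level_ready g m j r t \<Longrightarrow> r' \<le> r \<Longrightarrow> level_ready g m j r' t"
  unfolding level_ready_def using order_trans by blast

lemma levels_at_mono:
  "levels_at g J \<kappa> m c \<Longrightarrow> (\<And>j. \<kappa>' j \<le> \<kappa> j) \<Longrightarrow> levels_at g J \<kappa>' m c"
  unfolding levels_at_def using level_ready_mono by blast

lemma phase_at_mono:
  "phase_at g J \<kappa> m c \<Longrightarrow> (\<And>j. \<kappa>' j \<le> \<kappa> j) \<Longrightarrow> phase_at g J \<kappa>' m c"
  using levels_at_mono by (auto simp: phase_at_def)

lemma phase_cells_subset: "1 \<le> g \<Longrightarrow> answer_cells \<union> phase_lanes g \<subseteq> answer_cells \<union> {S..}"
  using phase_lanes_ge_S by blast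

abbreviation level_hit :: "(int \<Rightarrow> int) \<Rightarrow> int \<Rightarrow> nat \<Rightarrow> int \<Rightarrow> bool" where
  "level_hit q g j i \<equiv> \<exists>k. 0 \<le> k \<and> k < n \<and> hit q (cut g j) (cut g (Suc j)) k i"

abbreviation level_time :: "(int \<Rightarrow> int) \<Rightarrow> int \<Rightarrow> nat \<Rightarrow> int" where
  "level_time q g j \<equiv> 50 * g * straddle_count q (cut g j) (cut g (Suc j))"

lemma runs_query_ready_level:
  assumes env: "static_env V" "V rSize = g" "V rStart = cut g j" "V rLane = level_lane g j"
    and g: "1 \<le> g" "g \<le> G" "j < levels g" and steps: "0 \<le> V rSteps" "V rSteps < g * nn"
    and mem: "static_mem m" "has_query q m" "level_ready g m j (Suc r) t"
  shows "runs b (query_level K query) rSteps (answer_cells \<union> lane_cells S (level_lane g j))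
    (level_time q g j)
    (\<lambda>V' m'. \<exists>u. V' rSteps = V rSteps + int u \<and> level_ready g m' j r (t + u) \<and>
      marked (level_hit q g j) m m') V m"
proof -
  let ?l = "level_lane g j" and ?v = "query_vec q (cut g j) (cut g (Suc j))"
  have l: "0 \<le> ?l" "?l < S" using level_lane_range[OF g] by simp_all
  obtain s k where machine: "machine_at ?l m s" and k: "r \<le> k"
    and "can_serve (level_matrix g j) (Suc k) s t"
    using mem(3) unfolding level_ready_def by (metis Suc_le_D Suc_le_mono)
  then obtain u s' where exec: "exec b0 query (put_query N ?v s) u s'"
      "read_answer N s' = boolean_answer (level_matrix g j) ?v"
    and serve: "can_serve (level_matrix g j) k s' (t + (u + N))"
    using can_serve_step boolean_query_vec by metis
  have "u + N \<le> Y" using serve by (auto elim: can_serveE)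
  then have "V rSteps + int (u + N) < 2 ^ b"
    using steps(2) size_bounds(3)[OF g(1,2)] by linarith
  then have "can_simulate ?l (u + N) V"
    using env l steps(1) by (simp add: can_simulate_def static_env_def)
  then have query: "runs b (query_level K query) rSteps (answer_cells \<union> lane_cells S ?l)
    (level_time q g j)
    (\<lambda>V' m'. V' rSteps = V rSteps + int (u + N) \<and> machine_at ?l m' s' \<and>
      marked (level_hit q g j) m m') V m"
    using env g mem machine exec reg_bounds(2) cut_range[OF g(1)] cut_less[OF g(1,3)]
      less_levels_iff[OF g(1)] size_bounds[OF g(1,2)] unfolding level_matrix_def
    by (intro runs_query_level) (auto simp: cut_def algebra_simps)
  have "level_ready g m' j r (t + (u + N))" if "machine_at ?l m' s'" for m'
    using that serve k unfolding level_ready_def by blast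
  then show ?thesis by (intro runs_mono[OF query] exI[of _ "u + N"]) auto
qed

lemma runs_serve_level:
  assumes env: "static_env V" "V rSize = g" "V rStart = cut g j" "V rLane = level_lane g j"
    and g: "1 \<le> g" "g \<le> G" "j < levels g" and steps: "V rSteps < g * nn"
    and mem: "static_mem m" "has_query q m"
    and phase: "phase_at g (levels g) \<kappa> m (V rSteps)" "\<kappa> j = Suc r"
  shows "runs b (query_level K query) rSteps (answer_cells \<union> phase_lanes g) (level_time q g j)
    (\<lambda>V' m'. phase_at g (levels g) (\<kappa>(j := r)) m' (V' rSteps) \<and> marked (level_hit q g j) m m') V m"
proof -
  let ?l = "level_lane g j"
  have l: "0 \<le> ?l" "?l < S" using level_lane_range[OF g] by simp_all
  have steps_nonneg: "0 \<le> V rSteps" using phase(1) by (simp add: phase_at_def)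
  obtain t where ready: "level_ready g m j (Suc r) t"
    and update: "\<And>m' r u. level_ready g m' j r (t + u) \<Longrightarrow>
      (\<And>i v. i < levels g \<Longrightarrow> i \<noteq> j \<Longrightarrow> 0 \<le> v \<Longrightarrow>
        m' (cell S (level_lane g i) v) = m (cell S (level_lane g i) v)) \<Longrightarrow>
      levels_at g (levels g) (\<kappa>(j := r)) m' (V rSteps + int u)"
    using levels_at_update[OF phase_at_less[OF phase(1) steps] g(3)] phase(2) by metis
  show ?thesis
  proof (rule runs_mono[OF runs_query_ready_level[OF env g steps_nonneg steps mem ready]])
    show "answer_cells \<union> lane_cells S ?l \<subseteq> answer_cells \<union> phase_lanes g"
      using level_lane_cells_subset[OF g] by blast
    fix V' m'
    assume frame: "agree_off (answer_cells \<union> lane_cells S ?l) m m'"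
      and "\<exists>u. V' rSteps = V rSteps + int u \<and> level_ready g m' j r (t + u) \<and>
        marked (level_hit q g j) m m'"
    then obtain u where u: "V' rSteps = V rSteps + int u" "level_ready g m' j r (t + u)"
      and marks: "marked (level_hit q g j) m m'" by blast
    have "m' (cell S (level_lane g i) v) = m (cell S (level_lane g i) v)"
      if "i < levels g" "i \<noteq> j" "0 \<le> v" for i v
      using other_lane_agree[OF frame l, of "level_lane g i" v]
        level_lane_range[OF g(1,2) that(1)] that
      by (simp add: level_lane_def)
    with u(2) have "levels_at g (levels g) (\<kappa>(j := r)) m' (V rSteps + int u)" by (rule update)
    from phase_at_levels[OF this steps] level_ready_le[OF u(2)] u(1) marks
    show "phase_at g (levels g) (\<kappa>(j := r)) m' (V' rSteps) \<and> marked (level_hit q g j) m m'"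
      by simp
  qed simp_all
qed

lemma level_time_sum:
  assumes "1 \<le> g" "g \<le> G"
  shows "14 + (\<Sum>j < levels g. level_time q g j + 16) \<le> 150 * (n * g)"
proof -
  have "(\<Sum>j < levels g. level_time q g j) \<le> 50 * g * (2 * n)"
    using straddle_count_sum[OF assms(1), of q] assms(1)
    by (subst sum_distrib_left[symmetric]) (intro mult_left_mono, auto)
  moreover have "(\<Sum>j < levels g. level_time q g j + 16) =
      (\<Sum>j < levels g. level_time q g j) + 16 * int (levels g)"
    by (simp add: sum.distrib)
  moreover have "50 * g * (2 * n) = 100 * (n * g)" by simp
  ultimately show ?thesis
    using levels_le[OF assms(1)] G_mult_mono(3)[OF assms] n_pos by linarith
qed

definition level_result :: "int \<Rightarrow> nat \<Rightarrow> (int \<Rightarrow> int) \<Rightarrow> env \<Rightarrow> imem \<Rightarrow> bool" where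
  "level_result g r q V m \<longleftrightarrow> phase_at g (levels g) (\<lambda>_. r) m (V rSteps) \<and>
    (if V rStart < n then exhausted g (V rSteps) else answers q m)"

definition partly_served ::
  "imem \<Rightarrow> int \<Rightarrow> nat \<Rightarrow> (int \<Rightarrow> int) \<Rightarrow> nat \<Rightarrow> int \<Rightarrow> imem \<Rightarrow> bool" where
  "partly_served m g r q j c m' \<longleftrightarrow> phase_at g (levels g) (\<lambda>i. if i < j then r else Suc r) m' c \<and>
    marked (\<lambda>i. \<exists>k. 0 \<le> k \<and> k < n \<and> hit q 0 (cut g j) k i) m m'"

lemma runs_serve_next_level:
  assumes env: "static_env V" "V rSize = g" "V rStart = cut g j" "V rLane = level_lane g j"
    and g: "1 \<le> g" "g \<le> G" "j < levels g" and steps: "V rSteps < g * nn"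
    and mem: "static_mem m'" "has_query q m'" and served: "partly_served m g r q j (V rSteps) m'"
  shows "runs b (query_level K query) rSteps (answer_cells \<union> phase_lanes g) (level_time q g j)
    (\<lambda>V' m''. partly_served m g r q (Suc j) (V' rSteps) m'') V m'"
proof -
  let ?\<kappa> = "\<lambda>j i. if i < j then r else Suc r"
  have serve: "runs b (query_level K query) rSteps (answer_cells \<union> phase_lanes g) (level_time q g j)
    (\<lambda>V' m''. phase_at g (levels g) ((?\<kappa> j)(j := r)) m'' (V' rSteps) \<and>
      marked (level_hit q g j) m' m'') V m'"
    using env g steps mem served by (intro runs_serve_level) (auto simp: partly_served_def)
  have "(?\<kappa> j)(j := r) = ?\<kappa> (Suc j)" by (auto simp: less_Suc_eq)
  moreover have "marked (\<lambda>i. \<exists>k. 0 \<le> k \<and> k < n \<and> hit q 0 (cut g (Suc j)) k i) m m''"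
    if "marked (level_hit q g j) m' m''" for m''
    using marked_trans[OF conjunct2[OF served[unfolded partly_served_def]] that]
      hit_join[OF cut_range(1,3)[OF g(1)], of q j _]
    by (elim marked_cong) blast
  ultimately show ?thesis
    unfolding partly_served_def by (intro runs_mono[OF serve]) auto
qed

lemma level_result_if_partly_served:
  assumes "partly_served m g r q j (V rSteps) m'" "no_answer m" "1 \<le> g" "j \<le> levels g"
    and exit: "V rStart < n \<longleftrightarrow> j < levels g" "j = levels g \<or> g * nn \<le> V rSteps"
  shows "level_result g r q V m'"
proof -
  let ?\<kappa> = "\<lambda>i. if i < j then r else Suc r"
  have phase: "phase_at g (levels g) ?\<kappa> m' (V rSteps)"
    and marks: "marked (\<lambda>i. \<exists>k. 0 \<le> k \<and> k < n \<and> hit q 0 (cut g j) k i) m m'"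
    using assms(1) by (simp_all add: partly_served_def)
  have "phase_at g (levels g) (\<lambda>_. r) m' (V rSteps)" using phase by (rule phase_at_mono) simp
  moreover have "exhausted g (V rSteps)" if "j < levels g"
    using phase_at_exhausted[OF phase] exit(2) that by simp
  moreover have "answers q m'" if "j = levels g"
    using answers_if_marked[OF assms(2)] marks that cut_levels[OF assms(3)] by simp
  ultimately show ?thesis using assms(4) exit(1) by (auto simp: level_result_def)
qed

lemma runs_serve_levels:
  assumes env: "static_env V" "V rSize = g" "1 \<le> g" "g \<le> G"
    and mem: "static_mem m" "has_query q m" "no_answer m"
    and phase: "phase_at g (levels g) (\<lambda>_. Suc r) m (V rSteps)"
  shows "runs b (for_levels (query_level K query)) rLane (answer_cells \<union> phase_lanes g)
    (150 * (n * g)) (level_result g r q) V m"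
proof -
  have "runs b (for_levels (query_level K query)) rLane (answer_cells \<union> phase_lanes g)
    (150 * (n * g)) (\<lambda>V' m'. \<exists>j \<le> levels g. partly_served m g r q j (V' rSteps) m' \<and>
    (V' rStart < n \<longleftrightarrow> j < levels g) \<and> (j = levels g \<or> g * nn \<le> V' rSteps)) V m"
  proof (rule runs_for_levels[OF env _ _ _ level_time_sum[OF env(3,4)]])
    show "0 \<le> level_time q g j" for j using env(3) by (simp add: straddle_count_def)
    show "partly_served m g r q 0 (V rSteps) m"
      using phase by (simp add: partly_served_def hit_empty marked_refl)
    fix j V' m' assume frame: "agree_off (answer_cells \<union> phase_lanes g) m m'"
    assume "j < levels g" "static_env V'" "V' rSize = g" "V' rStart = cut g j"
      "V' rLane = level_lane g j" "V' rSteps < g * nn" "partly_served m g r q j (V' rSteps) m'"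
    then show "runs b (query_level K query) rSteps (answer_cells \<union> phase_lanes g) (level_time q g j)
        (\<lambda>V'' m''. partly_served m g r q (Suc j) (V'' rSteps) m'') V' m'"
      using env(3,4) static_mem_agree[OF mem(1) frame phase_cells_subset]
        has_query_agree[OF mem(2) frame phase_cells_subset]
      by (intro runs_serve_next_level) auto
  qed
  then show ?thesis
    by (rule runs_mono) (use level_result_if_partly_served[OF _ mem(3) env(3)] in auto)
qed

lemma phase_at_agree:
  assumes "phase_at g J \<kappa> m c" "\<And>x. S \<le> x \<Longrightarrow> m' x = m x" "1 \<le> g"
  shows "phase_at g J \<kappa> m' c"
proof -
  have "0 \<le> n * g" using assms(3) n_pos by simp
  then have "m' (cell S (level_lane g j) v) = m (cell S (level_lane g j) v)" if "0 \<le> v" for j v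
    using that by (intro assms(2) cell_ge_S) (simp_all add: level_lane_def)
  then show ?thesis
    using assms(1) level_ready_agree[of g m _ _ _ m'] unfolding phase_at_def levels_at_def by blast
qed

lemma fresh_from_above:
  assumes "fresh_from l0 m" "\<And>x. S \<le> x \<Longrightarrow> m' x = m x" "l0 \<le> l1" "0 \<le> l1"
  shows "fresh_from l1 m'"
  using assms(1,3,4) assms(2)[OF cell_ge_S] by (simp add: fresh_from_def)

lemma runs_query_levels:
  assumes env: "static_env V" "V rSize = g" "1 \<le> g" "g \<le> G"
    and mem: "static_mem m" "has_query q m"
    and phase: "phase_at g (levels g) (\<lambda>_. Suc r) m (V rSteps)"
  shows "runs b (query_levels K query) rLane (answer_cells \<union> phase_lanes g) (170 * (n * g))
    (level_result g r q) V m"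
  unfolding query_levels_def
proof (rule runs_Seq[OF runs_clear_answer[OF env(1)]])
  fix V1 m1
  assume frame: "agree_off {rRow..} V V1" "agree_off answer_cells m m1" and "no_answer m1"
  moreover have "m1 x = m x" if "S \<le> x" for x
    using agree_offD[OF frame(2)] answer_cells_below_S that by fastforce
  ultimately have serve: "runs b (for_levels (query_level K query)) rLane
      (answer_cells \<union> phase_lanes g) (150 * (n * g)) (level_result g r q) V1 m1"
    using env static_env_agree[OF env(1) frame(1)] agree_offD[OF frame(1)] phase_at_agree[OF phase]
      static_mem_agree[OF mem(1) frame(2)] has_query_agree[OF mem(2) frame(2)]
    by (intro runs_serve_levels) simp_all
  have "150 * (n * g) \<le> 170 * (n * g) - 20 * n" using G_mult_mono(3)[OF env(3,4)] by linarith
  then show "runs b (for_levels (query_level K query)) rLane (answer_cells \<union> phase_lanes g)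
      (170 * (n * g) - 20 * n) (level_result g r q) V1 m1"
    by (intro runs_mono[OF serve]) auto
qed auto

lemma runs_build_answers:
  assumes env: "static_env V" "V rSize = g" "1 \<le> g" "g \<le> G"
    and mem: "static_mem m" "fresh_from (n * g) m" "answers q m"
    and T: "credit V + 220 * (g * nn) \<le> T"
  shows "runs b (build K pre) rSize (answer_cells \<union> phase_lanes g) T
    (\<lambda>V' m'. V' rSize = g \<and> phase_at g (levels g) (\<lambda>_. N) m' (V' rSteps) \<and> answers q m') V m"
proof (rule runs_mono[OF runs_build[OF env mem(1,2)]])
  fix V' m'
  assume "agree_off {rLane..} V V'" "agree_off (phase_lanes g) m m'"
    "phase_at g (levels g) (\<lambda>_. N) m' (V' rSteps)"
  then show "V' rSize = g \<and> phase_at g (levels g) (\<lambda>_. N) m' (V' rSteps) \<and> answers q m'"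
    using agree_offD[of "{rLane..}" V V' rSize] env(2) answers_agree[OF mem(3)]
      phase_lanes_ge_S[OF env(3)] by simp
qed (use T in auto)

lemma runs_next_phase:
  assumes env: "static_env V" "V rSize = g" "1 \<le> g" "2 * g \<le> G"
    and mem: "static_mem m" "has_query q m" "fresh_from (2 * (n * g)) m"
  shows "runs b (next_phase K pre) rSize (answer_cells \<union> phase_lanes (2 * g))
    (credit V + 550 * (g * nn))
    (\<lambda>V' m'. V' rSize = 2 * g \<and> phase_at (2 * g) (levels (2 * g)) (\<lambda>_. N) m' (V' rSteps) \<and>
      answers q m') V m" (is "runs b _ _ ?F ?T ?Q V m")
  unfolding next_phase_def
proof (rule runs_Seq[OF runs_clear_answer[OF env(1)]])
  fix V1 m1
  assume frame1: "agree_off {rRow..} V V1" "agree_off answer_cells m m1" and "no_answer m1"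
  then have scan: "runs b scan_all rStart answer_cells (80 * nn)
      (\<lambda>V' m'. V' rSteps = V1 rSteps \<and> answers q m') V1 m1"
    using static_env_agree[OF env(1) frame1(1)] static_mem_agree[OF mem(1) frame1(2)]
      has_query_agree[OF mem(2) frame1(2)] by (intro runs_scan_all) simp_all
  show "runs b (scan_all ;; rSize ::= Var rSize +\<^sub>e Var rSize ;; build K pre) rSize ?F
      (?T - 20 * n) ?Q V1 m1"
  proof (rule runs_Seq[OF scan])
    fix V2 m2
    assume frame2: "agree_off {rStart..} V1 V2" "agree_off answer_cells m1 m2"
      and post: "V2 rSteps = V1 rSteps \<and> answers q m2"
    have frame: "agree_off {rStart..} V V2" "agree_off answer_cells m m2"
      using frame1 frame2 by (auto elim: agree_off_trans)
    have V2: "static_env V2" "V2 rSize = g" "V2 rSteps = V rSteps"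
      using static_env_agree[OF env(1) frame(1)] agree_offD[OF frame(1), of rSize] env(2)
        agree_offD[OF frame1(1), of rSteps] post by simp_all
    have "m2 x = m x" if "S \<le> x" for x
      using agree_offD[OF frame(2)] answer_cells_below_S that by fastforce
    then have "fresh_from (n * (2 * g)) m2"
      using fresh_from_above[OF mem(3)] env(3) n_pos by simp
    moreover have "static_mem m2" by (rule static_mem_agree[OF mem(1) frame(2)]) simp
    moreover have "2 * g \<in> words b"
      using size_bounds(2)[of "2 * g"] env(3,4) S_fits n_pos by (intro nonneg_in_words) auto
    moreover have "credit V + 220 * (2 * g * nn) \<le> ?T - 20 * n - 80 * nn - 3"
      using G_mult_mono(4)[OF env(3)] env(3,4) n_pos n_le_nn by linarith
    ultimately show "runs b (rSize ::= Var rSize +\<^sub>e Var rSize ;; build K pre) rSize ?F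
        (?T - 20 * n - 80 * nn) ?Q V2 m2"
      using V2 post env(3,4)
      by (intro runs_assign_Seq runs_build_answers) (simp_all add: credit_def)
  qed auto
qed auto

definition between_queries :: "int \<Rightarrow> nat \<Rightarrow> env \<Rightarrow> imem \<Rightarrow> bool" where
  "between_queries g r V m \<longleftrightarrow> static_env V \<and> V rSize = g \<and> static_mem m \<and>
    fresh_from (2 * (n * g)) m \<and> phase_at g (levels g) (\<lambda>_. r) m (V rSteps)"

text \<open>
  With bucket size \<open>2 ^ e\<close> and after \<open>d\<close> queries, the terms pay for building and abandoning the
  phases so far, for their simulated steps, and for scanning straddling buckets.
\<close>

definition potential :: "nat \<Rightarrow> int \<Rightarrow> int" where
  "potential e d = 1000 * (2 ^ e * nn) + 220 * (int e * int Y) + 200 * (d * (n * 2 ^ e))"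

definition query_inv :: "int \<Rightarrow> nat \<Rightarrow> int \<Rightarrow> int \<Rightarrow> env \<Rightarrow> imem \<Rightarrow> bool" where
  "query_inv T0 r d t V m \<longleftrightarrow>
    (\<exists>e. 2 ^ e \<le> G \<and> between_queries (2 ^ e) r V m \<and> t \<le> T0 + credit V + potential e d)"

lemma potential_next_query: "potential e (d + 1) = potential e d + 200 * (n * 2 ^ e)"
  by (simp add: potential_def algebra_simps)

lemma potential_next_phase:
  assumes "0 \<le> d"
  shows "potential e d + 1000 * (2 ^ e * nn) + 220 * int Y \<le> potential (Suc e) d"
proof -
  have "0 \<le> d * (n * 2 ^ e)" using assms n_pos by simp
  moreover have "d * (n * 2 ^ Suc e) = 2 * (d * (n * 2 ^ e))" by simp
  moreover have "int (Suc e) * int Y = int e * int Y + int Y" by (simp add: algebra_simps)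
  ultimately show ?thesis unfolding potential_def by simp
qed

lemma between_queriesI:
  assumes "static_env V" "agree_off {rSize..} V V'" "V' rSize = g"
    and "static_mem m" "fresh_from (2 * (n * g)) m" "agree_off (answer_cells \<union> phase_lanes g) m m'"
    and g: "1 \<le> g" "g \<le> G" and "phase_at g (levels g) (\<lambda>_. r) m' (V' rSteps)"
  shows "between_queries g r V' m'"
proof -
  have "n * g + n \<le> 2 * (n * g)" using G_mult_mono(3)[OF g] by linarith
  then have "fresh_from (2 * (n * g)) m'" by (rule fresh_from_agree[OF assms(5,6) _ g(1)])
  moreover have "static_mem m'"
    by (rule static_mem_agree[OF assms(4,6) phase_cells_subset[OF g(1)]])
  moreover have "static_env V'" using assms(1,2) by (rule static_env_agree) simp
  ultimately show ?thesis using assms by (simp add: between_queries_def)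
qed

lemma wp_next_phase:
  assumes e: "2 ^ e \<le> G" and between: "between_queries (2 ^ e) r V m"
    and "has_query q m" "exhausted (2 ^ e) (V rSteps)" "r \<le> N" "0 \<le> d"
    and t: "t \<le> T0 + credit V + potential e d + 180 * (n * 2 ^ e)"
  shows "wp b (next_phase K pre) (\<lambda>t' V' m'. query_inv T0 r (d + 1) t' V' m' \<and> answers q m') t V m"
proof -
  define g :: int where "g = 2 ^ e"
  have "1 \<le> g" by (simp add: g_def)
  with exhausted_size[OF assms(4)[folded g_def]]
  have g: "1 \<le> g" "2 * g \<le> G" "1 \<le> 2 * g" by simp_all
  have pre: "static_env V" "V rSize = g" "static_mem m" "fresh_from (2 * (n * g)) m"
    using between by (simp_all add: between_queries_def g_def)
  have fresh: "fresh_from (2 * (n * (2 * g))) m"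
    using fresh_from_above[OF pre(4)] g(1) n_pos by simp
  note phase = runs_next_phase[OF pre(1,2) g(1,2) pre(3) assms(3) pre(4)]
  show ?thesis
  proof (rule wp_runs[OF phase], elim conjE, intro conjI)
    fix t' V' m'
    assume time: "t' + credit V \<le> t + (credit V + 550 * (g * nn)) + credit V'"
      and frame: "agree_off {rSize..} V V'" "agree_off (answer_cells \<union> phase_lanes (2 * g)) m m'"
      and size: "V' rSize = 2 * g"
      and ready: "phase_at (2 * g) (levels (2 * g)) (\<lambda>_. N) m' (V' rSteps)"
    have "phase_at (2 * g) (levels (2 * g)) (\<lambda>_. r) m' (V' rSteps)"
      using ready by (rule phase_at_mono) (rule assms(5))
    then have "between_queries (2 ^ Suc e) r V' m'"
      using between_queriesI[OF pre(1) frame(1) size pre(3) fresh frame(2) g(3,2)]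
      by (simp add: g_def)
    moreover have "t' \<le> T0 + credit V' + potential (Suc e) (d + 1)"
    proof -
      have "credit V \<le> 220 * (g * nn) + 220 * int Y"
        using between by (simp add: between_queries_def phase_at_def credit_def g_def)
      moreover have "0 \<le> g * nn" "0 \<le> n * g" using g n_pos n_le_nn by simp_all
      ultimately show ?thesis
        using time t potential_next_query[of e d] potential_next_phase[of "d + 1" e] assms(6)
        by (simp add: g_def)
    qed
    ultimately show "query_inv T0 r (d + 1) t' V' m'"
      using g(2) unfolding query_inv_def g_def by (intro exI[of _ "Suc e"]) simp
  qed
qed

lemma wp_eq_query:
  assumes "query_inv T0 (Suc r) d t V m" "0 \<le> d" "r \<le> N" "has_query q m"
  shows "wp b (eq_query K pre query)
    (\<lambda>t' V' m'. query_inv T0 r (d + 1) t' V' m' \<and> answers q m') t V m"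
proof -
  obtain e where e: "1 \<le> (2::int) ^ e" "2 ^ e \<le> G"
    and between: "between_queries (2 ^ e) (Suc r) V m"
    and t: "t \<le> T0 + credit V + potential e d"
    using assms(1) unfolding query_inv_def by auto
  have start: "static_env V" "V rSize = 2 ^ e" "static_mem m" "fresh_from (2 * (n * 2 ^ e)) m"
    "phase_at (2 ^ e) (levels (2 ^ e)) (\<lambda>_. Suc r) m (V rSteps)"
    using between by (simp_all add: between_queries_def)
  show ?thesis unfolding eq_query_def
  proof (rule wp_Seq,
      rule wp_runs[OF runs_query_levels[OF start(1,2) e start(3) assms(4) start(5)]])
    fix t1 V1 m1
    assume "t1 + credit V \<le> t + 170 * (n * 2 ^ e) + credit V1"
      and frame: "agree_off {rLane..} V V1" "agree_off (answer_cells \<union> phase_lanes (2 ^ e)) m m1"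
      and result: "level_result (2 ^ e) r q V1 m1"
    with t have time: "t1 \<le> T0 + credit V1 + potential e d + 170 * (n * 2 ^ e)" by simp
    have "agree_off {rSize..} V V1" using frame(1) by (rule agree_off_mono) auto
    moreover have "V1 rSize = 2 ^ e" using agree_offD[OF frame(1), of rSize] start(2) by simp
    ultimately have between1: "between_queries (2 ^ e) r V1 m1"
      using result by (intro between_queriesI[OF start(1) _ _ start(3,4) frame(2) e])
        (simp_all add: level_result_def)
    then have n: "V1 rDim = n" by (simp add: between_queries_def static_env_def)
    have pos: "1 \<le> n * 2 ^ e" using G_mult_mono(3)[OF e] n_pos by linarith
    show "wp b (WHEN Var rStart <\<^sub>e Var rDim DO next_phase K pre)
        (\<lambda>t' V' m'. query_inv T0 r (d + 1) t' V' m' \<and> answers q m') t1 V1 m1"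
    proof (intro wp_cond wp_Skip wp_next_phase[OF e(2) between1])
      show "has_query q m1"
        by (rule has_query_agree[OF assms(4) frame(2) phase_cells_subset[OF e(1)]])
      show "exhausted (2 ^ e) (V1 rSteps)" if "val (Var rStart <\<^sub>e Var rDim) V1 m1 \<noteq> 0"
        using that result n by (auto simp: level_result_def split: if_splits)
      show "query_inv T0 r (d + 1) (t1 + int (cost (Var rStart <\<^sub>e Var rDim)) + 1 + 1) V1 m1 \<and>
          answers q m1"
        if "val (Var rStart <\<^sub>e Var rDim) V1 m1 = 0"
        using that result n between1 e time pos potential_next_query[of e d]
        unfolding query_inv_def
        by (auto simp: level_result_def intro!: exI[of _ e] split: if_splits)
    qed (use time pos assms in simp_all)
  qed
qed

lemma query_inv_put_query:
  assumes "query_inv T0 r d t V m" "agree_off {nn..<nn + n} m m'"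
  shows "query_inv T0 r d t V m'"
proof -
  have above: "m' x = m x" if "S \<le> x" for x
    using agree_offD[OF assms(2)] that tree_base_less_S n_le_nn n_pos by (simp add: region_defs)
  have "between_queries g r V m'" if between: "between_queries g r V m" and g: "1 \<le> g" for g
  proof -
    have "fresh_from (2 * (n * g)) m'"
      using between g n_pos
      by (intro fresh_from_above[OF _ above order_refl]) (simp_all add: between_queries_def)
    moreover have "phase_at g (levels g) (\<lambda>_. r) m' (V rSteps)"
      using between by (intro phase_at_agree[OF _ above g]) (simp_all add: between_queries_def)
    ultimately show ?thesis
      using between static_mem_put_query[OF _ assms(2)] by (simp add: between_queries_def)
  qed
  with assms(1) show ?thesis unfolding query_inv_def by (metis one_le_power one_le_numeral)
qed

lemma query_inv_time:
  assumes "query_inv T0 r n t V m"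
  shows "t \<le> T0 + 1420 * (G * nn) + 220 * (bitlen G * int Y)"
proof -
  obtain e where e: "2 ^ e \<le> G" "phase_at (2 ^ e) (levels (2 ^ e)) (\<lambda>_. r) m (V rSteps)"
    and t: "t \<le> T0 + credit V + potential e n"
    using assms unfolding query_inv_def between_queries_def by blast
  have "n * (n * 2 ^ e) = 2 ^ e * nn" by (simp add: nn_def)
  with t e(2) have "t \<le> T0 + 1420 * (2 ^ e * nn) + 220 * ((int e + 1) * int Y)"
    by (simp add: potential_def phase_at_def credit_def algebra_simps)
  moreover have "2 ^ e * nn \<le> G * nn" using e(1) n_le_nn n_pos by (intro mult_right_mono) auto
  moreover have "int e + 1 \<le> bitlen G" using e(1) G_pos bitlen_ge_iff_power[of "int e + 1" G]
    by (simp add: nat_add_distrib)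
  then have "(int e + 1) * int Y \<le> bitlen G * int Y" by (intro mult_right_mono) auto
  ultimately show ?thesis by simp
qed

lemma serves_eq_query:
  assumes A: "A \<in> carrier_mat N N" "\<And>i k. i < N \<Longrightarrow> k < N \<Longrightarrow> A $$ (i, k) = M (int i) (int k)"
    and "query_inv T0 (length vs) d t V m" "represents s V m" "0 \<le> d" "length vs \<le> N"
  shows "\<exists>u V' m'. serves b (eq_query K pre query) N (equality_answer A) s vs u \<and>
    query_inv T0 0 (d + int (length vs)) (t + int u) V' m'"
  using assms(3-)
proof (induction vs arbitrary: d t s V m)
  case Nil
  then show ?case by (intro exI[of _ 0] exI conjI serves.Nil) simp
next
  case (Cons v vs)
  obtain m1 where rep: "represents (put_query N v s) V m1"
    and frame: "agree_off {nn..<nn + n} m m1" and query: "has_query (\<lambda>k. v $ nat k) m1"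
    using put_query_represents[OF Cons.prems(2)] .
  have "query_inv T0 (Suc (length vs)) d t V m1"
    using query_inv_put_query[OF Cons.prems(1) frame] by simp
  from wp_eq_query[OF this Cons.prems(3) _ query] Cons.prems(4)
  have "wp b (eq_query K pre query) (\<lambda>t' V' m'. query_inv T0 (length vs) (d + 1) t' V' m' \<and>
      answers (\<lambda>k. v $ nat k) m') t V m1" by simp
  from wpD[OF this rep] obtain u s' V' m' where
    exec: "exec b (eq_query K pre query) (put_query N v s) u s'" and rep': "represents s' V' m'"
    and inv: "query_inv T0 (length vs) (d + 1) (t + int u) V' m'"
    and ans: "answers (\<lambda>k. v $ nat k) m'"
    unfolding reaches_def by blast
  have "read_answer N s' = equality_answer A v" by (rule read_answer_equality[OF rep' ans A])
  moreover obtain u' V'' m'' where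
    "serves b (eq_query K pre query) N (equality_answer A) s' vs u'"
    "query_inv T0 0 (d + 1 + int (length vs)) (t + int u + int u') V'' m''"
    using Cons.IH[OF inv rep'] Cons.prems(3,4) by auto
  ultimately have "serves b (eq_query K pre query) N (equality_answer A) s (v # vs) (u + u')"
    "query_inv T0 0 (d + int (length (v # vs))) (t + int (u + u')) V'' m''"
    using serves.Cons[OF exec] by (simp_all add: algebra_simps)
  then show ?case by blast
qed

lemma wp_first_phase:
  assumes env: "static_env V" and mem: "static_mem m" "fresh_from 0 m" and t: "t + 1 \<le> T0"
  shows "wp b (rSize ::= Lit 1 ;; build K pre) (query_inv T0 N 0) t V m"
proof (intro wp_Seq wp_assign)
  let ?V = "V(rSize := val (Lit 1) V m)"
  have env1: "static_env ?V" "?V rSize = 1"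
    using env by (simp_all add: static_env_def)
  have fresh: "fresh_from (n * 1) m" "fresh_from (2 * (n * 1)) m"
    using fresh_from_above[OF mem(2) refl] n_pos by simp_all
  show "wp b (build K pre) (query_inv T0 N 0) (t + int (cost (Lit 1))) ?V m"
  proof (rule wp_runs[OF runs_build[OF env1 order_refl G_pos mem(1) fresh(1)]])
    fix t' V' m'
    assume time: "t' + credit ?V \<le> t + int (cost (Lit 1)) + (credit ?V + 220 * (1 * nn)) +
        credit V'"
      and frame: "agree_off {rLane..} ?V V'" "agree_off (phase_lanes 1) m m'"
      and phase: "phase_at 1 (levels 1) (\<lambda>_. N) m' (V' rSteps)"
    have "agree_off {rSize..} ?V V'" using frame(1) by (rule agree_off_mono) auto
    moreover have "agree_off (answer_cells \<union> phase_lanes 1) m m'"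
      using frame(2) by (rule agree_off_mono) auto
    ultimately have "between_queries 1 N V' m'"
      using agree_offD[OF frame(1), of rSize] env1(1) mem(1) fresh(2) G_pos phase
      by (intro between_queriesI[where V = ?V and m = m]) simp_all
    moreover have "t' \<le> T0 + credit V' + potential 0 0"
      using time t n_pos n_le_nn by (simp add: potential_def)
    ultimately show "query_inv T0 N 0 t' V' m'"
      using G_pos unfolding query_inv_def by (intro exI[of _ 0]) simp
  qed
qed simp_all

lemma wp_first_phase_serves:
  assumes A: "A \<in> carrier_mat N N" "\<And>i k. i < N \<Longrightarrow> k < N \<Longrightarrow> A $$ (i, k) = M (int i) (int k)"
    and vs: "length vs = N"
    and "static_env V" "static_mem m" "fresh_from 0 m" "t + 1 \<le> T0"
  shows "wp b (rSize ::= Lit 1 ;; build K pre)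
    (serves_within A vs (T0 + 1420 * (G * nn) + 220 * (bitlen G * int Y))) t V m"
proof (rule wp_mono[OF wp_first_phase[OF assms(4-7)]])
  fix t' V' m' assume inv: "query_inv T0 N 0 t' V' m'"
  show "serves_within A vs (T0 + 1420 * (G * nn) + 220 * (bitlen G * int Y)) t' V' m'"
    unfolding serves_within_def
  proof (intro allI impI)
    fix s assume "represents s V' m'"
    then obtain u V'' m'' where "serves b (eq_query K pre query) N (equality_answer A) s vs u"
      "query_inv T0 0 (0 + int (length vs)) (t' + int u) V'' m''"
      using serves_eq_query[OF A, of T0 vs 0 t' V' m' s] inv vs by auto
    then show "\<exists>u. serves b (eq_query K pre query) N (equality_answer A) s vs u \<and>
        t' + int u \<le> T0 + 1420 * (G * nn) + 220 * (bitlen G * int Y)"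
      using vs int_N query_inv_time by auto
  qed
qed

end

definition setup_layout :: "nat \<Rightarrow> com" where
  "setup_layout C = rSquare ::= Var rDim *\<^sub>e Var rDim ;; rStride ::= Lit (int C) *\<^sub>e Var rSquare ;;
    rAnswer ::= Var rSquare +\<^sub>e Var rDim ;; rPerm ::= Var rAnswer +\<^sub>e Var rDim ;;
    rTree ::= Var rPerm +\<^sub>e Var rSquare"

definition eq_pre :: "nat \<Rightarrow> nat \<Rightarrow> com \<Rightarrow> com" where
  "eq_pre C K pre = setup_layout C ;; sort_columns ;; rSize ::= Lit 1 ;; build K pre"

lemma (in layout_lanes) runs_setup_layout:
  assumes "V rDim = n" "S = int C * nn" "S < 2 ^ b"
  shows "runs b (setup_layout C) rSquare {} 15
    (\<lambda>V' m'. static_env V' \<and> V' rSteps = V rSteps \<and> m' = m) V m"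
proof -
  have "int C * 1 \<le> int C * nn" using n_pos n_le_nn by (intro mult_left_mono) auto
  then have "int C < 2 ^ b" using assms(2,3) by linarith
  then have "int C \<in> words b" "S \<in> words b"
    using assms(3) S_pos by (intro nonneg_in_words; simp)+
  moreover have "nn \<in> words b" "answer_base \<in> words b" "perm_base \<in> words b" "tree_base \<in> words b"
    using n_pos n_le_nn by (auto simp: region_defs intro!: small_word)
  ultimately show ?thesis unfolding setup_layout_def
    by (intro runs_assign_Seq runs_assign)
      (use assms(1) in \<open>simp_all add: static_env_def region_defs add.commute[of "2 * n" nn]
        flip: nn_def assms(2)\<close>)
qed

context boolean_solver
begin

lemma wp_eq_pre:
  assumes A: "A \<in> carrier_mat (nat n) (nat n)"
      "\<And>i k. i < nat n \<Longrightarrow> k < nat n \<Longrightarrow> A $$ (i, k) = M (int i) (int k)"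
    and vs: "length vs = nat n" and S: "S = int C * nn" "S < 2 ^ b"
    and init: "V rDim = n" "has_matrix m" "\<And>x. nn \<le> x \<Longrightarrow> m x = 0"
  shows "wp b (eq_pre C K pre) (serves_within A vs (nn * (140 * depth + 130) +
    1420 * (G * nn) + 220 * (bitlen G * int Y))) 0 V m"
  unfolding eq_pre_def
proof (rule wp_Seq, rule wp_runs[OF runs_setup_layout[of V C m, OF init(1) S]], elim conjE)
  fix t1 V1 m1
  assume V1: "static_env V1" "V1 rSteps = V rSteps" "m1 = m"
    and t1: "t1 + credit V \<le> 0 + 15 + credit V1"
  have "tree_empty m" using init(3) n_pos n_le_nn
    by (simp add: tree_empty_def tree_def tree_base_def)
  note sort = runs_sort_columns[OF V1(1) init(2) this]
  show "wp b (sort_columns ;; rSize ::= Lit 1 ;; build K pre) (serves_within A vs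
      (nn * (140 * depth + 130) + 1420 * (G * nn) + 220 * (bitlen G * int Y))) t1 V1 m1"
    unfolding V1(3)
  proof (rule wp_Seq, rule wp_runs[OF sort])
    fix t2 V2 m2
    assume t2: "t2 + credit V1 \<le> t1 + (nn * (140 * depth + 107) + 5) + credit V2"
      and frame: "agree_off {rCol..} V1 V2" "agree_off {perm_base..<tree_base + 2 * n} m m2"
      and sorted: "\<forall>k. 0 \<le> k \<and> k < n \<longrightarrow> sorts n (column k) (perm m2 k)"
    interpret reduction n S b M K b0 pre query Y G "perm m2"
      by unfold_locales (use sorted in auto)
    have "has_matrix m2"
      using n_pos by (intro has_matrix_agree[OF init(2) frame(2)]) (auto simp: region_defs)
    then have "static_mem m2" by (simp add: static_mem_def)
    moreover have "fresh_from 0 m2"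
      unfolding fresh_from_def
    proof (intro allI impI)
      fix l v :: int assume "0 \<le> l \<and> l < S \<and> 0 \<le> v"
      then have "S \<le> cell S l v" by (intro cell_ge_S) auto
      then have "tree_base + 2 * n < cell S l v" "nn \<le> cell S l v"
        using tree_base_less_S n_pos n_le_nn by (simp_all add: region_defs)
      then show "m2 (cell S l v) = 0"
        using agree_offD[OF frame(2), of "cell S l v"] init(3) by simp
    qed
    moreover have "t2 + 1 \<le> nn * (140 * depth + 130)"
      using t1 t2 V1(2) credit_agree[OF frame(1)] n_le_nn n_pos
      by (simp add: credit_def algebra_simps)
    ultimately show "wp b (rSize ::= Lit 1 ;; build K pre) (serves_within A vs
        (nn * (140 * depth + 130) + 1420 * (G * nn) + 220 * (bitlen G * int Y))) t2 V2 m2"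
      using static_env_agree[OF V1(1) frame(1)] by (intro wp_first_phase_serves[OF A vs]) simp_all
  qed
qed

lemma eq_solves_instance:
  assumes A: "A \<in> carrier_mat (nat n) (nat n)"
      "\<And>i k. i < nat n \<Longrightarrow> k < nat n \<Longrightarrow> A $$ (i, k) = M (int i) (int k)"
    and vs: "length vs = nat n" and S: "S = int C * nn" "S < 2 ^ b"
  shows "\<exists>t0 s t. exec b (eq_pre C K pre) (init_state (nat n) A) t0 s \<and>
    serves b (eq_query K pre query) (nat n) (equality_answer A) s vs t \<and>
    int (t0 + t) \<le> nn * (140 * depth + 130) + 1420 * (G * nn) + 220 * (bitlen G * int Y)"
proof -
  let ?s = "init_state (nat n) A"
  let ?m = "\<lambda>x. snd ?s (nat x)"
  have nn: "nat n * nat n = nat nn" using n_pos by (simp add: nn_def nat_mult_distrib)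
  have matrix: "has_matrix ?m"
    unfolding has_matrix_def
  proof (intro allI impI)
    fix i k assume ik: "0 \<le> i \<and> i < n \<and> 0 \<le> k \<and> k < n"
    then have "nat (i * n + k) = nat i * nat n + nat k"
      by (simp add: nat_add_distrib nat_mult_distrib)
    moreover from ik have "nat i < nat n" "nat k < nat n" by auto
    moreover have "nat (i * n + k) < nat nn"
      using row_major_bound(2)[of i k] ik n_pos n_le_nn by simp
    ultimately show "?m (i * n + k) = M i k" using A(2)[of "nat i" "nat k"] ik nn
      by (simp add: init_state_def)
  qed
  have zero: "?m x = 0" if "nn \<le> x" for x using that nn by (simp add: init_state_def)
  have "fst ?s rDim = n" using n_pos by (simp add: init_state_def)
  note pre = wp_eq_pre[of A vs C "fst ?s" ?m, OF A vs S this matrix zero]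
  have "represents ?s (fst ?s) ?m" by (simp add: represents_def)
  from wpD[OF pre this] obtain u s' V' m' where
    exec: "exec b (eq_pre C K pre) ?s u s'" and rep: "represents s' V' m'"
    and serves: "serves_within A vs (nn * (140 * depth + 130) + 1420 * (G * nn) +
      220 * (bitlen G * int Y)) (0 + int u) V' m'"
    unfolding reaches_def by blast
  obtain u' where "serves b (eq_query K pre query) (nat n) (equality_answer A) s' vs u'"
    "int u + int u' \<le> nn * (140 * depth + 130) + 1420 * (G * nn) + 220 * (bitlen G * int Y)"
    using serves rep unfolding serves_within_def add_0 by blast
  with exec show ?thesis by (intro exI conjI) auto
qed

end


section \<open>Boolean-OMv needs quadratic time\<close>

lemma exec_changes_answer:
  assumes "exec b query (put_query n v s) t s'"
    and "\<And>i. i < n \<Longrightarrow> read_answer n s' $ i \<noteq> read_answer n s $ i"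
  shows "n \<le> t"
proof -
  let ?A = "(\<lambda>i. n * n + n + i) ` {..<n}"
  have "?A \<subseteq> changed_cells (put_query n v s) s'"
    using assms(2) by (auto simp: changed_cells_def read_answer_def put_query_def)
  moreover have "card ?A = n" by (simp add: card_image inj_on_def)
  ultimately show ?thesis
    using exec_changes_few_cells[OF assms(1)] card_mono[of "changed_cells (put_query n v s) s'" ?A]
    by linarith
qed

abbreviation bool_vec :: "nat \<Rightarrow> bool \<Rightarrow> int vec" where
  "bool_vec n x \<equiv> vec n (\<lambda>_. of_bool x)"

fun alternating :: "nat \<Rightarrow> nat \<Rightarrow> bool \<Rightarrow> int vec list" where
  "alternating n 0 x = []"
| "alternating n (Suc k) x = bool_vec n x # alternating n k (\<not> x)"

lemma length_alternating: "length (alternating n k x) = k"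
  by (induction k arbitrary: x) auto

lemma boolean_vec_alternating: "v \<in> set (alternating n k x) \<Longrightarrow> boolean_vec n v"
  by (induction k arbitrary: x)
    (auto simp: boolean_vec_def vec_set_def of_bool_def split: if_splits)

lemma boolean_answer_identity: "boolean_answer (1\<^sub>m n) (bool_vec n x) = bool_vec n x"
proof (rule eq_vecI)
  fix i assume "i < dim_vec (bool_vec n x)"
  then have "i < n" by simp
  then have "(\<exists>k < n. (1\<^sub>m n :: int mat) $$ (i, k) = 1 \<and> bool_vec n x $ k = (1::int)) \<longleftrightarrow> x"
    by (auto intro!: exI[of _ i])
  with \<open>i < n\<close> show "boolean_answer (1\<^sub>m n) (bool_vec n x) $ i = bool_vec n x $ i"
    by (simp add: boolean_answer_def)
qed (simp add: boolean_answer_def)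

lemma serves_alternating:
  assumes "serves b query n (boolean_answer (1\<^sub>m n)) s (alternating n k x) t"
    and "read_answer n s = bool_vec n (\<not> x)"
  shows "n * k \<le> t"
  using assms
proof (induction k arbitrary: x s t)
  case (Suc k)
  from Suc.prems(1) obtain u s' t' where exec: "exec b query (put_query n (bool_vec n x) s) u s'"
    and answer: "read_answer n s' = bool_vec n x" and "t = u + t'"
    and "serves b query n (boolean_answer (1\<^sub>m n)) s' (alternating n k (\<not> x)) t'"
    by cases (auto simp: boolean_answer_identity)
  moreover have "n \<le> u"
    using exec_changes_answer[OF exec] answer Suc.prems(2) by simp
  ultimately show ?case using Suc.IH[of s' "\<not> x" t'] by simp
qed simp

lemma boolean_omv_lower_bound:
  assumes solver: "solves_online {0, 1} boolean_answer pre query c T" and n: "1 \<le> n"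
  shows "n * (n - 1) \<le> T n"
proof -
  obtain k where k: "n = Suc k" using n by (cases n) auto
  have "int n < 2 ^ n" using of_nat_less_two_power by blast
  then have words: "int n \<in> words n" "{0, 1} \<subseteq> words n"
    using n by (auto intro!: nonneg_in_words)
  have "\<exists>t0 s t. exec (c * n) pre (init_state n (1\<^sub>m n)) t0 s \<and>
      serves (c * n) query n (boolean_answer (1\<^sub>m n)) s (alternating n n True) t \<and> t0 + t \<le> T n"
  proof (rule solver[unfolded solves_online_def, rule_format], intro conjI ballI)
    show "elements_mat (1\<^sub>m n) \<subseteq> {0, 1} \<inter> words n"
      using words(2) by (auto simp: elements_mat_def)
    show "v \<in> carrier_vec n" "vec_set v \<subseteq> {0, 1} \<inter> words n"
        if "v \<in> set (alternating n n True)" for v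
      using boolean_vec_alternating[OF that] words(2) by (auto simp: boolean_vec_def)
  qed (use n words(1) length_alternating in auto)
  then obtain s t where t: "t \<le> T n"
    and serves: "serves (c * n) query n (boolean_answer (1\<^sub>m n)) s (alternating n n True) t"
    using add_leD2 by blast
  have first: "alternating n n True = bool_vec n True # alternating n k False" by (simp add: k)
  from serves[unfolded first] obtain u s' t' where "t = u + t'" "read_answer n s' = bool_vec n True"
    "serves (c * n) query n (boolean_answer (1\<^sub>m n)) s' (alternating n k False) t'"
    by cases (use boolean_answer_identity[of n True] in auto)
  then show ?thesis using serves_alternating[of "c * n" query n s' k False t'] t k by simp
qed

lemma boolean_omv_exponent:
  assumes "solves_online {0, 1} boolean_answer pre query c T"
    and "(\<lambda>n. real (T n)) \<in> O(\<lambda>n. real n powr (3 - \<epsilon>))"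
  shows "\<epsilon> \<le> 1"
proof -
  have "real n powr 2 \<le> 2 * real (T n)" if "2 \<le> n" for n
  proof -
    have "n * n \<le> 2 * (n * (n - 1))" using that by (cases n) auto
    also have "\<dots> \<le> 2 * T n" using boolean_omv_lower_bound[OF assms(1), of n] that by simp
    finally have "real (n * n) \<le> real (2 * T n)" by (simp only: of_nat_le_iff)
    then show ?thesis using that by (simp add: powr_numeral power2_eq_square)
  qed
  then have "(\<lambda>n. real n powr 2) \<in> O(\<lambda>n. real (T n))"
    by (intro bigoI[of _ 2] eventually_sequentiallyI[of 2]) simp
  then have "(\<lambda>n. real n powr 2) \<in> O(\<lambda>n. real n powr (3 - \<epsilon>))"
    using assms(2) by (rule landau_o.big_trans)
  then have "2 \<le> 3 - \<epsilon>"
    using powr_bigo_iff[OF filterlim_real_sequentially sequentially_bot] by blast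
  then show ?thesis by simp
qed


section \<open>Choice of the parameters\<close>

lemma bigo_uniform_bound:
  fixes f g :: "nat \<Rightarrow> real"
  assumes "f \<in> O(g)" "\<And>n. 1 \<le> n \<Longrightarrow> 0 < g n"
  obtains C :: nat where "1 \<le> C" "\<And>n. 1 \<le> n \<Longrightarrow> f n \<le> real C * g n"
proof -
  obtain c where c: "0 < c" "eventually (\<lambda>n. norm (f n) \<le> c * norm (g n)) sequentially"
    using assms(1) by (rule landau_o.bigE)
  then obtain n0 where n0: "\<And>n. n0 \<le> n \<Longrightarrow> norm (f n) \<le> c * norm (g n)"
    unfolding eventually_sequentially by blast
  define C where "C = Suc (nat \<lceil>c + (\<Sum>n \<in> {1..<n0}. \<bar>f n\<bar> / g n)\<rceil>)"
  have sum: "0 \<le> (\<Sum>n \<in> {1..<n0}. \<bar>f n\<bar> / g n)" using assms(2)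
    by (intro sum_nonneg) (simp add: less_imp_le)
  have C: "c \<le> real C" "(\<Sum>n \<in> {1..<n0}. \<bar>f n\<bar> / g n) \<le> real C"
    using sum c(1) unfolding C_def by linarith+
  have "f n \<le> real C * g n" if n: "1 \<le> n" for n
  proof (cases "n0 \<le> n")
    case True
    then have "f n \<le> c * g n" using n0[OF True] assms(2)[OF n] by simp
    also have "\<dots> \<le> real C * g n" using C(1) assms(2)[OF n] by (intro mult_right_mono) auto
    finally show ?thesis .
  next
    case False
    have "\<bar>f n\<bar> / g n \<le> (\<Sum>n \<in> {1..<n0}. \<bar>f n\<bar> / g n)"
      using n False assms(2) by (intro member_le_sum) (auto simp: less_imp_le)
    with C(2) have "\<bar>f n\<bar> / g n \<le> real C" by simp
    then show ?thesis using assms(2)[OF n] by (simp add: pos_divide_le_eq abs_le_iff)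
  qed
  then show ?thesis by (intro that[of C]) (simp_all add: C_def)
qed

lemma abandoned_bucket_size:
  fixes n g Y C \<epsilon> :: real
  assumes "1 \<le> n" "1 \<le> C" "0 < \<epsilon>" "0 \<le> g"
    and abandoned: "g * (g * (n * n)) \<le> (n + g) * Y" and Y: "Y \<le> C * n powr (3 - \<epsilon>)"
  shows "g \<le> 2 * C * n powr (1 - \<epsilon> / 2)"
proof (rule ccontr)
  define P where "P = n powr (1 - \<epsilon> / 2)"
  assume "\<not> g \<le> 2 * C * n powr (1 - \<epsilon> / 2)"
  then have large: "2 * C * P < g" by (simp add: P_def)
  have P: "0 < P" "P \<le> n" using assms(1,3) powr_mono[of "1 - \<epsilon> / 2" 1 n] by (simp_all add: P_def)
  have "P \<le> C * P" using assms(2) P by simp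
  with large P have "P \<le> g" by linarith
  have CPP: "2 * (C * (P * P)) < g * P" using mult_strict_right_mono[OF large P(1)] by simp
  have "n powr (3 - \<epsilon>) = n powr (1 + (1 - \<epsilon> / 2) + (1 - \<epsilon> / 2))" by (simp add: algebra_simps)
  also have "\<dots> = n * (P * P)" unfolding powr_add P_def using assms(1) by simp
  finally have "Y \<le> n * (C * (P * P))" using Y by (simp add: mult_ac)
  then have "(n + g) * Y \<le> (n + g) * (n * (C * (P * P)))"
    using assms(1,4) by (intro mult_left_mono) auto
  also have "\<dots> = n * (n * (C * (P * P)) + g * (C * (P * P)))" by (simp add: algebra_simps)
  also have "\<dots> < n * (n * (g * g))"
  proof (rule mult_strict_left_mono)
    have "n * (2 * (C * (P * P))) < n * (g * P)" using CPP assms(1)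
      by (intro mult_strict_left_mono) auto
    also have "\<dots> \<le> n * (g * g)" using \<open>P \<le> g\<close> assms(1,4) by (intro mult_left_mono) auto
    finally have "n * (2 * (C * (P * P))) < n * (g * g)" .
    moreover have "g * (2 * (C * (P * P))) \<le> g * (g * P)" using CPP assms(4)
      by (intro mult_left_mono) auto
    moreover have "g * (g * P) \<le> g * (g * n)" using P(2) assms(4) by (intro mult_left_mono) auto
    ultimately show "n * (C * (P * P)) + g * (C * (P * P)) < n * (g * g)" by (simp add: mult_ac)
  qed (use assms(1) in simp)
  finally show False using abandoned by (simp add: mult_ac)
qed

lemma less_power_word_length:
  fixes x k :: int
  assumes "x \<le> k * (2 ^ w) ^ a" "k < 2 ^ z" "1 \<le> w" "a + z \<le> d"
  shows "x < 2 ^ (d * w)"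
proof -
  have "(2::int) ^ z \<le> (2 ^ w) ^ z"
    using assms(3) by (intro power_mono) (auto intro: self_le_power)
  with assms(2) have "k * (2 ^ w) ^ a < (2 ^ w) ^ z * (2 ^ w) ^ a"
    by (intro mult_strict_right_mono) auto
  also have "\<dots> = (2 ^ w) ^ (a + z)" by (simp add: power_add)
  also have "\<dots> \<le> (2 ^ w) ^ d" using assms(4) by (intro power_increasing) auto
  finally show ?thesis using assms(1) by (simp add: mult.commute flip: power_mult)
qed

lemma bitlen_bigo_powr:
  fixes f :: "nat \<Rightarrow> int"
  assumes "\<And>n. 1 \<le> n \<Longrightarrow> f n \<le> int D * int n" "1 \<le> D" "0 < a"
  shows "(\<lambda>n. real_of_int (bitlen (f n))) \<in> O(\<lambda>n. real n powr a)"
proof -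
  let ?c = "1 + real D powr a / (a * ln 2)"
  have "real_of_int (bitlen (f n)) \<le> ?c * real n powr a" if n: "1 \<le> n" for n
  proof (cases "0 < f n")
    case True
    have "f n \<le> int (D * n)" using assms(1)[OF n] by simp
    then have "real_of_int (f n) \<le> real (D * n)" by (metis of_int_le_iff of_int_of_nat_eq)
    with True have "log 2 (f n) \<le> log 2 (real (D * n))" by (intro log_mono) auto
    also have "\<dots> \<le> real (D * n) powr a / a / ln 2"
      unfolding log_def
    proof (intro divide_right_mono ln_powr_bound)
      have "1 * 1 \<le> real D * real n" using assms(2) n by (intro mult_mono) auto
      then show "1 \<le> real (D * n)" by simp
    qed (use assms(3) in auto)
    finally have "log 2 (f n) \<le> real D powr a / (a * ln 2) * real n powr a"
      by (simp add: powr_mult)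
    moreover have "real_of_int (bitlen (f n)) \<le> 1 + log 2 (f n)"
      using True by (simp add: bitlen_alt_def)
    moreover have "1 \<le> real n powr a" using n assms(3) by (simp add: ge_one_powr_ge_zero)
    ultimately show ?thesis by (simp add: algebra_simps)
  next
    case False
    then show ?thesis using assms(3) by (simp add: bitlen_alt_def)
  qed
  then show ?thesis
    by (intro bigoI[of _ ?c] eventually_sequentiallyI[of 1]) (simp add: bitlen_nonneg)
qed

locale boolean_omv_algorithm =
  fixes pre query :: com and c C :: nat and T :: "nat \<Rightarrow> nat" and \<epsilon> :: real
  assumes solver: "solves_online {0, 1} boolean_answer pre query c T"
    and eps: "0 < \<epsilon>" "\<epsilon> \<le> 1" and C_pos: "1 \<le> C"
    and time: "\<And>n. 1 \<le> n \<Longrightarrow> real (T n + n * n) \<le> real C * real n powr (3 - \<epsilon>)"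
begin

definition charge :: "nat \<Rightarrow> nat" where
  "charge n = T n + n * n"

definition max_size :: "nat \<Rightarrow> int" where
  "max_size n = \<lfloor>4 * real C * real n powr (1 - \<epsilon> / 2)\<rfloor>"

definition num_regs :: nat where
  "num_regs = Suc (max (reg_bound pre) (reg_bound query))"

definition stride_factor :: nat where
  "stride_factor = 4 * C + 12"

definition word_factor :: nat where
  "word_factor = c + 6 + ((num_regs + 3) * stride_factor + 5 * C)"

definition eq_time :: "nat \<Rightarrow> nat" where
  "eq_time n = nat (int n * int n * (140 * bitlen (2 * int n) + 130) +
    1420 * (max_size n * (int n * int n)) + 220 * (bitlen (max_size n) * int (charge n)))"

lemma max_size_pos: "1 \<le> n \<Longrightarrow> 1 \<le> max_size n"
proof -
  assume n: "1 \<le> n"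
  have "1 * 1 \<le> 4 * real C * real n powr (1 - \<epsilon> / 2)"
    using n eps C_pos by (intro mult_mono ge_one_powr_ge_zero) auto
  then show ?thesis unfolding max_size_def by linarith
qed

lemma max_size_linear: "1 \<le> n \<Longrightarrow> max_size n \<le> int (4 * C) * int n"
proof -
  assume n: "1 \<le> n"
  have "real n powr (1 - \<epsilon> / 2) \<le> real n" using n eps powr_mono[of "1 - \<epsilon> / 2" 1 "real n"] by simp
  then have "4 * real C * real n powr (1 - \<epsilon> / 2) \<le> 4 * real C * real n"
    by (intro mult_left_mono) auto
  then have "real_of_int (max_size n) \<le> real_of_int (int (4 * C) * int n)"
    unfolding max_size_def by simp linarith
  then show ?thesis by (simp only: of_int_le_iff)
qed

lemma charge_cubic: "1 \<le> n \<Longrightarrow> charge n \<le> C * n ^ 3"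
proof -
  assume n: "1 \<le> n"
  have "real (charge n) \<le> real C * real n powr (3 - \<epsilon>)" using time[OF n] by (simp add: charge_def)
  also have "\<dots> \<le> real C * real n powr 3" using n eps by (intro mult_left_mono powr_mono) auto
  also have "\<dots> = real (C * n ^ 3)" using n by (simp add: powr_numeral)
  finally show ?thesis by (simp only: of_nat_le_iff)
qed

lemma abandoned_size:
  assumes n: "1 \<le> n" and g: "1 \<le> g"
    and abandoned: "g * (g * (int n * int n)) \<le> (int n + g) * int (charge n)"
  shows "2 * g \<le> max_size n"
proof -
  have "real_of_int (g * (g * (int n * int n))) \<le> real_of_int ((int n + g) * int (charge n))"
    using abandoned by (simp only: of_int_le_iff)
  then have "real_of_int g \<le> 2 * real C * real n powr (1 - \<epsilon> / 2)"
    using n g eps C_pos time[OF n]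
    by (intro abandoned_bucket_size[of _ _ _ _ "real (charge n)"]) (simp_all add: charge_def)
  then show ?thesis unfolding max_size_def by (simp add: le_floor_iff)
qed

lemma solves_in_charge:
  assumes n: "1 \<le> n" "int n \<in> words w"
    and A: "boolean_mat n A" and vs: "length vs = n" "\<forall>v \<in> set vs. boolean_vec n v"
    and b0: "c * w \<le> b0"
  shows "\<exists>t0 s t. exec b0 pre (init_state n A) t0 s \<and>
    serves b0 query n (boolean_answer A) s vs t \<and> t0 + t + n * n \<le> charge n"
proof -
  have "int n < 2 ^ w" using n(2) unfolding words_def by (simp only: atLeastLessThan_iff)
  with n(1) have "(1::int) < 2 ^ w" by linarith
  then have bits: "{0, 1} \<subseteq> words w" by (auto intro!: nonneg_in_words)
  have "\<exists>t0 s t. exec (c * w) pre (init_state n A) t0 s \<and>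
      serves (c * w) query n (boolean_answer A) s vs t \<and> t0 + t \<le> T n"
    by (rule solver[unfolded solves_online_def, rule_format])
      (use n A vs bits in \<open>auto simp: boolean_mat_def boolean_vec_def\<close>)
  then show ?thesis
    using exec_mono_word_length[OF _ b0] serves_mono_word_length[OF _ b0]
    by (metis add_le_mono1 charge_def)
qed

lemma layout_word_length:
  assumes "1 \<le> n" "int n \<in> words w"
  shows "int n * int n + 2 * int n \<le> 2 ^ ((c + 4) * w)"
proof -
  have n: "1 \<le> int n" "int n \<le> 2 ^ w" using assms by (simp_all add: words_def)
  have w: "1 \<le> w" using assms by (cases w) (auto simp: words_def)
  have "int n \<le> int n ^ 2" using n by (simp add: self_le_power)
  moreover have "int n ^ 2 \<le> (2 ^ w) ^ 2" using n by (intro power_mono) auto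
  ultimately have "int n * int n + 2 * int n \<le> 3 * (2 ^ w) ^ 2" by (simp add: power2_eq_square)
  then show ?thesis using w by (intro less_imp_le[OF less_power_word_length[of _ 3 w 2 2]]) simp_all
qed

lemma lanes_word_length:
  assumes "1 \<le> n" "int n \<in> words w"
  shows "(2 ^ ((c + 4) * w) + int num_regs + 2) * (int stride_factor * (int n * int n)) \<le>
    2 ^ (word_factor * w)"
proof -
  let ?W = "2 ^ w :: int" and ?k = "(num_regs + 3) * stride_factor"
  have "int n \<le> ?W" using assms by (simp add: words_def)
  then have square: "int n * int n \<le> ?W ^ 2" unfolding power2_eq_square by (intro mult_mono) auto
  have w: "1 \<le> w" using assms by (cases w) (auto simp: words_def)
  have "(int num_regs + 2) * 1 \<le> (int num_regs + 2) * ?W ^ (c + 4)"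
    by (intro mult_left_mono) auto
  then have "2 ^ ((c + 4) * w) + int num_regs + 2 \<le> (int num_regs + 3) * ?W ^ (c + 4)"
    by (simp add: algebra_simps flip: power_mult)
  then have "(2 ^ ((c + 4) * w) + int num_regs + 2) * (int stride_factor * (int n * int n)) \<le>
      ((int num_regs + 3) * ?W ^ (c + 4)) * (int stride_factor * ?W ^ 2)"
    using square by (intro mult_mono) auto
  also have "\<dots> = int ?k * ?W ^ (c + 4 + 2)" by (simp add: power_add mult_ac)
  finally show ?thesis
  proof (rule less_imp_le[OF less_power_word_length[of _ "int ?k" w "c + 4 + 2" ?k]])
    show "int ?k < 2 ^ ?k" by (rule of_nat_less_two_power)
    show "c + 4 + 2 + ?k \<le> word_factor" by (simp add: word_factor_def)
  qed (rule w)
qed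

lemma steps_word_length:
  assumes "1 \<le> n" "int n \<in> words w"
  shows "max_size n * (int n * int n) + int (charge n) < 2 ^ (word_factor * w)"
proof -
  have w: "1 \<le> w" using assms by (cases w) (auto simp: words_def)
  have "max_size n * (int n * int n) \<le> int (4 * C) * int n * (int n * int n)"
    using max_size_linear[OF assms(1)] by (intro mult_right_mono) auto
  moreover have "int (charge n) \<le> int (C * n ^ 3)"
    using charge_cubic[OF assms(1)] by (simp only: of_nat_le_iff)
  ultimately have "max_size n * (int n * int n) + int (charge n) \<le> int (5 * C) * int n ^ 3"
    by (simp add: power3_eq_cube algebra_simps)
  also have "int n \<le> 2 ^ w" using assms by (simp add: words_def)
  then have "int (5 * C) * int n ^ 3 \<le> int (5 * C) * (2 ^ w) ^ 3"
    by (intro mult_left_mono power_mono) auto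
  finally show ?thesis
  proof (rule less_power_word_length[of _ "int (5 * C)" w 3 "5 * C"])
    show "int (5 * C) < 2 ^ (5 * C)" by (rule of_nat_less_two_power)
    show "3 + 5 * C \<le> word_factor" by (simp add: word_factor_def)
  qed (rule w)
qed

lemma boolean_solver_instance:
  assumes n: "1 \<le> n" "int n \<in> words w"
  shows "boolean_solver (int n) (int stride_factor * (int n * int n)) (word_factor * w) num_regs
    ((c + 4) * w) pre query (charge n) (max_size n)"
proof -
  let ?S = "int stride_factor * (int n * int n)"
  have nn: "int n \<le> int n * int n" using n(1) mult_right_mono[of 1 "int n" "int n"] by simp
  with n(1) have nn_pos: "1 \<le> int n * int n" by linarith
  have S: "?S = 4 * int C * (int n * int n) + 12 * (int n * int n)"
    by (simp add: stride_factor_def algebra_simps)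
  moreover have "0 \<le> 4 * int C * (int n * int n)" by simp
  ultimately have S_pos: "0 < ?S" "10 * (int n * int n) \<le> ?S" using nn_pos by linarith+
  have "1 * ?S \<le> (2 ^ ((c + 4) * w) + int num_regs + 2) * ?S"
    using S_pos by (intro mult_right_mono) auto
  then have S_le: "?S \<le> 2 ^ (word_factor * w)" using lanes_word_length[OF n] by simp
  interpret layout "int n" ?S "word_factor * w" M
    by unfold_locales (use n S_pos S_le in simp_all)
  show ?thesis
  proof
    show "(c + 4) * w \<le> word_factor * w" by (simp add: word_factor_def)
    show "nn + 2 * int n \<le> 2 ^ ((c + 4) * w)" using layout_word_length[OF n] by (simp add: nn_def)
    show "reg_bound pre \<le> num_regs" "reg_bound query \<le> num_regs" "1 \<le> num_regs"
      by (auto simp: num_regs_def)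
    have "int n * max_size n \<le> int n * (int (4 * C) * int n)"
      using max_size_linear[OF n(1)] by (intro mult_left_mono) auto
    then show "int n * max_size n + int n < ?S" using S nn nn_pos by (simp add: mult_ac)
  qed (use S_pos n lanes_word_length steps_word_length abandoned_size max_size_pos solves_in_charge
      in simp_all)
qed

lemma eq_solves_online:
  "solves_online UNIV equality_answer (eq_pre stride_factor num_regs pre)
    (eq_query num_regs pre query) word_factor eq_time"
  unfolding solves_online_def
proof (intro allI impI, elim conjE)
  fix n w :: nat and A :: "int mat" and vs :: "int vec list"
  assume n: "1 \<le> n" "int n \<in> words w" and A: "A \<in> carrier_mat n n" and vs: "length vs = n"
  interpret boolean_solver "int n" "int stride_factor * (int n * int n)" "word_factor * w"
    "\<lambda>i k. A $$ (nat i, nat k)" num_regs "(c + 4) * w" pre query "charge n" "max_size n"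
    by (rule boolean_solver_instance[OF n])
  have "int stride_factor * (int n * int n) < 2 ^ (word_factor * w)"
  proof -
    have "1 * S' < (2 ^ ((c + 4) * w) + int num_regs + 2) * S'" if "0 < S'" for S' :: int
      using that by (intro mult_strict_right_mono) (simp_all add: add_pos_nonneg)
    from this[OF S_pos] show ?thesis using lanes_fit by linarith
  qed
  then obtain t0 s t
    where "exec (word_factor * w) (eq_pre stride_factor num_regs pre) (init_state n A) t0 s"
    "serves (word_factor * w) (eq_query num_regs pre query) n (equality_answer A) s vs t"
    "int (t0 + t) \<le> nn * (140 * depth + 130) + 1420 * (max_size n * nn) +
      220 * (bitlen (max_size n) * int (charge n))"
    using eq_solves_instance[of A vs stride_factor] A vs by (auto simp: nn_def)
  then show "\<exists>t0 s t. exec (word_factor * w) (eq_pre stride_factor num_regs pre)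
      (init_state n A) t0 s \<and>
      serves (word_factor * w) (eq_query num_regs pre query) n (equality_answer A) s vs t \<and>
      t0 + t \<le> eq_time n"
    unfolding eq_time_def nn_def depth_def by (metis nat_int nat_mono)
qed

lemma max_size_bigo: "(\<lambda>n. real_of_int (max_size n)) \<in> O(\<lambda>n. real n powr (1 - \<epsilon> / 2))"
proof -
  have "real_of_int (max_size n) \<le> 4 * real C * real n powr (1 - \<epsilon> / 2)" for n
    by (simp add: max_size_def)
  then show ?thesis
    using max_size_pos
    by (intro bigoI[of _ "4 * real C"] eventually_sequentiallyI[of 1]) (fastforce simp: abs_of_pos)
qed

lemma charge_bigo: "(\<lambda>n. real (charge n)) \<in> O(\<lambda>n. real n powr (3 - \<epsilon>))"
  using time by (intro bigoI[of _ "real C"] eventually_sequentiallyI[of 1]) (auto simp: charge_def)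

lemma eq_time_bigo: "(\<lambda>n. real (eq_time n)) \<in> O(\<lambda>n. real n powr (3 - \<epsilon> / 2))"
proof -
  let ?p = "\<lambda>a n. real n powr a"
  let ?sort = "\<lambda>n. ?p 2 n * (140 * real_of_int (bitlen (2 * int n)) + 130 * 1)"
    and ?phases = "\<lambda>n. real_of_int (max_size n) * ?p 2 n"
    and ?simulation = "\<lambda>n. real_of_int (bitlen (max_size n)) * real (charge n)"
  have "(\<lambda>n. real_of_int (bitlen (2 * int n))) \<in> O(?p (1 / 2))"
    by (rule bitlen_bigo_powr[where D = 2]) auto
  moreover have "(\<lambda>_. 1) \<in> O(?p (1 / 2))"
    by (intro bigoI[of _ 1] eventually_sequentiallyI[of 1]) (auto simp: ge_one_powr_ge_zero)
  ultimately have sort: "?sort \<in> O(?p (2 + 1 / 2))"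
    unfolding powr_add by (intro landau_o.big.mult sum_in_bigo) simp_all
  have phases: "?phases \<in> O(?p (1 - \<epsilon> / 2 + 2))"
    unfolding powr_add using max_size_bigo by (intro landau_o.big.mult) simp_all
  have "(\<lambda>n. real_of_int (bitlen (max_size n))) \<in> O(?p (\<epsilon> / 2))"
    using max_size_linear C_pos eps by (intro bitlen_bigo_powr[where D = "4 * C"]) auto
  then have simulation: "?simulation \<in> O(?p (\<epsilon> / 2 + (3 - \<epsilon>)))"
    unfolding powr_add using charge_bigo by (rule landau_o.big.mult)
  have weaken: "f \<in> O(?p (3 - \<epsilon> / 2))" if "f \<in> O(?p a)" "a \<le> 3 - \<epsilon> / 2" for f a
    using that(2) landau_o.big_trans[OF that(1)]
    by (simp add: powr_bigo_iff[OF filterlim_real_sequentially sequentially_bot])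
  have "(\<lambda>n. ?sort n + 1420 * ?phases n + 220 * ?simulation n) \<in> O(?p (3 - \<epsilon> / 2))"
    using weaken[OF sort] weaken[OF phases] weaken[OF simulation] eps
    by (intro sum_in_bigo) simp_all
  moreover have "real (eq_time n) \<le> \<bar>?sort n + 1420 * ?phases n + 220 * ?simulation n\<bar>" for n
  proof -
    have "real (nat z) \<le> \<bar>real_of_int z\<bar>" for z by linarith
    from this[of "int n * int n * (140 * bitlen (2 * int n) + 130) +
        1420 * (max_size n * (int n * int n)) + 220 * (bitlen (max_size n) * int (charge n))"]
    show ?thesis unfolding eq_time_def by (simp add: power2_eq_square mult_ac)
  qed
  then have "(\<lambda>n. real (eq_time n)) \<in> O(\<lambda>n. ?sort n + 1420 * ?phases n + 220 * ?simulation n)"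
    by (intro bigoI[of _ 1]) simp
  ultimately show ?thesis by (rule landau_o.big_trans[rotated])
qed

end

theorem theorem3p1:
  fixes \<epsilon> :: real
  assumes "\<epsilon> > 0"
    and "Boolean_OMv_in_time_O (\<lambda>n. real n powr (3 - \<epsilon>))"
  shows "Ex_Equality_OMv_in_time_O (\<lambda>n. real n powr (3 - \<epsilon> / 2))"
proof -
  obtain pre query c T where solver: "solves_online {0, 1} boolean_answer pre query c T"
    and T: "(\<lambda>n. real (T n)) \<in> O(\<lambda>n. real n powr (3 - \<epsilon>))"
    using assms(2) unfolding Boolean_OMv_in_time_O_def solvable_in_time_O_def by blast
  have eps: "\<epsilon> \<le> 1" by (rule boolean_omv_exponent[OF solver T])
  have "(\<lambda>n. real n powr 2) \<in> O(\<lambda>n. real n powr (3 - \<epsilon>))"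
    using eps by (subst powr_bigo_iff) (simp_all add: filterlim_real_sequentially)
  then have "(\<lambda>n. real (T n + n * n)) \<in> O(\<lambda>n. real n powr (3 - \<epsilon>))"
    using T by (simp add: sum_in_bigo power2_eq_square)
  then obtain C where "1 \<le> C"
    "\<And>n. 1 \<le> n \<Longrightarrow> real (T n + n * n) \<le> real C * real n powr (3 - \<epsilon>)"
    by (rule bigo_uniform_bound) auto
  with solver assms(1) eps interpret boolean_omv_algorithm pre query c C T \<epsilon>
    by unfold_locales
  show ?thesis
    unfolding Ex_Equality_OMv_in_time_O_def solvable_in_time_O_def
    using eq_solves_online eq_time_bigo by blast
qed

end
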